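(* Assume the following. (A1) $\{\mathcal T_{g,n}:1\le g\le G_n\}$ is a partition of $\{1,\dots,n\}$ such that the collections $\{(u_{i,n},x_{i,n}'):i\in\mathcal T_{g,n}\}$ are independent over $g$ conditional on $\mathcal W_n$, and $\max_{1\le g\le G_n}\#\mathcal T_{g,n}=O(1)$. (A2) $\mathbb P[\lambda_{\min}(\sum_{i=1}^n w_{i,n}w_{i,n}')>0]\to1$, $\limsup_{n\to\infty}K_n/n<1$, $\mathcal C_n=O_p(1)$ and $\Sigma_n^{-1}=O_p(1)$. (A3) $\mathbb E[u_{i,n}|\mathcal X_n,\mathcal W_n]=0$ for all $i,n$, $\chi_n=O(1)$, and $\max_{1\le i\le n}\|\hat v_{i,n}\|/\sqrt n=o_p(1)$. If $$\|\kappa_n\|_\infty=\max_{(g_1,i_1,j_1)}\sum_{g_2=1}^{G_n}\sum_{i_2,j_2\in\mathcal T_{g_2,n}}|\kappa_{g_1,g_2,i_1,j_1,i_2,j_2,n}|=O_p(1),$$ then $$\hat\Sigma_n(\kappa_n)=\frac1n\sum_{g_1=1}^{G_n}\sum_{g_2=1}^{G_n}\sum_{g_3=1}^{G_n}\sum_{i_1,j_1\in\mathcal T_{g_1,n}}\sum_{i_2,j_2\in\mathcal T_{g_2,n}}\sum_{i_3,j_3\in\mathcal T_{g_3,n}}\kappa_{g_1,g_2,i_1,j_1,i_2,j_2,n}\,\hat v_{i_1,n}\hat v_{j_1,n}'M_{i_2j_3,n}M_{j_2i_3,n}\,\mathbb E[u_{i_3,n}u_{j_3,n}|\mathcal X_n,\mathcal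 W_n]+o_p(1).$$
   Context: All limits are as $n\to\infty$, in a triangular-array setting. For each $n$, the random data $\{(y_{i,n},x_{i,n}',w_{i,n}'):1\le i\le n\}$ are generated by $y_{i,n}=\beta'x_{i,n}+\gamma_n'w_{i,n}+u_{i,n}$, where $y_{i,n}$ is scalar, $x_{i,n}$ is $d\times1$ with $d$ fixed, $w_{i,n}$ is $K_n\times1$ ($K_n$ may grow with $n$), and $u_{i,n}$ is an unobserved scalar error. Put $\mathcal X_n=(x_{1,n},\dots,x_{n,n})$, $\mathcal W_n=(w_{1,n},\dots,w_{n,n})$. $\|\cdot\|$ is the Euclidean norm, $\lambda_{\min}(\cdot)$ the minimum eigenvalue, $\mathbb V$ the variance, $\#$ cardinality. $M_n=(M_{ij,n})$ is the $n\times n$ matrix $M_{ij,n}=\mathbf 1\{i=j\}-w_{i,n}'(\sum_{k=1}^n w_{k,n}w_{k,n}')^{-1}w_{j,n}$; $\hat v_{i,n}=\sum_{j=1}^nM_{ij,n}x_{j,n}$; the OLS estimator is $\hat\beta_n=(\sum_{i=1}^n\hat v_{i,n}\hat v_{i,n}')^{-1}\sum_{i=1}^n\hat v_{i,n}y_{i,n}$; residuals are $\hat u_{i,n}=\sum_{j=1}^nM_{ij,n}(y_{j,n}-\hat\beta_n'x_{j,n})$. $\Sigma_n=\mathbb V[\frac1{\sqrt n}\sum_{i=1}^n\hat v_{i,n}u_{i,n}|\mathcal X_n,\mathcal W_n]$. $v_{i,n}=x_{i,n}-(\sum_{j=1}^n\mathbb E[x_{j,n}w_{j,n}'])(\sum_{j=1}^n\mathbb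 E[w_{j,n}w_{j,n}'])^{-1}w_{i,n}$, $Q_{i,n}=\mathbb E[v_{i,n}|\mathcal W_n]$, $\chi_n=\frac1n\sum_{i=1}^n\mathbb E[\|Q_{i,n}\|^2]$. $V_{i,n}=x_{i,n}-\mathbb E[x_{i,n}|\mathcal W_n]$, $\tilde V_{i,n}=\sum_{j=1}^nM_{ij,n}V_{j,n}$, $\tilde\Gamma_n=\frac1n\sum_{i=1}^n\tilde V_{i,n}\tilde V_{i,n}'$, and $$\mathcal C_n=\max_{1\le i\le n}\{\mathbb E[u_{i,n}^4|\mathcal X_n,\mathcal W_n]+\mathbb E[\|V_{i,n}\|^4|\mathcal W_n]+1/\mathbb E[u_{i,n}^2|\mathcal X_n,\mathcal W_n]\}+1/\lambda_{\min}(\mathbb E[\tilde\Gamma_n|\mathcal W_n]).$$ Class of variance estimators: let $L_n=\sum_{g=1}^{G_n}(\#\mathcal T_{g,n})^2$ and let $\kappa_n=\kappa_n(w_{1,n},\dots,w_{n,n})$ be an $L_n\times L_n$ symmetric matrix that is a function of the $w_{i,n}$'s, whose rows and columns are indexed by triples $(g,i,j)$ with $1\le g\le G_n$, $i,j\in\mathcal T_{g,n}$ (ordered by cluster, then $i$, then $j$); $\kappa_{g_1,g_2,i_1,j_1,i_2,j_2,n}$ is its entry in row $(g_1,i_1,j_1)$ and column $(g_2,i_2,j_2)$. Define $$\hat\Sigma_n(\kappa_n)=\frac1n\sum_{g_1=1}^{G_n}\sum_{g_2=1}^{G_n}\sum_{i_1,j_1\in\mathcal T_{g_1,n}}\sum_{i_2,j_2\in\mathcal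 T_{g_2,n}}\kappa_{g_1,g_2,i_1,j_1,i_2,j_2,n}\hat v_{i_1,n}\hat v_{j_1,n}'\hat u_{i_2,n}\hat u_{j_2,n}.$$ *)

theory Defs
  imports
    "HOL-Probability.Probability"
    "HOL-Library.Landau_Symbols"
    "Jordan_Normal_Form.Char_Poly"
    "Jordan_Normal_Form.Gauss_Jordan_Elimination"
begin

text \<open>
  The regressors \<open>x\<close> have fixed dimension and live in \<open>real ^ 'd\<close>.  The dimension \<open>k\<close> of the
  controls varies along the array, so a control vector is a function on \<open>{..<k}\<close> and
  \<open>k \<times> k\<close> matrices are those of Jordan-Normal-Form.  In what follows \<open>$\<close> always means the
  component of a \<open>real ^ 'd\<close>.
\<close>

no_notation Matrix.vec_index (infixl "$" 100)

definition outer :: "real ^ 'd \<Rightarrow> real ^ 'd \<Rightarrow> real ^ 'd ^ 'd" where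
  "outer v w = (\<chi> a b. v $ a * w $ b)"

definition lambda_min :: "real ^ 'd ^ 'd \<Rightarrow> real" where
  "lambda_min A = Min {l. \<exists>v. v \<noteq> 0 \<and> A *v v = l *\<^sub>R v}"

definition lambda_min_mat :: "real Matrix.mat \<Rightarrow> real" where
  "lambda_min_mat A = Min {l. eigenvalue A l}"

text \<open>
  The value at singular matrices is a mere convention: it is only reached on events whose probability
  is assumed to vanish, and for finitely many \<open>n\<close> in the case of population Gram matrices.
\<close>

definition inv_mat :: "real Matrix.mat \<Rightarrow> real Matrix.mat" where
  "inv_mat A = (case mat_inverse A of Some B \<Rightarrow> B | None \<Rightarrow> 0\<^sub>m (dim_row A) (dim_row A))"

text \<open>
  Norm of the inverse. Since \<^const>\<open>matrix_inv\<close> takes an unspecified value at singular matrices,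
  the value there is set to infinity, so that boundedness of the inverse entails its existence.
\<close>

definition norm_inverse :: "real ^ 'd ^ 'd \<Rightarrow> ennreal" where
  "norm_inverse A = (if invertible A then ennreal (norm (matrix_inv A)) else \<infinity>)"

definition gram :: "nat \<Rightarrow> nat \<Rightarrow> (nat \<Rightarrow> nat \<Rightarrow> real) \<Rightarrow> real Matrix.mat" where
  "gram n k w = Matrix.mat k k (\<lambda>(a, b). \<Sum>i=1..n. w i a * w i b)"

definition annih :: "nat \<Rightarrow> nat \<Rightarrow> (nat \<Rightarrow> nat \<Rightarrow> real) \<Rightarrow> nat \<Rightarrow> nat \<Rightarrow> real" where
  "annih n k w i j =
     (if i = j then 1 else 0)
     - (\<Sum>a<k. \<Sum>b<k. w i a * inv_mat (gram n k w) $$ (a, b) * w j b)"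

definition partial_out ::
    "nat \<Rightarrow> nat \<Rightarrow> (nat \<Rightarrow> nat \<Rightarrow> real) \<Rightarrow> (nat \<Rightarrow> 'b::real_vector) \<Rightarrow> nat \<Rightarrow> 'b" where
  "partial_out n k w z i = (\<Sum>j=1..n. annih n k w i j *\<^sub>R z j)"

definition ols ::
    "nat \<Rightarrow> nat \<Rightarrow> (nat \<Rightarrow> nat \<Rightarrow> real) \<Rightarrow> (nat \<Rightarrow> real ^ 'd) \<Rightarrow> (nat \<Rightarrow> real) \<Rightarrow> real ^ 'd" where
  "ols n k w x y =
     matrix_inv (\<Sum>i=1..n. outer (partial_out n k w x i) (partial_out n k w x i))
       *v (\<Sum>i=1..n. y i *\<^sub>R partial_out n k w x i)"

definition residual ::
    "nat \<Rightarrow> nat \<Rightarrow> (nat \<Rightarrow> nat \<Rightarrow> real) \<Rightarrow> (nat \<Rightarrow> real ^ 'd) \<Rightarrow> (nat \<Rightarrow> real) \<Rightarrow> nat \<Rightarrow> real" where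
  "residual n k w x y = partial_out n k w (\<lambda>j. y j - ols n k w x y \<bullet> x j)"

text \<open>Rows and columns of a weight matrix are indexed by triples \<open>(g, i, j)\<close>.\<close>

type_synonym weights = "nat \<times> nat \<times> nat \<Rightarrow> nat \<times> nat \<times> nat \<Rightarrow> real"

definition idx :: "nat \<Rightarrow> (nat \<Rightarrow> nat set) \<Rightarrow> (nat \<times> nat \<times> nat) set" where
  "idx G T = (SIGMA g:{1..G}. T g \<times> T g)"

definition weights_norm :: "nat \<Rightarrow> (nat \<Rightarrow> nat set) \<Rightarrow> weights \<Rightarrow> real" where
  "weights_norm G T \<kappa> =
     Max ((\<lambda>p. \<Sum>g2=1..G. \<Sum>i2\<in>T g2. \<Sum>j2\<in>T g2. \<bar>\<kappa> p (g2, i2, j2)\<bar>) ` idx G T)"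

definition Sigma_hat ::
    "nat \<Rightarrow> nat \<Rightarrow> (nat \<Rightarrow> nat \<Rightarrow> real) \<Rightarrow> (nat \<Rightarrow> real ^ 'd) \<Rightarrow> (nat \<Rightarrow> real)
     \<Rightarrow> nat \<Rightarrow> (nat \<Rightarrow> nat set) \<Rightarrow> weights \<Rightarrow> real ^ 'd ^ 'd" where
  "Sigma_hat n k w x y G T \<kappa> =
     (1 / real n) *\<^sub>R
       (\<Sum>g1=1..G. \<Sum>g2=1..G. \<Sum>i1\<in>T g1. \<Sum>j1\<in>T g1. \<Sum>i2\<in>T g2. \<Sum>j2\<in>T g2.
          (\<kappa> (g1, i1, j1) (g2, i2, j2) * residual n k w x y i2 * residual n k w x y j2)
            *\<^sub>R outer (partial_out n k w x i1) (partial_out n k w x j1))"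

definition control_space :: "nat \<Rightarrow> nat \<Rightarrow> (nat \<Rightarrow> nat \<Rightarrow> real) measure" where
  "control_space n k = Pi\<^sub>M {1..n} (\<lambda>_. Pi\<^sub>M {..<k} (\<lambda>_. borel))"

definition sigma_W :: "'a measure \<Rightarrow> nat \<Rightarrow> nat \<Rightarrow> ('a \<Rightarrow> nat \<Rightarrow> nat \<Rightarrow> real) \<Rightarrow> 'a measure" where
  "sigma_W M n k w = vimage_algebra (space M) w (control_space n k)"

definition sigma_XW ::
    "'a measure \<Rightarrow> nat \<Rightarrow> nat \<Rightarrow> ('a \<Rightarrow> nat \<Rightarrow> real ^ 'd) \<Rightarrow> ('a \<Rightarrow> nat \<Rightarrow> nat \<Rightarrow> real) \<Rightarrow> 'a measure" where
  "sigma_XW M n k x w =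
     vimage_algebra (space M) (\<lambda>\<omega>. (x \<omega>, w \<omega>)) (Pi\<^sub>M {1..n} (\<lambda>_. borel) \<Otimes>\<^sub>M control_space n k)"

definition vec_cond_exp :: "'a measure \<Rightarrow> 'a measure \<Rightarrow> ('a \<Rightarrow> real ^ 'd) \<Rightarrow> 'a \<Rightarrow> real ^ 'd" where
  "vec_cond_exp M F f \<omega> = (\<chi> a. real_cond_exp M F (\<lambda>\<omega>. f \<omega> $ a) \<omega>)"

definition mat_cond_exp ::
    "'a measure \<Rightarrow> 'a measure \<Rightarrow> ('a \<Rightarrow> real ^ 'd ^ 'd) \<Rightarrow> 'a \<Rightarrow> real ^ 'd ^ 'd" where
  "mat_cond_exp M F f \<omega> = (\<chi> a b. real_cond_exp M F (\<lambda>\<omega>. f \<omega> $ a $ b) \<omega>)"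

definition cond_variance ::
    "'a measure \<Rightarrow> 'a measure \<Rightarrow> ('a \<Rightarrow> real ^ 'd) \<Rightarrow> 'a \<Rightarrow> real ^ 'd ^ 'd" where
  "cond_variance M F S =
     mat_cond_exp M F (\<lambda>\<omega>. outer (S \<omega> - vec_cond_exp M F S \<omega>) (S \<omega> - vec_cond_exp M F S \<omega>))"

text \<open>
  Conditional independence given \<open>F\<close> of a family of random elements \<open>Z g\<close> of \<open>N g\<close>; conditional
  probabilities are conditional expectations of indicators.
\<close>

definition cond_indep_vars ::
    "'a measure \<Rightarrow> 'a measure \<Rightarrow> ('i \<Rightarrow> 'b measure) \<Rightarrow> ('i \<Rightarrow> 'a \<Rightarrow> 'b) \<Rightarrow> 'i set \<Rightarrow> bool" where
  "cond_indep_vars M F N Z I \<longleftrightarrow>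
     (\<forall>g\<in>I. Z g \<in> measurable M (N g)) \<and>
     (\<forall>J\<subseteq>I. finite J \<longrightarrow> J \<noteq> {} \<longrightarrow> (\<forall>A\<in>(\<Pi> g\<in>J. sets (N g)).
        AE \<omega> in M.
          real_cond_exp M F (indicator {\<omega>\<in>space M. \<forall>g\<in>J. Z g \<omega> \<in> A g}) \<omega>
          = (\<Prod>g\<in>J. real_cond_exp M F (indicator {\<omega>\<in>space M. Z g \<omega> \<in> A g}) \<omega>)))"

definition V_dev ::
    "'a measure \<Rightarrow> nat \<Rightarrow> nat \<Rightarrow> ('a \<Rightarrow> nat \<Rightarrow> real ^ 'd) \<Rightarrow> ('a \<Rightarrow> nat \<Rightarrow> nat \<Rightarrow> real)
     \<Rightarrow> 'a \<Rightarrow> nat \<Rightarrow> real ^ 'd" where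
  "V_dev M n k x w \<omega> i = x \<omega> i - vec_cond_exp M (sigma_W M n k w) (\<lambda>\<omega>. x \<omega> i) \<omega>"

definition Gamma_tilde ::
    "'a measure \<Rightarrow> nat \<Rightarrow> nat \<Rightarrow> ('a \<Rightarrow> nat \<Rightarrow> real ^ 'd) \<Rightarrow> ('a \<Rightarrow> nat \<Rightarrow> nat \<Rightarrow> real)
     \<Rightarrow> 'a \<Rightarrow> real ^ 'd ^ 'd" where
  "Gamma_tilde M n k x w \<omega> =
     (1 / real n) *\<^sub>R
       (\<Sum>i=1..n. outer (partial_out n k (w \<omega>) (V_dev M n k x w \<omega>) i)
                       (partial_out n k (w \<omega>) (V_dev M n k x w \<omega>) i))"

text \<open>
  Extended-valued, so that infinite conditional moments, vanishing conditional error variances and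
  a singular conditional mean of \<^const>\<open>Gamma_tilde\<close> all give the value infinity.
\<close>

definition moment_bound ::
    "'a measure \<Rightarrow> nat \<Rightarrow> nat \<Rightarrow> ('a \<Rightarrow> nat \<Rightarrow> real ^ 'd) \<Rightarrow> ('a \<Rightarrow> nat \<Rightarrow> nat \<Rightarrow> real)
     \<Rightarrow> ('a \<Rightarrow> nat \<Rightarrow> real) \<Rightarrow> 'a \<Rightarrow> ennreal" where
  "moment_bound M n k x w u \<omega> =
     Max ((\<lambda>i.
         nn_cond_exp M (sigma_XW M n k x w) (\<lambda>\<omega>. ennreal (u \<omega> i ^ 4)) \<omega>
       + nn_cond_exp M (sigma_W M n k w) (\<lambda>\<omega>. ennreal (norm (V_dev M n k x w \<omega> i) ^ 4)) \<omega>
       + 1 / nn_cond_exp M (sigma_XW M n k x w) (\<lambda>\<omega>. ennreal ((u \<omega> i)\<^sup>2)) \<omega>) ` {1..n})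
     + 1 / ennreal (lambda_min (mat_cond_exp M (sigma_W M n k w) (Gamma_tilde M n k x w) \<omega>))"

definition Sigma_pop ::
    "'a measure \<Rightarrow> nat \<Rightarrow> nat \<Rightarrow> ('a \<Rightarrow> nat \<Rightarrow> real ^ 'd) \<Rightarrow> ('a \<Rightarrow> nat \<Rightarrow> nat \<Rightarrow> real)
     \<Rightarrow> ('a \<Rightarrow> nat \<Rightarrow> real) \<Rightarrow> 'a \<Rightarrow> real ^ 'd ^ 'd" where
  "Sigma_pop M n k x w u =
     cond_variance M (sigma_XW M n k x w)
       (\<lambda>\<omega>. (1 / sqrt (real n)) *\<^sub>R (\<Sum>i=1..n. u \<omega> i *\<^sub>R partial_out n k (w \<omega>) (x \<omega>) i))"

text \<open>Residual of \<open>x i\<close> after population linear projection on the controls.\<close>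

definition v_proj ::
    "'a measure \<Rightarrow> nat \<Rightarrow> nat \<Rightarrow> ('a \<Rightarrow> nat \<Rightarrow> real ^ 'd) \<Rightarrow> ('a \<Rightarrow> nat \<Rightarrow> nat \<Rightarrow> real)
     \<Rightarrow> 'a \<Rightarrow> nat \<Rightarrow> real ^ 'd" where
  "v_proj M n k x w \<omega> i =
     (let B = inv_mat (Matrix.mat k k (\<lambda>(a, b). \<Sum>j=1..n. \<integral>\<omega>. w \<omega> j a * w \<omega> j b \<partial>M))
      in x \<omega> i - (\<Sum>a<k. \<Sum>b<k.
           (B $$ (a, b) * w \<omega> i b) *\<^sub>R (\<chi> c. \<Sum>j=1..n. \<integral>\<omega>. x \<omega> j $ c * w \<omega> j a \<partial>M)))"

definition chi_pop ::
    "'a measure \<Rightarrow> nat \<Rightarrow> nat \<Rightarrow> ('a \<Rightarrow> nat \<Rightarrow> real ^ 'd) \<Rightarrow> ('a \<Rightarrow> nat \<Rightarrow> nat \<Rightarrow> real) \<Rightarrow> ennreal" where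
  "chi_pop M n k x w =
     ennreal (1 / real n) *
       (\<Sum>i=1..n. \<integral>\<^sup>+\<omega>. ennreal ((norm (vec_cond_exp M (sigma_W M n k w)
                                          (\<lambda>\<omega>. v_proj M n k x w \<omega> i) \<omega>))\<^sup>2) \<partial>M)"

text \<open>
  Both notions are stated through the probability of the favourable event: \<^const>\<open>measure\<close> is \<open>0\<close> on
  non-measurable sets, so they cannot hold merely for lack of measurability.
\<close>

definition bounded_in_prob :: "(nat \<Rightarrow> 'a measure) \<Rightarrow> (nat \<Rightarrow> 'a \<Rightarrow> ennreal) \<Rightarrow> bool" where
  "bounded_in_prob M Z \<longleftrightarrow>
     (\<forall>\<epsilon>>0. \<exists>B::real. \<forall>\<^sub>F n in sequentially.
        measure (M n) {\<omega>\<in>space (M n). Z n \<omega> \<le> ennreal B} \<ge> 1 - \<epsilon>)"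

definition null_in_prob :: "(nat \<Rightarrow> 'a measure) \<Rightarrow> (nat \<Rightarrow> 'a \<Rightarrow> 'b::real_normed_vector) \<Rightarrow> bool" where
  "null_in_prob M Z \<longleftrightarrow>
     (\<forall>\<epsilon>>0. (\<lambda>n. measure (M n) {\<omega>\<in>space (M n). norm (Z n \<omega>) \<le> \<epsilon>}) \<longlonglongrightarrow> 1)"

end

theory Submission
  imports Defs
begin

text \<open>
  Fix \<open>n\<close> and an event \<open>E\<close> in \<open>F = \<sigma>(X, W)\<close> on which the conditional fourth moments of the errors and
  the norm of \<open>\<kappa>\<close> are at most \<open>B\<close>, the Gram matrices of the controls and of the partialled-out regressors
  \<open>v i\<close> are invertible, \<open>max |v i|\<^sup>2 \<le> n \<delta>\<close> and \<open>\<Sum>|v i|\<^sup>2 \<le> n B\<close>.  An entry of the estimator is a quadratic form with weights \<open>Th\<close> in the residuals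
  \<open>M u - P u\<close>, where \<open>M\<close> annihilates the controls and \<open>P\<close> projects onto the span of the \<open>v i\<close>.  Since \<open>\<kappa>\<close>
  is symmetric, \<open>|Th i j| \<le> B \<delta>\<close> while \<open>\<Sum>|Th i j|\<close> stays bounded.  The terms with \<open>P u\<close> are controlled by
  the inequality \<open>2 |a b| \<le> s a\<^sup>2 + b\<^sup>2 / s\<close> with \<open>\<delta> = s\<^sup>2\<close>, because \<open>E |P u|\<^sup>2\<close> is bounded by the trace
  of \<open>P\<close>.  The remaining form has matrix \<open>M Th M\<close>, whose Frobenius norm does not exceed that of \<open>Th\<close>; after
  centring, its summands are orthogonal unless they involve the same pair of clusters, which bounds
  its second moment by a multiple of \<open>\<delta>\<close>.  The leverage condition allows \<open>\<delta> \<rightarrow> 0\<close>.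
\<close>

section \<open>Conditional independence of clusters\<close>

text \<open>Independence of the clusters is assumed given the controls W only, while the moment
  conditions and the weights refer to F, which also contains the regressors of every cluster. The
  bridge is that, for functions of the errors and regressors of one cluster, conditioning on F or on
  the larger algebra \<open>past g\<close> gives the same result. It is derived from uniqueness of
  finite measures on an intersection-stable generator, without conditional distributions. The second
  obstacle is that the errors are not assumed to have unconditional second moments. Every
  coefficient is therefore multiplied by the indicator of E; since E lies in F, conditional moments
  on E turn into bounds for ordinary integrals. The bound for the sum of |v i|^2 comes from writing
  x as V + Q plus a nonrandom combination of the controls, which partialling out removes. The order
  of choices matters: B is fixed first, from the admissible failure probability, and s only
  afterwards, because for fixed B the tail bound is of order s.\<close>

definition joint_sigma :: "'a measure \<Rightarrow> 'a measure \<Rightarrow> 'a measure" where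
  "joint_sigma A B = sigma (space A) {a \<inter> b |a b. a \<in> sets A \<and> b \<in> sets B}"

lemma space_joint_sigma: "space (joint_sigma A B) = space A"
  unfolding joint_sigma_def by (rule space_measure_of) (use sets.sets_into_space in blast)

lemma sets_joint_sigma:
  "sets (joint_sigma A B) = sigma_sets (space A) {a \<inter> b |a b. a \<in> sets A \<and> b \<in> sets B}"
  unfolding joint_sigma_def by (rule sets_measure_of) (use sets.sets_into_space in blast)

lemma subalgebra_joint_sigma:
  assumes "subalgebra M A" "subalgebra M B"
  shows "subalgebra M (joint_sigma A B)"
  unfolding subalgebra_def space_joint_sigma sets_joint_sigma
proof (intro conjI)
  show "space A = space M" using assms by (simp add: subalgebra_def)
  then show "sigma_sets (space A) {a \<inter> b |a b. a \<in> sets A \<and> b \<in> sets B} \<subseteq> sets M"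
    using assms by (simp add: subalgebra_def) (intro sets.sigma_sets_subset, blast)
qed

lemma subalgebra_joint_sigma_left:
  assumes "space A = space B"
  shows "subalgebra (joint_sigma A B) A"
  unfolding subalgebra_def space_joint_sigma sets_joint_sigma
proof (intro conjI refl subsetI)
  fix a assume a: "a \<in> sets A"
  then have "a = a \<inter> space B" using assms sets.sets_into_space by blast
  then show "a \<in> sigma_sets (space A) {a \<inter> b |a b. a \<in> sets A \<and> b \<in> sets B}"
    using a by (intro sigma_sets.Basic) blast
qed

lemma subalgebra_joint_sigma_right:
  assumes "space A = space B"
  shows "subalgebra (joint_sigma A B) B"
  unfolding subalgebra_def space_joint_sigma sets_joint_sigma
proof (intro conjI subsetI)
  fix b assume b: "b \<in> sets B"
  then have "b = space A \<inter> b" using assms sets.sets_into_space by blast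
  then show "b \<in> sigma_sets (space A) {a \<inter> b |a b. a \<in> sets A \<and> b \<in> sets B}"
    using b by (intro sigma_sets.Basic) blast
qed (simp add: assms)

text \<open>The densities f and g define two finite measures that agree on the intersection-stable
  generator E, hence on J, and h is integrated against both. They are restricted to J because E
  generates J and not the algebra of M.\<close>

lemma generated_nn_integral_cong:
  assumes J: "subalgebra M J" and gen: "sets J = sigma_sets (space M) E"
    and stable: "Int_stable E" and E: "E \<subseteq> Pow (space M)" and top: "space M \<in> E"
    and f [measurable]: "f \<in> borel_measurable M" and g [measurable]: "g \<in> borel_measurable M"
    and fin: "(\<integral>\<^sup>+\<omega>. f \<omega> \<partial>M) < \<infinity>"
    and eq: "\<And>X. X \<in> E \<Longrightarrow>
      (\<integral>\<^sup>+\<omega>. indicator X \<omega> * f \<omega> \<partial>M) = (\<integral>\<^sup>+\<omega>. indicator X \<omega> * g \<omega> \<partial>M)"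
    and h: "h \<in> borel_measurable J"
  shows "(\<integral>\<^sup>+\<omega>. h \<omega> * f \<omega> \<partial>M) = (\<integral>\<^sup>+\<omega>. h \<omega> * g \<omega> \<partial>M)"
proof -
  have Jf: "subalgebra (density M f) J" and Jg: "subalgebra (density M g) J"
    using J by (auto simp: subalgebra_def)
  have spJ: "space J = space M" using J by (simp add: subalgebra_def)
  have EJ: "X \<in> sets J" if "X \<in> E" for X
    unfolding gen by (rule sigma_sets.Basic[OF that])
  have EM: "X \<in> sets M" if "X \<in> E" for X
    using EJ[OF that] J by (auto simp: subalgebra_def)
  have em: "emeasure (restr_to_subalg (density M f) J) X = emeasure (restr_to_subalg (density M g) J) X"
    if "X \<in> E" for X
    using eq[OF that] EJ[OF that] EM[OF that]
    by (simp add: emeasure_restr_to_subalg[OF Jf] emeasure_restr_to_subalg[OF Jg] emeasure_density mult.commute)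
  have "restr_to_subalg (density M f) J = restr_to_subalg (density M g) J"
  \<comment> \<open>The whole space belongs to E and has finite measure, so a constant sequence
    serves as the exhaustion.\<close>
  proof (rule measure_eqI_generator_eq[where E = E and \<Omega> = "space M" and A = "\<lambda>_::nat. space M"])
    show "sets (restr_to_subalg (density M f) J) = sigma_sets (space M) E"
      "sets (restr_to_subalg (density M g) J) = sigma_sets (space M) E"
      by (simp_all add: sets_restr_to_subalg[OF Jf] sets_restr_to_subalg[OF Jg] gen)
    have "emeasure (density M f) (space M) = (\<integral>\<^sup>+\<omega>. f \<omega> \<partial>M)"
      by (subst emeasure_density) (auto intro!: nn_integral_cong)
    then show "emeasure (restr_to_subalg (density M f) J) (space M) \<noteq> \<infinity>" for i::nat
      using emeasure_restr_to_subalg[OF Jf sets.top] fin by (simp add: spJ)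
  qed (use em E top stable in auto)
  then have "(\<integral>\<^sup>+\<omega>. h \<omega> \<partial>density M f) = (\<integral>\<^sup>+\<omega>. h \<omega> \<partial>density M g)"
    using nn_integral_subalgebra2[OF Jf h] nn_integral_subalgebra2[OF Jg h] by simp
  then show ?thesis
    using measurable_from_subalg[OF J h] by (simp add: nn_integral_density mult.commute)
qed

text \<open>The sets a \<inter> b are stable under intersection, which the sets of A and B taken
  together are not in general; this is why \<open>joint_sigma\<close> is generated by them.
  Identities for conditional expectations given A and B jointly need to be tested on such sets
  only.\<close>

lemma joint_sigma_nn_integral_cong:
  assumes A: "subalgebra M A" and B: "subalgebra M B"
    and f: "f \<in> borel_measurable M" and g: "g \<in> borel_measurable M"
    and fin: "(\<integral>\<^sup>+\<omega>. f \<omega> \<partial>M) < \<infinity>"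
    and eq: "\<And>a b. a \<in> sets A \<Longrightarrow> b \<in> sets B \<Longrightarrow>
      (\<integral>\<^sup>+\<omega>. indicator (a \<inter> b) \<omega> * f \<omega> \<partial>M) = (\<integral>\<^sup>+\<omega>. indicator (a \<inter> b) \<omega> * g \<omega> \<partial>M)"
    and h: "h \<in> borel_measurable (joint_sigma A B)"
  shows "(\<integral>\<^sup>+\<omega>. h \<omega> * f \<omega> \<partial>M) = (\<integral>\<^sup>+\<omega>. h \<omega> * g \<omega> \<partial>M)"
proof (rule generated_nn_integral_cong[OF subalgebra_joint_sigma[OF A B], where E = "{a \<inter> b |a b. a \<in> sets A \<and> b \<in> sets B}"])
  let ?E = "{a \<inter> b |a b. a \<in> sets A \<and> b \<in> sets B}"
  have sp: "space A = space M" "space B = space M" using A B by (auto simp: subalgebra_def)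
  show "sets (joint_sigma A B) = sigma_sets (space M) ?E" by (simp add: sets_joint_sigma sp)
  show "Int_stable ?E"
  proof (rule Int_stableI)
    fix X Y assume "X \<in> ?E" "Y \<in> ?E"
    then obtain a b a' b' where "X = a \<inter> b" "a \<in> sets A" "b \<in> sets B"
      "Y = a' \<inter> b'" "a' \<in> sets A" "b' \<in> sets B" by auto
    then have "X \<inter> Y = (a \<inter> a') \<inter> (b \<inter> b')" "a \<inter> a' \<in> sets A" "b \<inter> b' \<in> sets B" by auto
    then show "X \<inter> Y \<in> ?E" by blast
  qed
  show "?E \<subseteq> Pow (space M)" using sets.sets_into_space[of _ A] sp by blast
  have "space A \<inter> space B \<in> ?E" by blast
  then show "space M \<in> ?E" unfolding sp by simp
qed (use assms in auto)

lemma (in prob_space) sigma_finite_subalgebraI: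
  "subalgebra M F \<Longrightarrow> sigma_finite_subalgebra M F"
  by (rule finite_measure_subalgebra_is_sigma_finite)
     (simp add: finite_measure_subalgebra_def finite_measure_subalgebra_axioms_def finite_measure_axioms)

section \<open>Conditional independence of two sigma-algebras given a third\<close>

locale cond_indep_algebras = prob_space M
  for M :: "'a measure" +
  fixes W A B :: "'a measure"
  assumes subW: "subalgebra M W" and subA: "subalgebra M A" and subB: "subalgebra M B"
    and cond_prob_Int: "\<And>a b. a \<in> sets A \<Longrightarrow> b \<in> sets B \<Longrightarrow>
      AE \<omega> in M. nn_cond_exp M W (indicator (a \<inter> b)) \<omega>
        = nn_cond_exp M W (indicator a) \<omega> * nn_cond_exp M W (indicator b) \<omega>"
begin

sublocale W: sigma_finite_subalgebra M W by (rule sigma_finite_subalgebraI[OF subW])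

lemma spaces: "space W = space M" "space A = space M" "space B = space M"
  using subW subA subB by (auto simp: subalgebra_def)

lemma nn_integral_indicator_le: "(\<integral>\<^sup>+\<omega>. indicator S \<omega> \<partial>M) < \<infinity>"
proof -
  have "(\<integral>\<^sup>+\<omega>. indicator S \<omega> \<partial>M) \<le> (\<integral>\<^sup>+\<omega>. 1 \<partial>M)"
    by (rule nn_integral_mono) (auto simp: indicator_def)
  then show ?thesis by (simp add: emeasure_space_1 order.strict_trans1)
qed

lemma in_M: "a \<in> sets A \<Longrightarrow> a \<in> sets M" "b \<in> sets B \<Longrightarrow> b \<in> sets M" "c \<in> sets W \<Longrightarrow> c \<in> sets M"
  using subW subA subB by (auto simp: subalgebra_def)

text \<open>The asymmetric form of conditional independence, P(a | W, B) = P(a | W). On a test set c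
  \<inter> b the factor c is W-measurable, so \<open>cond_prob_Int\<close> can be used under the
  integral, after which the conditioning on b is undone.\<close>

lemma nn_integral_indicator_block:
  assumes a: "a \<in> sets A" and k: "k \<in> borel_measurable (joint_sigma W B)"
  shows "(\<integral>\<^sup>+\<omega>. k \<omega> * indicator a \<omega> \<partial>M) = (\<integral>\<^sup>+\<omega>. k \<omega> * nn_cond_exp M W (indicator a) \<omega> \<partial>M)"
proof (rule joint_sigma_nn_integral_cong[OF subW subB _ _ nn_integral_indicator_le _ k])
  note [measurable] = in_M(1)[OF a]
  show "(indicator a :: 'a \<Rightarrow> ennreal) \<in> borel_measurable M"
    "nn_cond_exp M W (indicator a) \<in> borel_measurable M" by auto
  fix c b assume c [measurable]: "c \<in> sets W" and b: "b \<in> sets B"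
  note [measurable] = in_M(2)[OF b]
  have "(\<integral>\<^sup>+\<omega>. indicator (c \<inter> b) \<omega> * indicator a \<omega> \<partial>M) = (\<integral>\<^sup>+\<omega>. indicator c \<omega> * (indicator (a \<inter> b) \<omega> :: ennreal) \<partial>M)"
    by (rule nn_integral_cong) (auto simp: indicator_def)
  also have "\<dots> = (\<integral>\<^sup>+\<omega>. indicator c \<omega> * nn_cond_exp M W (indicator (a \<inter> b)) \<omega> \<partial>M)"
    by (rule W.nn_cond_exp_intg[symmetric]) auto
  also have "\<dots> = (\<integral>\<^sup>+\<omega>. (indicator c \<omega> * nn_cond_exp M W (indicator a) \<omega>) * nn_cond_exp M W (indicator b) \<omega> \<partial>M)"
    by (rule nn_integral_cong_AE) (use cond_prob_Int[OF a b] in \<open>auto simp: mult.assoc\<close>)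
  also have "\<dots> = (\<integral>\<^sup>+\<omega>. (indicator c \<omega> * nn_cond_exp M W (indicator a) \<omega>) * indicator b \<omega> \<partial>M)"
    by (rule W.nn_cond_exp_intg) auto
  also have "\<dots> = (\<integral>\<^sup>+\<omega>. indicator (c \<inter> b) \<omega> * nn_cond_exp M W (indicator a) \<omega> \<partial>M)"
    by (rule nn_integral_cong) (auto simp: indicator_def)
  finally show "(\<integral>\<^sup>+\<omega>. indicator (c \<inter> b) \<omega> * indicator a \<omega> \<partial>M)
    = (\<integral>\<^sup>+\<omega>. indicator (c \<inter> b) \<omega> * nn_cond_exp M W (indicator a) \<omega> \<partial>M)" .
qed

text \<open>Extends the previous identity from events of A to functions of W and A, in the form
  E[h | W, B] = E[h | W]. The argument works on the dual side: 1_S is replaced by P(S | W), tested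
  on the sets c \<inter> a, and self-adjointness of conditioning on W then moves the conditional
  expectation over to h.\<close>

lemma nn_integral_indicator_join:
  assumes S: "S \<in> sets (joint_sigma W B)" and h: "h \<in> borel_measurable (joint_sigma W A)"
  shows "(\<integral>\<^sup>+\<omega>. h \<omega> * indicator S \<omega> \<partial>M) = (\<integral>\<^sup>+\<omega>. nn_cond_exp M W h \<omega> * indicator S \<omega> \<partial>M)"
proof -
  have SM [measurable]: "S \<in> sets M" using S subalgebra_joint_sigma[OF subW subB] by (auto simp: subalgebra_def)
  have hM [measurable]: "h \<in> borel_measurable M"
    by (rule measurable_from_subalg[OF subalgebra_joint_sigma[OF subW subA] h])
  have "(\<integral>\<^sup>+\<omega>. h \<omega> * indicator S \<omega> \<partial>M) = (\<integral>\<^sup>+\<omega>. h \<omega> * nn_cond_exp M W (indicator S) \<omega> \<partial>M)"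
  proof (rule joint_sigma_nn_integral_cong[OF subW subA _ _ nn_integral_indicator_le _ h])
    fix c a assume c [measurable]: "c \<in> sets W" and a: "a \<in> sets A"
    note [measurable] = in_M(1)[OF a] in_M(3)[OF c]
    have "c \<in> sets (joint_sigma W B)"
      using c subalgebra_joint_sigma_left[of W B] spaces by (auto simp: subalgebra_def)
    then have k: "(\<lambda>\<omega>. indicator c \<omega> * indicator S \<omega> :: ennreal) \<in> borel_measurable (joint_sigma W B)"
      using S by auto
    have "(\<integral>\<^sup>+\<omega>. indicator (c \<inter> a) \<omega> * indicator S \<omega> \<partial>M)
        = (\<integral>\<^sup>+\<omega>. (indicator c \<omega> * indicator S \<omega>) * (indicator a \<omega> :: ennreal) \<partial>M)"
      by (rule nn_integral_cong) (auto simp: indicator_def)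
    also have "\<dots> = (\<integral>\<^sup>+\<omega>. (indicator c \<omega> * indicator S \<omega>) * nn_cond_exp M W (indicator a) \<omega> \<partial>M)"
      by (rule nn_integral_indicator_block[OF a k])
    also have "\<dots> = (\<integral>\<^sup>+\<omega>. (indicator c \<omega> * nn_cond_exp M W (indicator a) \<omega>) * indicator S \<omega> \<partial>M)"
      by (simp add: ac_simps)
    also have "\<dots> = (\<integral>\<^sup>+\<omega>. (indicator c \<omega> * nn_cond_exp M W (indicator a) \<omega>) * nn_cond_exp M W (indicator S) \<omega> \<partial>M)"
      by (rule W.nn_cond_exp_intg[symmetric]) auto
    also have "\<dots> = (\<integral>\<^sup>+\<omega>. (indicator c \<omega> * nn_cond_exp M W (indicator S) \<omega>) * nn_cond_exp M W (indicator a) \<omega> \<partial>M)"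
      by (simp add: ac_simps)
    also have "\<dots> = (\<integral>\<^sup>+\<omega>. (indicator c \<omega> * nn_cond_exp M W (indicator S) \<omega>) * indicator a \<omega> \<partial>M)"
      by (rule W.nn_cond_exp_intg) auto
    also have "\<dots> = (\<integral>\<^sup>+\<omega>. indicator (c \<inter> a) \<omega> * nn_cond_exp M W (indicator S) \<omega> \<partial>M)"
      by (rule nn_integral_cong) (auto simp: indicator_def)
    finally show "(\<integral>\<^sup>+\<omega>. indicator (c \<inter> a) \<omega> * indicator S \<omega> \<partial>M)
      = (\<integral>\<^sup>+\<omega>. indicator (c \<inter> a) \<omega> * nn_cond_exp M W (indicator S) \<omega> \<partial>M)" .
  qed auto
  also have "\<dots> = (\<integral>\<^sup>+\<omega>. nn_cond_exp M W (indicator S) \<omega> * nn_cond_exp M W h \<omega> \<partial>M)"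
    by (subst W.nn_cond_exp_intg) (auto simp: mult.commute)
  also have "\<dots> = (\<integral>\<^sup>+\<omega>. nn_cond_exp M W h \<omega> * nn_cond_exp M W (indicator S) \<omega> \<partial>M)"
    by (simp add: mult.commute)
  also have "\<dots> = (\<integral>\<^sup>+\<omega>. nn_cond_exp M W h \<omega> * indicator S \<omega> \<partial>M)"
    by (rule W.nn_cond_exp_intg) auto
  finally show ?thesis .
qed

text \<open>
  Enlarging \<open>W\<close> by a part \<open>A0\<close> of \<open>A\<close> preserves conditional independence, and any \<open>F\<close> between the
  enlargement and its join with \<open>B\<close> inherits the conditional expectation.
\<close>

lemma nn_cond_exp_enlarge:
  assumes A0: "subalgebra A A0" and f: "f \<in> borel_measurable (joint_sigma W A)"
    and G: "G = joint_sigma (joint_sigma W A0) B"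
    and F: "subalgebra G F" "subalgebra F (joint_sigma W A0)"
  shows "AE \<omega> in M. nn_cond_exp M G f \<omega> = nn_cond_exp M F f \<omega>"
proof -
  let ?L = "joint_sigma W A0"
  have subA0: "subalgebra M A0" using A0 subA by (auto simp: subalgebra_def)
  have subL: "subalgebra M ?L" by (rule subalgebra_joint_sigma[OF subW subA0])
  have subG: "subalgebra M G" unfolding G by (rule subalgebra_joint_sigma[OF subL subB])
  have subF: "subalgebra M F" using F(1) subG by (auto simp: subalgebra_def)
  have LW: "subalgebra ?L W" using spaces subA0 by (intro subalgebra_joint_sigma_left) (auto simp: subalgebra_def)
  have AL: "subalgebra (joint_sigma W A) ?L"
  proof -
    have "subalgebra (joint_sigma W A) W" "subalgebra (joint_sigma W A) A"
      using spaces by (auto intro: subalgebra_joint_sigma_left subalgebra_joint_sigma_right)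
    then have "subalgebra (joint_sigma W A) W" "subalgebra (joint_sigma W A) A0"
      using A0 by (auto simp: subalgebra_def)
    then show ?thesis by (rule subalgebra_joint_sigma)
  qed
  interpret L: sigma_finite_subalgebra M ?L by (rule sigma_finite_subalgebraI[OF subL])
  interpret G: sigma_finite_subalgebra M G by (rule sigma_finite_subalgebraI[OF subG])
  interpret F: sigma_finite_subalgebra M F by (rule sigma_finite_subalgebraI[OF subF])
  have J: "subalgebra M (joint_sigma W A)" by (rule subalgebra_joint_sigma[OF subW subA])
  have fM [measurable]: "f \<in> borel_measurable M" by (rule measurable_from_subalg[OF J f])
  \<comment> \<open>P(S | L) is also P(S | G). Tested on l \<inter> b, both integrands are functions
    of W and A times 1_b, so only their conditional expectations given W matter, and these agree by
    the tower property because W lies in L.\<close>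
  have indic: "(\<integral>\<^sup>+\<omega>. indicator T \<omega> * indicator S \<omega> \<partial>M) = (\<integral>\<^sup>+\<omega>. indicator T \<omega> * nn_cond_exp M ?L (indicator S) \<omega> \<partial>M)"
    if S: "S \<in> sets (joint_sigma W A)" and T: "T \<in> sets G" for S T
  proof (rule joint_sigma_nn_integral_cong[OF subL subB _ _ nn_integral_indicator_le])
    have SM [measurable]: "S \<in> sets M" using S J by (auto simp: subalgebra_def)
    show "(indicator S :: 'a \<Rightarrow> ennreal) \<in> borel_measurable M" "nn_cond_exp M ?L (indicator S) \<in> borel_measurable M"
      by auto
    show "(indicator T :: 'a \<Rightarrow> ennreal) \<in> borel_measurable (joint_sigma ?L B)" using T unfolding G by auto
    fix l b assume l [measurable]: "l \<in> sets ?L" and b: "b \<in> sets B"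
    have bJ: "b \<in> sets (joint_sigma W B)"
      using subalgebra_joint_sigma_right[of W B] spaces b by (auto simp: subalgebra_def)
    have lJ: "l \<in> sets (joint_sigma W A)" using l AL by (auto simp: subalgebra_def)
    have lM [measurable]: "l \<in> sets M" using l subL by (auto simp: subalgebra_def)
    have m1: "(\<lambda>\<omega>. indicator l \<omega> * indicator S \<omega> :: ennreal) \<in> borel_measurable (joint_sigma W A)"
      using lJ S by auto
    have m2: "(\<lambda>\<omega>. indicator l \<omega> * nn_cond_exp M ?L (indicator S) \<omega>) \<in> borel_measurable (joint_sigma W A)"
      by (rule measurable_from_subalg[OF AL]) auto
    have "(\<integral>\<^sup>+\<omega>. indicator (l \<inter> b) \<omega> * indicator S \<omega> \<partial>M)
        = (\<integral>\<^sup>+\<omega>. (indicator l \<omega> * indicator S \<omega>) * (indicator b \<omega> :: ennreal) \<partial>M)"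
      by (rule nn_integral_cong) (auto simp: indicator_def)
    also have "\<dots> = (\<integral>\<^sup>+\<omega>. nn_cond_exp M W (\<lambda>\<omega>. indicator l \<omega> * indicator S \<omega>) \<omega> * indicator b \<omega> \<partial>M)"
      by (rule nn_integral_indicator_join[OF bJ m1])
    also have "\<dots> = (\<integral>\<^sup>+\<omega>. nn_cond_exp M W (\<lambda>\<omega>. indicator l \<omega> * nn_cond_exp M ?L (indicator S) \<omega>) \<omega> * indicator b \<omega> \<partial>M)"
    proof (rule nn_integral_cong_AE)
      have "AE \<omega> in M. nn_cond_exp M W (\<lambda>\<omega>. indicator l \<omega> * indicator S \<omega>) \<omega>
        = nn_cond_exp M W (nn_cond_exp M ?L (\<lambda>\<omega>. indicator l \<omega> * indicator S \<omega>)) \<omega>"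
        by (rule W.nn_cond_exp_nested_subalg[OF subL LW]) auto
      moreover have "AE \<omega> in M. nn_cond_exp M W (nn_cond_exp M ?L (\<lambda>\<omega>. indicator l \<omega> * indicator S \<omega>)) \<omega>
        = nn_cond_exp M W (\<lambda>\<omega>. indicator l \<omega> * nn_cond_exp M ?L (indicator S) \<omega>) \<omega>"
      proof (rule W.nn_cond_exp_cong)
        show "AE \<omega> in M. nn_cond_exp M ?L (\<lambda>\<omega>. indicator l \<omega> * indicator S \<omega>) \<omega>
          = indicator l \<omega> * nn_cond_exp M ?L (indicator S) \<omega>"
          by (rule AE_symmetric, rule L.nn_cond_exp_prod) auto
      qed auto
      ultimately show "AE \<omega> in M. nn_cond_exp M W (\<lambda>\<omega>. indicator l \<omega> * indicator S \<omega>) \<omega> * indicator b \<omega>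
        = nn_cond_exp M W (\<lambda>\<omega>. indicator l \<omega> * nn_cond_exp M ?L (indicator S) \<omega>) \<omega> * indicator b \<omega>" by auto
    qed
    also have "\<dots> = (\<integral>\<^sup>+\<omega>. (indicator l \<omega> * nn_cond_exp M ?L (indicator S) \<omega>) * indicator b \<omega> \<partial>M)"
      by (rule nn_integral_indicator_join[OF bJ m2, symmetric])
    also have "\<dots> = (\<integral>\<^sup>+\<omega>. indicator (l \<inter> b) \<omega> * nn_cond_exp M ?L (indicator S) \<omega> \<partial>M)"
      by (rule nn_integral_cong) (auto simp: indicator_def)
    finally show "(\<integral>\<^sup>+\<omega>. indicator (l \<inter> b) \<omega> * indicator S \<omega> \<partial>M)
      = (\<integral>\<^sup>+\<omega>. indicator (l \<inter> b) \<omega> * nn_cond_exp M ?L (indicator S) \<omega> \<partial>M)" .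
  qed
  \<comment> \<open>E[f | L] is already G-measurable, so its integrals over sets T of G decide. To
    reach f without approximating it by simple functions, the conditioning is put on 1_T, where
    \<open>indic\<close> can be tested on events, and then brought back to f by
    self-adjointness.\<close>
  have "AE \<omega> in M. nn_cond_exp M ?L f \<omega> = nn_cond_exp M G f \<omega>"
  proof (rule G.nn_cond_exp_charact)
    fix T assume T: "T \<in> sets G"
    then have TM [measurable]: "T \<in> sets M" using subG by (auto simp: subalgebra_def)
    have "(\<integral>\<^sup>+\<omega>. f \<omega> * indicator T \<omega> \<partial>M) = (\<integral>\<^sup>+\<omega>. f \<omega> * nn_cond_exp M ?L (indicator T) \<omega> \<partial>M)"
    proof (rule joint_sigma_nn_integral_cong[OF subW subA _ _ nn_integral_indicator_le _ f])
      fix c a assume "c \<in> sets W" "a \<in> sets A"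
      then have S: "c \<inter> a \<in> sets (joint_sigma W A)"
        unfolding sets_joint_sigma by (intro sigma_sets.Basic) blast
      then have SM [measurable]: "c \<inter> a \<in> sets M" using J by (auto simp: subalgebra_def)
      have "(\<integral>\<^sup>+\<omega>. indicator (c \<inter> a) \<omega> * indicator T \<omega> \<partial>M) = (\<integral>\<^sup>+\<omega>. indicator T \<omega> * (indicator (c \<inter> a) \<omega> :: ennreal) \<partial>M)"
        by (simp add: mult.commute)
      also have "\<dots> = (\<integral>\<^sup>+\<omega>. nn_cond_exp M ?L (indicator (c \<inter> a)) \<omega> * indicator T \<omega> \<partial>M)"
        unfolding indic[OF S T] by (simp add: mult.commute)
      also have "\<dots> = (\<integral>\<^sup>+\<omega>. nn_cond_exp M ?L (indicator (c \<inter> a)) \<omega> * nn_cond_exp M ?L (indicator T) \<omega> \<partial>M)"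
        by (rule L.nn_cond_exp_intg[symmetric]) auto
      also have "\<dots> = (\<integral>\<^sup>+\<omega>. nn_cond_exp M ?L (indicator T) \<omega> * nn_cond_exp M ?L (indicator (c \<inter> a)) \<omega> \<partial>M)"
        by (simp add: mult.commute)
      also have "\<dots> = (\<integral>\<^sup>+\<omega>. nn_cond_exp M ?L (indicator T) \<omega> * indicator (c \<inter> a) \<omega> \<partial>M)"
        by (rule L.nn_cond_exp_intg) auto
      finally show "(\<integral>\<^sup>+\<omega>. indicator (c \<inter> a) \<omega> * indicator T \<omega> \<partial>M)
        = (\<integral>\<^sup>+\<omega>. indicator (c \<inter> a) \<omega> * nn_cond_exp M ?L (indicator T) \<omega> \<partial>M)" by (simp add: mult.commute)
    qed auto
    also have "\<dots> = (\<integral>\<^sup>+\<omega>. nn_cond_exp M ?L (indicator T) \<omega> * nn_cond_exp M ?L f \<omega> \<partial>M)"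
      by (subst L.nn_cond_exp_intg) (auto simp: mult.commute)
    also have "\<dots> = (\<integral>\<^sup>+\<omega>. nn_cond_exp M ?L f \<omega> * nn_cond_exp M ?L (indicator T) \<omega> \<partial>M)"
      by (simp add: mult.commute)
    also have "\<dots> = (\<integral>\<^sup>+\<omega>. nn_cond_exp M ?L f \<omega> * indicator T \<omega> \<partial>M)"
      by (rule L.nn_cond_exp_intg) auto
    finally show "(\<integral>\<^sup>+\<omega>\<in>T. f \<omega> \<partial>M) = (\<integral>\<^sup>+\<omega>\<in>T. nn_cond_exp M ?L f \<omega> \<partial>M)" .
  next
    have "subalgebra G ?L" using F by (auto simp: subalgebra_def)
    then show "nn_cond_exp M ?L f \<in> borel_measurable G" by (rule measurable_from_subalg) auto
  qed auto
  then have 1: "AE \<omega> in M. nn_cond_exp M G f \<omega> = nn_cond_exp M ?L f \<omega>" by auto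
  \<comment> \<open>F is sandwiched: E[f | F] = E[E[f | G] | F] = E[E[f | L] | F], and the last one
    is E[f | L] since L lies in F.\<close>
  have 2: "AE \<omega> in M. nn_cond_exp M F f \<omega> = nn_cond_exp M F (nn_cond_exp M G f) \<omega>"
    by (rule F.nn_cond_exp_nested_subalg[OF subG F(1)]) auto
  have 3: "AE \<omega> in M. nn_cond_exp M F (nn_cond_exp M G f) \<omega> = nn_cond_exp M F (nn_cond_exp M ?L f) \<omega>"
    by (rule F.nn_cond_exp_cong[OF 1]) auto
  have 4: "AE \<omega> in M. nn_cond_exp M ?L f \<omega> = nn_cond_exp M F (nn_cond_exp M ?L f) \<omega>"
    by (rule F.nn_cond_exp_F_meas, rule measurable_from_subalg[OF F(2)]) auto
  show ?thesis using 1 2 3 4 by eventually_elim simp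
qed

end

lemma subalgebra_vimage_algebra:
  assumes "f \<in> measurable N P" "space N = X"
  shows "subalgebra N (vimage_algebra X f P)"
proof -
  have "f \<in> X \<rightarrow> space P" using measurable_space[OF assms(1)] assms(2) by auto
  then show ?thesis
    using measurable_sets[OF assms(1)] assms(2)
    by (auto simp: subalgebra_def sets_vimage_algebra2)
qed

text \<open>\<open>cond_indep_vars\<close> is phrased with \<open>real_cond_exp\<close>, whereas the
  arguments above run with \<open>nn_cond_exp\<close>. As \<open>real_cond_exp\<close> applies
  \<open>enn2real\<close>, the passage needs finiteness almost everywhere, which comes from
  comparison with the conditional expectation of 1.\<close>

lemma (in prob_space) nn_cond_exp_indicator:
  assumes F: "subalgebra M F" and S [measurable]: "S \<in> sets M"
  shows "AE \<omega> in M. nn_cond_exp M F (indicator S) \<omega> = ennreal (real_cond_exp M F (indicator S) \<omega>)"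
proof -
  interpret F: sigma_finite_subalgebra M F by (rule sigma_finite_subalgebraI[OF F])
  have one: "AE \<omega> in M. (1::ennreal) = nn_cond_exp M F (\<lambda>_. 1) \<omega>" by (rule F.nn_cond_exp_F_meas) auto
  have zero: "AE \<omega> in M. (0::ennreal) = nn_cond_exp M F (\<lambda>_. 0) \<omega>" by (rule F.nn_cond_exp_F_meas) auto
  have le: "AE \<omega> in M. nn_cond_exp M F (indicator S) \<omega> \<le> nn_cond_exp M F (\<lambda>_. 1) \<omega>"
    by (rule F.nn_cond_exp_mono) (auto simp: indicator_def)
  have neg: "(\<lambda>\<omega>. ennreal (- indicator S \<omega>)) = (\<lambda>_. 0)" by (auto simp: indicator_def fun_eq_iff ennreal_neg)
  have pos: "(\<lambda>\<omega>. ennreal (indicator S \<omega>)) = indicator S" by (auto simp: indicator_def fun_eq_iff)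
  show ?thesis unfolding real_cond_exp_def neg pos
    using one zero le
  proof eventually_elim
    case (elim \<omega>)
    then have "nn_cond_exp M F (indicator S) \<omega> < \<infinity>"
      by (metis ennreal_one_less_top infinity_ennreal_def order.strict_trans1)
    then show ?case using elim(2) by (simp add: ennreal_enn2real_if)
  qed
qed

section \<open>One row of the array: the clusters and the sigma-algebras they generate\<close>

locale cluster_row = prob_space M
  for M :: "'a measure" +
  fixes n k G :: nat and T :: "nat \<Rightarrow> nat set"
    and x :: "'a \<Rightarrow> nat \<Rightarrow> real ^ 'd" and w :: "'a \<Rightarrow> nat \<Rightarrow> nat \<Rightarrow> real" and u :: "'a \<Rightarrow> nat \<Rightarrow> real"
  assumes x_rv: "x \<in> measurable M (Pi\<^sub>M {1..n} (\<lambda>_. borel))"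
    and w_rv: "w \<in> measurable M (control_space n k)"
    and u_rv: "u \<in> measurable M (Pi\<^sub>M {1..n} (\<lambda>_. borel))"
    and partition: "partition_on {1..n} (T ` {1..G})" "inj_on T {1..G}"
    and cluster_indep: "cond_indep_vars M (sigma_W M n k w)
      (\<lambda>g. Pi\<^sub>M (T g) (\<lambda>_. borel)) (\<lambda>g \<omega>. \<lambda>i\<in>T g. (u \<omega> i, x \<omega> i)) {1..G}"
begin

abbreviation "W \<equiv> sigma_W M n k w"
abbreviation "F \<equiv> sigma_XW M n k x w"

definition block :: "nat \<Rightarrow> 'a \<Rightarrow> nat \<Rightarrow> real \<times> (real ^ 'd)" where
  "block g \<omega> = (\<lambda>i\<in>T g. (u \<omega> i, x \<omega> i))"

definition block_algebra :: "nat \<Rightarrow> 'a measure" where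
  "block_algebra g = vimage_algebra (space M) (block g) (Pi\<^sub>M (T g) (\<lambda>_. borel))"

text \<open>The share of a block that F contains; it plays the part of A0 in
  \<open>nn_cond_exp_enlarge\<close>.\<close>

definition block_x_algebra :: "nat \<Rightarrow> 'a measure" where
  "block_x_algebra g = vimage_algebra (space M) (\<lambda>\<omega>. \<lambda>i\<in>T g. x \<omega> i) (Pi\<^sub>M (T g) (\<lambda>_. borel))"

text \<open>Rectangles over all clusters but g are the events for which
  \<open>cond_indep_vars\<close> supplies a product formula, and they form an intersection-stable
  generator for the information in the other clusters.\<close>

definition other_rects :: "nat \<Rightarrow> 'a set set" where
  "other_rects g = {{\<omega> \<in> space M. \<forall>h\<in>{1..G} - {g}. block h \<omega> \<in> C h} |C.
     C \<in> (\<Pi> h\<in>{1..G} - {g}. sets (Pi\<^sub>M (T h) (\<lambda>_. borel)))}"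

definition others_algebra :: "nat \<Rightarrow> 'a measure" where
  "others_algebra g = sigma (space M) (other_rects g)"

text \<open>The information in the regressors, the controls and the errors outside cluster \<open>g\<close>.\<close>

definition past :: "nat \<Rightarrow> 'a measure" where
  "past g = joint_sigma (joint_sigma W (block_x_algebra g)) (others_algebra g)"

lemma block_measurable [measurable]:
  "g \<in> {1..G} \<Longrightarrow> block g \<in> measurable M (Pi\<^sub>M (T g) (\<lambda>_. borel))"
  using cluster_indep unfolding cond_indep_vars_def block_def by auto

lemma block_space:
  "g \<in> {1..G} \<Longrightarrow> \<omega> \<in> space M \<Longrightarrow> block g \<omega> \<in> space (Pi\<^sub>M (T g) (\<lambda>_. borel))"
  by (rule measurable_space[OF block_measurable])

lemma T_subset: "g \<in> {1..G} \<Longrightarrow> T g \<subseteq> {1..n}"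
  using partition_onD1[OF partition(1)] by auto

lemma finite_T: "g \<in> {1..G} \<Longrightarrow> finite (T g)"
  using T_subset finite_subset by blast

lemma T_disjoint: "g \<in> {1..G} \<Longrightarrow> h \<in> {1..G} \<Longrightarrow> i \<in> T g \<Longrightarrow> i \<in> T h \<Longrightarrow> g = h"
  using disjointD[OF partition_onD2[OF partition(1)], of "T g" "T h"] inj_onD[OF partition(2), of g h]
  by fast

lemma cluster_ex: "i \<in> {1..n} \<Longrightarrow> \<exists>g\<in>{1..G}. i \<in> T g"
  using partition_onD1[OF partition(1)] by auto

lemma subalgebra_W: "subalgebra M W"
  unfolding sigma_W_def by (rule subalgebra_vimage_algebra[OF w_rv refl])

lemma w_W: "w \<in> measurable W (control_space n k)"
  unfolding sigma_W_def using measurable_space[OF w_rv] by (intro measurable_vimage_algebra1) auto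

lemma xw_rv: "(\<lambda>\<omega>. (x \<omega>, w \<omega>)) \<in> measurable M (Pi\<^sub>M {1..n} (\<lambda>_. borel) \<Otimes>\<^sub>M control_space n k)"
  using x_rv w_rv by (rule measurable_Pair)

lemma subalgebra_F: "subalgebra M F"
  unfolding sigma_XW_def by (rule subalgebra_vimage_algebra[OF xw_rv refl])

lemma xw_F: "(\<lambda>\<omega>. (x \<omega>, w \<omega>)) \<in> measurable F (Pi\<^sub>M {1..n} (\<lambda>_. borel) \<Otimes>\<^sub>M control_space n k)"
  unfolding sigma_XW_def using measurable_space[OF xw_rv] by (intro measurable_vimage_algebra1) auto

lemma x_F: "x \<in> measurable F (Pi\<^sub>M {1..n} (\<lambda>_. borel))"
  and w_F: "w \<in> measurable F (control_space n k)"
  using measurable_compose[OF xw_F measurable_fst] measurable_compose[OF xw_F measurable_snd] by simp_all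

lemma xi_F: "i \<in> {1..n} \<Longrightarrow> (\<lambda>\<omega>. x \<omega> i) \<in> borel_measurable F"
  by (rule measurable_compose[OF x_F measurable_component_singleton])

lemma subalgebra_F_W: "subalgebra F W"
  unfolding sigma_W_def using subalgebra_F
  by (intro subalgebra_vimage_algebra[OF w_F]) (simp add: subalgebra_def)

lemma ui_rv: "i \<in> {1..n} \<Longrightarrow> (\<lambda>\<omega>. u \<omega> i) \<in> borel_measurable M"
  by (rule measurable_compose[OF u_rv measurable_component_singleton])

lemma subalgebra_block: "g \<in> {1..G} \<Longrightarrow> subalgebra M (block_algebra g)"
  unfolding block_algebra_def by (rule subalgebra_vimage_algebra) auto

lemma block_block_algebra:
  assumes "g \<in> {1..G}"
  shows "block g \<in> measurable (block_algebra g) (Pi\<^sub>M (T g) (\<lambda>_. borel))"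
  unfolding block_algebra_def using measurable_space[OF block_measurable[OF assms]]
  by (intro measurable_vimage_algebra1) auto

lemma block_component:
  assumes "g \<in> {1..G}" "i \<in> T g" "block g \<in> measurable N (Pi\<^sub>M (T g) (\<lambda>_. borel))"
  shows "(\<lambda>\<omega>. u \<omega> i) \<in> borel_measurable N" "(\<lambda>\<omega>. x \<omega> i) \<in> borel_measurable N"
proof -
  have "(\<lambda>\<omega>. block g \<omega> i) \<in> measurable N borel"
    by (rule measurable_compose[OF assms(3) measurable_component_singleton[OF assms(2)]])
  then have m: "(\<lambda>\<omega>. block g \<omega> i) \<in> measurable N (borel \<Otimes>\<^sub>M borel)" by (simp add: borel_prod)
  show "(\<lambda>\<omega>. u \<omega> i) \<in> borel_measurable N" "(\<lambda>\<omega>. x \<omega> i) \<in> borel_measurable N"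
    using measurable_compose[OF m measurable_fst] measurable_compose[OF m measurable_snd] assms(2) by (simp_all add: block_def)
qed

lemma ui_block: "g \<in> {1..G} \<Longrightarrow> i \<in> T g \<Longrightarrow> (\<lambda>\<omega>. u \<omega> i) \<in> borel_measurable (block_algebra g)"
  by (rule block_component[OF _ _ block_block_algebra])

lemma x_PiM:
  assumes g: "g \<in> {1..G}" and N: "\<And>i. i \<in> T g \<Longrightarrow> (\<lambda>\<omega>. x \<omega> i) \<in> borel_measurable N"
  shows "(\<lambda>\<omega>. \<lambda>i\<in>T g. x \<omega> i) \<in> measurable N (Pi\<^sub>M (T g) (\<lambda>_. borel))"
  by (rule measurable_restrict) (rule N)

lemma subalgebra_block_x: "g \<in> {1..G} \<Longrightarrow> subalgebra (block_algebra g) (block_x_algebra g)"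
  unfolding block_x_algebra_def
  by (rule subalgebra_vimage_algebra[OF x_PiM])
     (auto intro: block_component(2)[OF _ _ block_block_algebra], auto simp: block_algebra_def)

lemma xi_block_x:
  assumes "g \<in> {1..G}" "i \<in> T g"
  shows "(\<lambda>\<omega>. x \<omega> i) \<in> borel_measurable (block_x_algebra g)"
proof -
  have "(\<lambda>\<omega>. \<lambda>i\<in>T g. x \<omega> i) \<in> measurable (block_x_algebra g) (Pi\<^sub>M (T g) (\<lambda>_. borel))"
    unfolding block_x_algebra_def by (rule measurable_vimage_algebra1) (auto simp: space_PiM)
  from measurable_compose[OF this measurable_component_singleton[OF assms(2)]]
  show ?thesis using assms(2) by simp
qed

lemma other_rectsI:
  assumes "C \<in> (\<Pi> h\<in>{1..G} - {g}. sets (Pi\<^sub>M (T h) (\<lambda>_. borel)))"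
  shows "{\<omega> \<in> space M. \<forall>h\<in>{1..G} - {g}. block h \<omega> \<in> C h} \<in> other_rects g"
  unfolding other_rects_def using assms by (intro CollectI exI[of _ C] conjI refl)

lemma other_rects_sets: "R \<in> other_rects g \<Longrightarrow> R \<in> sets M"
proof -
  assume "R \<in> other_rects g"
  then obtain C where R: "R = {\<omega> \<in> space M. \<forall>h\<in>{1..G} - {g}. block h \<omega> \<in> C h}"
    and C: "C \<in> (\<Pi> h\<in>{1..G} - {g}. sets (Pi\<^sub>M (T h) (\<lambda>_. borel)))"
    unfolding other_rects_def by auto
  show "R \<in> sets M" unfolding R
  proof (rule sets.sets_Collect_finite_All)
    fix h assume h: "h \<in> {1..G} - {g}"
    have "block h -` C h \<inter> space M \<in> sets M"
      by (rule measurable_sets[OF block_measurable Pi_mem[OF C h]]) (use h in simp)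
    moreover have "block h -` C h \<inter> space M = {\<omega> \<in> space M. block h \<omega> \<in> C h}" by blast
    ultimately show "{\<omega> \<in> space M. block h \<omega> \<in> C h} \<in> sets M" by argo
  qed simp
qed

lemma other_rects_Pow: "other_rects g \<subseteq> Pow (space M)"
  unfolding other_rects_def by auto

lemma sets_others: "sets (others_algebra g) = sigma_sets (space M) (other_rects g)"
  and space_others: "space (others_algebra g) = space M"
  unfolding others_algebra_def
  by (rule sets_measure_of[OF other_rects_Pow], rule space_measure_of[OF other_rects_Pow])

lemma subalgebra_others: "subalgebra M (others_algebra g)"
  unfolding subalgebra_def sets_others space_others
  by (rule conjI[OF refl], rule sets.sigma_sets_subset, rule subsetI, rule other_rects_sets)

lemma other_rects_top: "space M \<in> other_rects g"
proof -
  have eq: "{\<omega> \<in> space M. \<forall>h\<in>{1..G} - {g}. block h \<omega> \<in> space (Pi\<^sub>M (T h) (\<lambda>_. borel))} = space M"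
    (is "?L = _")
  proof (rule equalityI; rule subsetI)
    fix \<omega> assume \<omega>: "\<omega> \<in> space M"
    show "\<omega> \<in> ?L"
      by (rule CollectI, rule conjI[OF \<omega>], rule ballI, rule block_space[OF _ \<omega>]) simp
  qed simp
  have "(\<lambda>h. space (Pi\<^sub>M (T h) (\<lambda>_. borel :: (real \<times> (real ^ 'd)) measure))) \<in> (\<Pi> h\<in>{1..G} - {g}. sets (Pi\<^sub>M (T h) (\<lambda>_. borel)))"
    by (rule Pi_I, rule sets.top)
  from other_rectsI[OF this] show ?thesis unfolding eq .
qed

lemma other_rects_stable: "Int_stable (other_rects g)"
proof (rule Int_stableI)
  fix R S assume "R \<in> other_rects g" "S \<in> other_rects g"
  then obtain C D where R: "R = {\<omega> \<in> space M. \<forall>h\<in>{1..G} - {g}. block h \<omega> \<in> C h}"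
    and S: "S = {\<omega> \<in> space M. \<forall>h\<in>{1..G} - {g}. block h \<omega> \<in> D h}"
    and C: "C \<in> (\<Pi> h\<in>{1..G} - {g}. sets (Pi\<^sub>M (T h) (\<lambda>_. borel)))"
    and D: "D \<in> (\<Pi> h\<in>{1..G} - {g}. sets (Pi\<^sub>M (T h) (\<lambda>_. borel)))"
    unfolding other_rects_def by auto
  have eq: "R \<inter> S = {\<omega> \<in> space M. \<forall>h\<in>{1..G} - {g}. block h \<omega> \<in> C h \<inter> D h}"
    unfolding R S by blast
  have "(\<lambda>h. C h \<inter> D h) \<in> (\<Pi> h\<in>{1..G} - {g}. sets (Pi\<^sub>M (T h) (\<lambda>_. borel)))"
    by (rule Pi_I, rule sets.Int[OF Pi_mem[OF C] Pi_mem[OF D]])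
  from other_rectsI[OF this] show "R \<inter> S \<in> other_rects g" unfolding eq .
qed

text \<open>The preimage is a rectangle whose side at h is the given set and whose other sides are
  full spaces.\<close>

lemma block_others:
  assumes h: "h \<in> {1..G}" "h \<noteq> g"
  shows "block h \<in> measurable (others_algebra g) (Pi\<^sub>M (T h) (\<lambda>_. borel))"
proof (rule measurableI)
  fix C assume C: "C \<in> sets (Pi\<^sub>M (T h) (\<lambda>_. borel :: (real \<times> (real ^ 'd)) measure))"
  let ?D = "\<lambda>j. if j = h then C else space (Pi\<^sub>M (T j) (\<lambda>_. borel :: (real \<times> (real ^ 'd)) measure))"
  have eq: "block h -` C \<inter> space (others_algebra g) = {\<omega> \<in> space M. \<forall>j\<in>{1..G} - {g}. block j \<omega> \<in> ?D j}"
    (is "?L = ?R")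
  proof (rule equalityI; rule subsetI)
    fix \<omega> assume "\<omega> \<in> ?L"
    then have \<omega>: "\<omega> \<in> space M" "block h \<omega> \<in> C" by (simp_all add: space_others)
    show "\<omega> \<in> ?R"
    proof (rule CollectI, rule conjI[OF \<omega>(1)], rule ballI)
      fix j assume "j \<in> {1..G} - {g}"
      then show "block j \<omega> \<in> ?D j" using \<omega> block_space[of j \<omega>] by simp
    qed
  next
    fix \<omega> assume "\<omega> \<in> ?R"
    then have "\<omega> \<in> space M" "block h \<omega> \<in> ?D h" using h by blast+
    then show "\<omega> \<in> ?L" by (simp add: space_others)
  qed
  have "?D \<in> (\<Pi> j\<in>{1..G} - {g}. sets (Pi\<^sub>M (T j) (\<lambda>_. borel)))"
    using C by (simp add: Pi_iff)
  from other_rectsI[OF this] have "block h -` C \<inter> space (others_algebra g) \<in> other_rects g"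
    unfolding eq .
  then show "block h -` C \<inter> space (others_algebra g) \<in> sets (others_algebra g)"
    unfolding sets_others by (rule sigma_sets.Basic)
qed (use h block_space in \<open>simp add: space_others\<close>)

text \<open>Two instances of the assumed product formula are compared, one over all clusters and one
  over all but g: the first product is the second times the factor of cluster g.\<close>

lemma cond_prob_rect:
  assumes g: "g \<in> {1..G}" and a: "a \<in> sets (block_algebra g)" and R: "R \<in> other_rects g"
  shows "AE \<omega> in M. nn_cond_exp M W (indicator (a \<inter> R)) \<omega>
    = nn_cond_exp M W (indicator a) \<omega> * nn_cond_exp M W (indicator R) \<omega>"
proof -
  obtain C where R': "R = {\<omega> \<in> space M. \<forall>h\<in>{1..G} - {g}. block h \<omega> \<in> C h}"
    and C: "C \<in> (\<Pi> h\<in>{1..G} - {g}. sets (Pi\<^sub>M (T h) (\<lambda>_. borel)))"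
    using R unfolding other_rects_def by auto
  have "block g \<in> space M \<rightarrow> space (Pi\<^sub>M (T g) (\<lambda>_. borel))"
    by (rule Pi_I, rule measurable_space[OF block_measurable[OF g]])
  from a[unfolded block_algebra_def sets_vimage_algebra2[OF this]]
  obtain D where D: "D \<in> sets (Pi\<^sub>M (T g) (\<lambda>_. borel))" and a': "a = block g -` D \<inter> space M"
    by blast
  have aM: "a \<in> sets M" using a subalgebra_block[OF g] by (auto simp: subalgebra_def)
  have RM: "R \<in> sets M" by (rule other_rects_sets[OF R])
  let ?P = "\<lambda>S \<omega>. real_cond_exp M W (indicator S) \<omega>"
  define C' where "C' h = (if h = g then D else C h)" for h
  have C': "C' \<in> (\<Pi> h\<in>J. sets (Pi\<^sub>M (T h) (\<lambda>_. borel)))" if "J \<subseteq> {1..G}" for J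
    using C D that by (auto simp: C'_def)
  have indep: "AE \<omega> in M. ?P {\<omega> \<in> space M. \<forall>h\<in>J. block h \<omega> \<in> C' h} \<omega>
      = (\<Prod>h\<in>J. ?P {\<omega> \<in> space M. block h \<omega> \<in> C' h} \<omega>)" if "J \<subseteq> {1..G}" "J \<noteq> {}" for J
    using cluster_indep that C'[OF that(1)] finite_subset[OF that(1)]
    unfolding cond_indep_vars_def block_def[symmetric] by blast
  have all: "{\<omega> \<in> space M. \<forall>h\<in>{1..G}. block h \<omega> \<in> C' h} = a \<inter> R"
    using g by (auto simp: a' R' C'_def)
  have rest: "{\<omega> \<in> space M. \<forall>h\<in>{1..G} - {g}. block h \<omega> \<in> C' h} = R"
    by (auto simp: R' C'_def)
  have own: "{\<omega> \<in> space M. block g \<omega> \<in> C' g} = a" by (auto simp: a' C'_def)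
  have split: "(\<Prod>h\<in>{1..G}. ?P {\<omega> \<in> space M. block h \<omega> \<in> C' h} \<omega>)
      = ?P a \<omega> * (\<Prod>h\<in>{1..G} - {g}. ?P {\<omega> \<in> space M. block h \<omega> \<in> C' h} \<omega>)" for \<omega>
    by (subst prod.remove[OF _ g]) (simp_all add: own)
  have real: "AE \<omega> in M. ?P (a \<inter> R) \<omega> = ?P a \<omega> * ?P R \<omega>"
  \<comment> \<open>The product formula excludes the empty family. With a single cluster, R is the
    whole space and has conditional probability 1.\<close>
  proof (cases "{1..G} - {g} = {}")
    case False
    have ne: "{1..G} \<noteq> {}" using g by auto
    show ?thesis using indep[OF order.refl ne] indep[OF Diff_subset False] unfolding all rest split
      by eventually_elim simp
  next
    case True
    have "R = space M" unfolding R' True by simp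
    interpret W: sigma_finite_subalgebra M W by (rule sigma_finite_subalgebraI[OF subalgebra_W])
    have "space M \<in> sets W" using subalgebra_W sets.top[of W] by (simp add: subalgebra_def)
    then have "AE \<omega> in M. ?P (space M) \<omega> = indicator (space M) \<omega>"
      by (intro W.real_cond_exp_F_meas borel_measurable_indicator integrable_real_indicator)
         (simp_all add: emeasure_space_1)
    then have one: "AE \<omega> in M. ?P (space M) \<omega> = 1"
      using AE_space by eventually_elim simp
    have "a \<inter> space M = a" using sets.sets_into_space[OF aM] by (rule Int_absorb2)
    then show ?thesis using one unfolding \<open>R = space M\<close> by (elim eventually_mono) simp
  qed
  have aR: "a \<inter> R \<in> sets M" using aM RM by auto
  interpret W: sigma_finite_subalgebra M W by (rule sigma_finite_subalgebraI[OF subalgebra_W])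
  have "AE \<omega> in M. ?P a \<omega> \<ge> 0" using aM by (intro W.real_cond_exp_pos) auto
  then show ?thesis
    using nn_cond_exp_indicator[OF subalgebra_W aM] nn_cond_exp_indicator[OF subalgebra_W RM]
      nn_cond_exp_indicator[OF subalgebra_W aR] real
    by eventually_elim (simp add: ennreal_mult')
qed

text \<open>With a and a W-event c fixed, both sides are integrals of 1_b against integrable
  densities, so the identity passes from rectangles to the sigma-algebra they generate.\<close>

lemma cond_indep_block:
  assumes g: "g \<in> {1..G}"
  shows "cond_indep_algebras M W (block_algebra g) (others_algebra g)"
proof unfold_locales
  interpret W: sigma_finite_subalgebra M W by (rule sigma_finite_subalgebraI[OF subalgebra_W])
  fix a b assume a: "a \<in> sets (block_algebra g)" and b: "b \<in> sets (others_algebra g)"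
  have aM [measurable]: "a \<in> sets M" using a subalgebra_block[OF g] by (auto simp: subalgebra_def)
  have bM [measurable]: "b \<in> sets M" using b subalgebra_others by (auto simp: subalgebra_def)
  show "AE \<omega> in M. nn_cond_exp M W (indicator (a \<inter> b)) \<omega>
    = nn_cond_exp M W (indicator a) \<omega> * nn_cond_exp M W (indicator b) \<omega>"
  proof (rule AE_symmetric, rule W.nn_cond_exp_charact)
    fix c assume c [measurable]: "c \<in> sets W"
    have cM [measurable]: "c \<in> sets M" using c subalgebra_W by (auto simp: subalgebra_def)
    have "(\<integral>\<^sup>+\<omega>. indicator b \<omega> * indicator (c \<inter> a) \<omega> \<partial>M)
      = (\<integral>\<^sup>+\<omega>. indicator b \<omega> * (indicator c \<omega> * nn_cond_exp M W (indicator a) \<omega>) \<partial>M)"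
    proof (rule generated_nn_integral_cong[OF subalgebra_others sets_others other_rects_stable other_rects_Pow other_rects_top])
      have "(\<integral>\<^sup>+\<omega>. indicator (c \<inter> a) \<omega> \<partial>M) \<le> (\<integral>\<^sup>+\<omega>. 1 \<partial>M)"
        by (rule nn_integral_mono) (auto simp: indicator_def)
      then show "(\<integral>\<^sup>+\<omega>. indicator (c \<inter> a) \<omega> \<partial>M) < \<infinity>" by (simp add: emeasure_space_1 order.strict_trans1)
      fix R assume R: "R \<in> other_rects g"
      have RM [measurable]: "R \<in> sets M" by (rule other_rects_sets[OF R])
      have "(\<integral>\<^sup>+\<omega>. indicator R \<omega> * indicator (c \<inter> a) \<omega> \<partial>M) = (\<integral>\<^sup>+\<omega>. indicator c \<omega> * (indicator (a \<inter> R) \<omega> :: ennreal) \<partial>M)"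
        by (rule nn_integral_cong) (auto simp: indicator_def)
      also have "\<dots> = (\<integral>\<^sup>+\<omega>. indicator c \<omega> * nn_cond_exp M W (indicator (a \<inter> R)) \<omega> \<partial>M)"
        by (rule W.nn_cond_exp_intg[symmetric]) auto
      also have "\<dots> = (\<integral>\<^sup>+\<omega>. (indicator c \<omega> * nn_cond_exp M W (indicator a) \<omega>) * nn_cond_exp M W (indicator R) \<omega> \<partial>M)"
        by (rule nn_integral_cong_AE) (use cond_prob_rect[OF g a R] in \<open>auto simp: mult.assoc\<close>)
      also have "\<dots> = (\<integral>\<^sup>+\<omega>. (indicator c \<omega> * nn_cond_exp M W (indicator a) \<omega>) * indicator R \<omega> \<partial>M)"
        by (rule W.nn_cond_exp_intg) auto
      finally show "(\<integral>\<^sup>+\<omega>. indicator R \<omega> * indicator (c \<inter> a) \<omega> \<partial>M)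
        = (\<integral>\<^sup>+\<omega>. indicator R \<omega> * (indicator c \<omega> * nn_cond_exp M W (indicator a) \<omega>) \<partial>M)"
        by (simp add: mult.commute)
    qed (use b in auto)
    also have "\<dots> = (\<integral>\<^sup>+\<omega>. (indicator c \<omega> * nn_cond_exp M W (indicator a) \<omega>) * indicator b \<omega> \<partial>M)"
      by (simp add: mult.commute)
    also have "\<dots> = (\<integral>\<^sup>+\<omega>. (indicator c \<omega> * nn_cond_exp M W (indicator a) \<omega>) * nn_cond_exp M W (indicator b) \<omega> \<partial>M)"
      by (rule W.nn_cond_exp_intg[symmetric]) auto
    also have "\<dots> = (\<integral>\<^sup>+\<omega>\<in>c. (nn_cond_exp M W (indicator a) \<omega> * nn_cond_exp M W (indicator b) \<omega>) \<partial>M)"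
      by (simp add: ac_simps)
    also have "(\<integral>\<^sup>+\<omega>. indicator b \<omega> * indicator (c \<inter> a) \<omega> \<partial>M) = (\<integral>\<^sup>+\<omega>\<in>c. indicator (a \<inter> b) \<omega> \<partial>M)"
      by (rule nn_integral_cong) (auto simp: indicator_def)
    finally show "(\<integral>\<^sup>+\<omega>\<in>c. indicator (a \<inter> b) \<omega> \<partial>M)
      = (\<integral>\<^sup>+\<omega>\<in>c. (nn_cond_exp M W (indicator a) \<omega> * nn_cond_exp M W (indicator b) \<omega>) \<partial>M)" .
  qed auto
qed (rule subalgebra_W subalgebra_others subalgebra_block[OF g])+

lemma spaces: "space W = space M" "space F = space M" "space (block_x_algebra g) = space M"
  "space (past g) = space M"
proof -
  show W: "space W = space M" and "space F = space M"
    using conjunct1[OF subalgebra_W[unfolded subalgebra_def]] conjunct1[OF subalgebra_F[unfolded subalgebra_def]] .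
  show "space (block_x_algebra g) = space M" unfolding block_x_algebra_def by simp
  show "space (past g) = space M" unfolding past_def space_joint_sigma by (rule W)
qed

lemma subalgebra_past_parts:
  assumes g: "g \<in> {1..G}"
  shows "subalgebra (past g) W" "subalgebra (past g) (block_x_algebra g)" "subalgebra (past g) (others_algebra g)"
proof -
  have 1: "subalgebra (past g) (joint_sigma W (block_x_algebra g))" "subalgebra (past g) (others_algebra g)"
    unfolding past_def
    by (auto intro!: subalgebra_joint_sigma_left subalgebra_joint_sigma_right simp: space_joint_sigma spaces space_others)
  have 2: "subalgebra (joint_sigma W (block_x_algebra g)) W"
    "subalgebra (joint_sigma W (block_x_algebra g)) (block_x_algebra g)"
    by (auto intro!: subalgebra_joint_sigma_left subalgebra_joint_sigma_right simp: spaces)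
  show "subalgebra (past g) W" "subalgebra (past g) (block_x_algebra g)" "subalgebra (past g) (others_algebra g)"
    using 1 2 by (auto simp: subalgebra_def)
qed

lemma subalgebra_past: assumes g: "g \<in> {1..G}" shows "subalgebra M (past g)"
proof -
  have "subalgebra M (block_x_algebra g)"
    using subalgebra_block[OF g] subalgebra_block_x[OF g] by (auto simp: subalgebra_def)
  then show ?thesis unfolding past_def
    by (intro subalgebra_joint_sigma subalgebra_W subalgebra_others)
qed

lemma ui_past:
  assumes g: "g \<in> {1..G}" and i: "i \<in> {1..n}" "i \<notin> T g"
  shows "(\<lambda>\<omega>. u \<omega> i) \<in> borel_measurable (past g)"
proof -
  obtain h where h: "h \<in> {1..G}" "i \<in> T h" using cluster_ex[OF i(1)] by auto
  then have "h \<noteq> g" using i by auto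
  show ?thesis
    by (rule measurable_from_subalg[OF subalgebra_past_parts(3)[OF g]])
       (rule block_component[OF h block_others[OF h(1) \<open>h \<noteq> g\<close>]])
qed

text \<open>First half of the sandwich needed by \<open>nn_cond_exp_enlarge\<close>: each x i sits
  either in cluster g, whose regressors \<open>past g\<close> retains, or in another cluster, whose
  block it contains entirely.\<close>

lemma subalgebra_past_F:
  assumes g: "g \<in> {1..G}"
  shows "subalgebra (past g) F"
  unfolding sigma_XW_def
proof (rule subalgebra_vimage_algebra[OF measurable_Pair])
  show "x \<in> measurable (past g) (Pi\<^sub>M {1..n} (\<lambda>_. borel))"
  proof (rule measurable_PiM_single')
    fix i assume i: "i \<in> {1..n}"
    obtain h where h: "h \<in> {1..G}" "i \<in> T h" using cluster_ex[OF i] by auto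
    show "(\<lambda>\<omega>. x \<omega> i) \<in> borel_measurable (past g)"
    proof (cases "h = g")
      case True
      then show ?thesis
        using measurable_from_subalg[OF subalgebra_past_parts(2)[OF g] xi_block_x[OF g]] h by auto
    next
      case False
      show ?thesis
        by (rule measurable_from_subalg[OF subalgebra_past_parts(3)[OF g]])
           (rule block_component[OF h block_others[OF h(1) False]])
    qed
  qed (use measurable_space[OF x_rv] in \<open>auto simp: space_PiM spaces\<close>)
  show "w \<in> measurable (past g) (control_space n k)"
    by (rule measurable_from_subalg[OF subalgebra_past_parts(1)[OF g] w_W])
qed (rule spaces)

text \<open>Second half of the sandwich: the controls and the regressors of cluster g are part of
  what F knows.\<close>

lemma subalgebra_F_joint:
  assumes g: "g \<in> {1..G}"
  shows "subalgebra F (joint_sigma W (block_x_algebra g))"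
proof (rule subalgebra_joint_sigma[OF subalgebra_F_W])
  show "subalgebra F (block_x_algebra g)"
    unfolding block_x_algebra_def
    by (rule subalgebra_vimage_algebra[OF x_PiM[OF g]]) (use xi_F T_subset[OF g] spaces in auto)
qed

text \<open>Instance of \<open>nn_cond_exp_enlarge\<close> with A the block of g, A0 its regressors
  and B the other blocks. Knowing the other errors on top of F does not help to predict cluster g;
  every orthogonality relation below rests on this.\<close>

lemma nn_cond_exp_past:
  assumes g: "g \<in> {1..G}" and f: "f \<in> borel_measurable (block_algebra g)"
  shows "AE \<omega> in M. nn_cond_exp M (past g) f \<omega> = nn_cond_exp M F f \<omega>"
proof -
  have sp: "space W = space (block_algebra g)" by (simp add: spaces block_algebra_def)
  interpret cond_indep_algebras M W "block_algebra g" "others_algebra g" by (rule cond_indep_block[OF g])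
  show ?thesis
  proof (rule nn_cond_exp_enlarge[OF subalgebra_block_x[OF g] _ past_def subalgebra_past_F[OF g] subalgebra_F_joint[OF g]])
    show "f \<in> borel_measurable (joint_sigma W (block_algebra g))"
      by (rule measurable_from_subalg[OF subalgebra_joint_sigma_right f]) (rule sp)
  qed
qed

lemma real_cond_exp_past:
  assumes g: "g \<in> {1..G}" and f [measurable]: "f \<in> borel_measurable (block_algebra g)"
  shows "AE \<omega> in M. real_cond_exp M (past g) f \<omega> = real_cond_exp M F f \<omega>"
proof -
  have "AE \<omega> in M. nn_cond_exp M (past g) (\<lambda>\<omega>. ennreal (f \<omega>)) \<omega> = nn_cond_exp M F (\<lambda>\<omega>. ennreal (f \<omega>)) \<omega>"
    "AE \<omega> in M. nn_cond_exp M (past g) (\<lambda>\<omega>. ennreal (- f \<omega>)) \<omega> = nn_cond_exp M F (\<lambda>\<omega>. ennreal (- f \<omega>)) \<omega>"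
    by (auto intro!: nn_cond_exp_past[OF g])
  then show ?thesis unfolding real_cond_exp_def by eventually_elim simp
qed

text \<open>Integrability is required of the product only: f may be a product of two errors without
  a finite mean, tamed by a weight that is contained in \<open>\<Theta>\<close>.\<close>

lemma past_integral:
  assumes g: "g \<in> {1..G}" and f: "f \<in> borel_measurable (block_algebra g)"
    and \<Theta>: "\<Theta> \<in> borel_measurable (past g)" and int: "integrable M (\<lambda>\<omega>. \<Theta> \<omega> * f \<omega>)"
  shows "integrable M (\<lambda>\<omega>. \<Theta> \<omega> * real_cond_exp M F f \<omega>)"
    "(\<integral>\<omega>. \<Theta> \<omega> * real_cond_exp M F f \<omega> \<partial>M) = (\<integral>\<omega>. \<Theta> \<omega> * f \<omega> \<partial>M)"
proof -
  interpret P: sigma_finite_subalgebra M "past g" by (rule sigma_finite_subalgebraI[OF subalgebra_past[OF g]])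
  have fM [measurable]: "f \<in> borel_measurable M" by (rule measurable_from_subalg[OF subalgebra_block[OF g] f])
  have \<Theta>M [measurable]: "\<Theta> \<in> borel_measurable M" by (rule measurable_from_subalg[OF subalgebra_past[OF g] \<Theta>])
  have ae: "AE \<omega> in M. \<Theta> \<omega> * real_cond_exp M (past g) f \<omega> = \<Theta> \<omega> * real_cond_exp M F f \<omega>"
    using real_cond_exp_past[OF g f] by eventually_elim simp
  note intg = P.real_cond_exp_intg[OF int \<Theta> fM]
  have "integrable M (\<lambda>\<omega>. \<Theta> \<omega> * real_cond_exp M (past g) f \<omega>)
      = integrable M (\<lambda>\<omega>. \<Theta> \<omega> * real_cond_exp M F f \<omega>)"
    by (rule integrable_cong_AE[OF _ _ ae]) auto
  then show "integrable M (\<lambda>\<omega>. \<Theta> \<omega> * real_cond_exp M F f \<omega>)" using intg(1) by simp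
  have "(\<integral>\<omega>. \<Theta> \<omega> * real_cond_exp M (past g) f \<omega> \<partial>M) = (\<integral>\<omega>. \<Theta> \<omega> * real_cond_exp M F f \<omega> \<partial>M)"
    by (rule integral_cong_AE[OF _ _ ae]) auto
  then show "(\<integral>\<omega>. \<Theta> \<omega> * real_cond_exp M F f \<omega> \<partial>M) = (\<integral>\<omega>. \<Theta> \<omega> * f \<omega> \<partial>M)" using intg(2) by simp
qed

end

section \<open>Square sums of nearly orthogonal variables\<close>

lemma integrable_mult_of_squares:
  fixes f g :: "'a \<Rightarrow> real"
  assumes [measurable]: "f \<in> borel_measurable M" "g \<in> borel_measurable M"
    and "integrable M (\<lambda>\<omega>. (f \<omega>)\<^sup>2)" "integrable M (\<lambda>\<omega>. (g \<omega>)\<^sup>2)"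
  shows "integrable M (\<lambda>\<omega>. f \<omega> * g \<omega>)"
proof (rule Bochner_Integration.integrable_bound)
  show "integrable M (\<lambda>\<omega>. (f \<omega>)\<^sup>2 + (g \<omega>)\<^sup>2)" using assms by simp
  have "\<bar>a * b\<bar> \<le> a\<^sup>2 + b\<^sup>2" for a b :: real
  proof -
    have "0 \<le> (\<bar>a\<bar> - \<bar>b\<bar>)\<^sup>2" by simp
    then have "2 * (\<bar>a\<bar> * \<bar>b\<bar>) \<le> a\<^sup>2 + b\<^sup>2" by (simp add: power2_diff)
    moreover have "0 \<le> \<bar>a\<bar> * \<bar>b\<bar>" by simp
    ultimately show ?thesis unfolding abs_mult by argo
  qed
  then show "AE \<omega> in M. norm (f \<omega> * g \<omega>) \<le> norm ((f \<omega>)\<^sup>2 + (g \<omega>)\<^sup>2)" by simp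
qed measurable

text \<open>A second-moment bound along a dependency graph R. Products of non-adjacent variables
  integrate to zero, adjacent ones contribute at most the mean of the two squares, and by symmetry
  of R each square is counted as often as its index has neighbours.\<close>

lemma integral_square_sum_le:
  fixes z :: "'i \<Rightarrow> 'a \<Rightarrow> real"
  assumes fin: "finite I"
    and meas: "\<And>i. i \<in> I \<Longrightarrow> z i \<in> borel_measurable M"
    and sq: "\<And>i. i \<in> I \<Longrightarrow> integrable M (\<lambda>\<omega>. (z i \<omega>)\<^sup>2)"
    and orth: "\<And>i j. i \<in> I \<Longrightarrow> j \<in> I \<Longrightarrow> \<not> R i j \<Longrightarrow> (\<integral>\<omega>. z i \<omega> * z j \<omega> \<partial>M) = 0"
    and sym: "\<And>i j. R i j \<Longrightarrow> R j i"
    and deg: "\<And>i. i \<in> I \<Longrightarrow> real (card {j \<in> I. R i j}) \<le> m"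
  shows "integrable M (\<lambda>\<omega>. (\<Sum>i\<in>I. z i \<omega>)\<^sup>2)"
    "(\<integral>\<omega>. (\<Sum>i\<in>I. z i \<omega>)\<^sup>2 \<partial>M) \<le> m * (\<Sum>i\<in>I. \<integral>\<omega>. (z i \<omega>)\<^sup>2 \<partial>M)"
proof -
  have int: "integrable M (\<lambda>\<omega>. z i \<omega> * z j \<omega>)" if "i \<in> I" "j \<in> I" for i j
    by (rule integrable_mult_of_squares) (use that meas sq in auto)
  have expand: "(\<Sum>i\<in>I. z i \<omega>)\<^sup>2 = (\<Sum>i\<in>I. \<Sum>j\<in>I. z i \<omega> * z j \<omega>)" for \<omega>
    by (simp add: power2_eq_square sum_product)
  show "integrable M (\<lambda>\<omega>. (\<Sum>i\<in>I. z i \<omega>)\<^sup>2)"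
    unfolding expand by (intro Bochner_Integration.integrable_sum int)
  define q where "q i = (\<integral>\<omega>. (z i \<omega>)\<^sup>2 \<partial>M)" for i
  have q0: "0 \<le> q i" for i unfolding q_def by simp
  have bound: "(\<integral>\<omega>. z i \<omega> * z j \<omega> \<partial>M) \<le> (if R i j then (q i + q j) / 2 else 0)" if ij: "i \<in> I" "j \<in> I" for i j
  proof (cases "R i j")
    case True
    have "(\<integral>\<omega>. z i \<omega> * z j \<omega> \<partial>M) \<le> (\<integral>\<omega>. ((z i \<omega>)\<^sup>2 + (z j \<omega>)\<^sup>2) / 2 \<partial>M)"
    proof (rule integral_mono)
      show "integrable M (\<lambda>\<omega>. ((z i \<omega>)\<^sup>2 + (z j \<omega>)\<^sup>2) / 2)" using sq ij by simp
      fix \<omega>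
      have "0 \<le> (z i \<omega> - z j \<omega>)\<^sup>2" by simp
      then show "z i \<omega> * z j \<omega> \<le> ((z i \<omega>)\<^sup>2 + (z j \<omega>)\<^sup>2) / 2" by (simp add: power2_diff)
    qed (rule int[OF ij])
    also have "\<dots> = (q i + q j) / 2" unfolding q_def using sq ij by simp
    finally show ?thesis using True by simp
  qed (use orth ij in simp)
  have deg': "(\<Sum>j\<in>I. if R i j then q i else 0) \<le> m * q i" if "i \<in> I" for i
  proof -
    have "(\<Sum>j\<in>I. if R i j then q i else 0) = real (card {j \<in> I. R i j}) * q i"
      using fin by (simp add: sum.inter_filter[symmetric])
    then show ?thesis using mult_right_mono[OF deg[OF that] q0] by simp
  qed
  have "(\<integral>\<omega>. (\<Sum>i\<in>I. z i \<omega>)\<^sup>2 \<partial>M) = (\<Sum>i\<in>I. \<Sum>j\<in>I. \<integral>\<omega>. z i \<omega> * z j \<omega> \<partial>M)"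
    unfolding expand by (simp add: Bochner_Integration.integral_sum int)
  also have "\<dots> \<le> (\<Sum>i\<in>I. \<Sum>j\<in>I. if R i j then (q i + q j) / 2 else 0)"
    by (intro sum_mono bound)
  also have "\<dots> = (\<Sum>i\<in>I. \<Sum>j\<in>I. (if R i j then q i else 0) / 2) + (\<Sum>i\<in>I. \<Sum>j\<in>I. (if R i j then q j else 0) / 2)"
    unfolding sum.distrib[symmetric] by (intro sum.cong refl) (simp add: add_divide_distrib)
  also have "(\<Sum>i\<in>I. \<Sum>j\<in>I. (if R i j then q j else 0) / 2) = (\<Sum>i\<in>I. \<Sum>j\<in>I. (if R i j then q i else 0) / 2)"
    by (subst sum.swap, intro sum.cong refl if_cong arg_cong[where f = "\<lambda>t. t / 2"]) (use sym in blast)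
  also have "(\<Sum>i\<in>I. \<Sum>j\<in>I. (if R i j then q i else 0) / 2) + (\<Sum>i\<in>I. \<Sum>j\<in>I. (if R i j then q i else 0) / 2)
      = (\<Sum>i\<in>I. \<Sum>j\<in>I. if R i j then q i else 0)"
    unfolding sum.distrib[symmetric] by (intro sum.cong refl) simp
  also have "\<dots> \<le> (\<Sum>i\<in>I. m * q i)" by (intro sum_mono deg')
  finally show "(\<integral>\<omega>. (\<Sum>i\<in>I. z i \<omega>)\<^sup>2 \<partial>M) \<le> m * (\<Sum>i\<in>I. \<integral>\<omega>. (z i \<omega>)\<^sup>2 \<partial>M)"
    by (simp add: q_def sum_distrib_left)
qed

section \<open>Orthogonal projections and least squares\<close>

text \<open>Orthogonal projections given by their entries. Both projections of the argument are
  instances: the annihilator of the controls and the hat matrix of the partialled-out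
  regressors.\<close>

locale sym_idem =
  fixes n :: nat and P :: "nat \<Rightarrow> nat \<Rightarrow> real"
  assumes sym: "P i j = P j i"
    and idem: "i \<in> {1..n} \<Longrightarrow> l \<in> {1..n} \<Longrightarrow> (\<Sum>j=1..n. P i j * P j l) = P i l"
begin

lemma row_square: "i \<in> {1..n} \<Longrightarrow> (\<Sum>j=1..n. (P i j)\<^sup>2) = P i i"
  using idem[of i i] by (simp add: power2_eq_square sym)

lemma square_le_diag: "i \<in> {1..n} \<Longrightarrow> j \<in> {1..n} \<Longrightarrow> (P i j)\<^sup>2 \<le> P i i"
  unfolding row_square[symmetric] by (rule member_le_sum) auto

lemma diag_le_1: "i \<in> {1..n} \<Longrightarrow> P i i \<le> 1"
proof (rule ccontr)
  assume i: "i \<in> {1..n}" and "\<not> P i i \<le> 1"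
  then have "1 * P i i < P i i * P i i" by (intro mult_strict_right_mono) auto
  then show False using square_le_diag[OF i i] by (simp add: power2_eq_square)
qed

lemma square_le_1: "i \<in> {1..n} \<Longrightarrow> j \<in> {1..n} \<Longrightarrow> (P i j)\<^sup>2 \<le> 1"
  using square_le_diag[of i j] diag_le_1[of i] by simp

text \<open>With y = P z, symmetry and idempotence give |y|^2 = <z, y>, which is at most (|z|^2 +
  |y|^2) / 2.\<close>

lemma contraction: "(\<Sum>i=1..n. (\<Sum>j=1..n. P i j * z j)\<^sup>2) \<le> (\<Sum>j=1..n. (z j)\<^sup>2)"
proof -
  define y where "y i = (\<Sum>j=1..n. P i j * z j)" for i
  have "(\<Sum>i=1..n. y i * y i) = (\<Sum>i=1..n. \<Sum>j=1..n. (P i j * z j) * y i)"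
    by (simp add: y_def sum_distrib_right[symmetric])
  also have "\<dots> = (\<Sum>j=1..n. \<Sum>i=1..n. (P i j * z j) * y i)" by (rule sum.swap)
  also have "\<dots> = (\<Sum>j=1..n. z j * y j)"
  proof (rule sum.cong[OF refl])
    fix j assume j: "j \<in> {1..n}"
    have "(\<Sum>i=1..n. (P i j * z j) * y i) = (\<Sum>i=1..n. \<Sum>l=1..n. z j * (P j i * P i l * z l))"
      unfolding y_def sum_distrib_left by (intro sum.cong refl) (simp add: sym[of _ j])
    also have "\<dots> = (\<Sum>l=1..n. z j * ((\<Sum>i=1..n. P j i * P i l) * z l))"
      by (subst sum.swap) (simp add: sum_distrib_left sum_distrib_right)
    also have "\<dots> = z j * y j"
      unfolding y_def sum_distrib_left by (intro sum.cong refl) (use idem[OF j] in simp)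
    finally show "(\<Sum>i=1..n. (P i j * z j) * y i) = z j * y j" .
  qed
  also have "\<dots> \<le> (\<Sum>j=1..n. ((z j)\<^sup>2 + (y j)\<^sup>2) / 2)"
  proof (rule sum_mono)
    fix j
    have "0 \<le> (z j - y j)\<^sup>2" by simp
    then show "z j * y j \<le> ((z j)\<^sup>2 + (y j)\<^sup>2) / 2" by (simp add: power2_diff)
  qed
  also have "\<dots> = ((\<Sum>j=1..n. (z j)\<^sup>2) + (\<Sum>j=1..n. y j * y j)) / 2"
    by (simp add: sum.distrib sum_divide_distrib[symmetric] power2_eq_square)
  finally have "(\<Sum>i=1..n. y i * y i) \<le> (\<Sum>j=1..n. (z j)\<^sup>2)" by argo
  then show ?thesis by (simp add: y_def power2_eq_square)
qed

definition conj_form :: "(nat \<Rightarrow> nat \<Rightarrow> real) \<Rightarrow> nat \<Rightarrow> nat \<Rightarrow> real" where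
  "conj_form C a b = (\<Sum>i=1..n. \<Sum>j=1..n. P a i * C i j * P j b)"

text \<open>Multiplication by a projection on either side does not increase the Frobenius norm:
  \<open>contraction\<close> is applied to the columns of D = C P, then to the rows of C.\<close>

lemma conj_form_square_le:
  "(\<Sum>a=1..n. \<Sum>b=1..n. (conj_form C a b)\<^sup>2) \<le> (\<Sum>i=1..n. \<Sum>j=1..n. (C i j)\<^sup>2)"
proof -
  define D where "D i b = (\<Sum>j=1..n. P b j * C i j)" for i b
  have cf: "conj_form C a b = (\<Sum>i=1..n. P a i * D i b)" for a b
    unfolding conj_form_def D_def sum_distrib_left by (intro sum.cong refl) (simp add: sym[of b])
  have "(\<Sum>a=1..n. \<Sum>b=1..n. (conj_form C a b)\<^sup>2) = (\<Sum>b=1..n. \<Sum>a=1..n. (\<Sum>i=1..n. P a i * D i b)\<^sup>2)"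
    unfolding cf by (rule sum.swap)
  also have "\<dots> \<le> (\<Sum>b=1..n. \<Sum>i=1..n. (D i b)\<^sup>2)" by (intro sum_mono contraction)
  also have "\<dots> = (\<Sum>i=1..n. \<Sum>b=1..n. (D i b)\<^sup>2)" by (rule sum.swap)
  also have "\<dots> \<le> (\<Sum>i=1..n. \<Sum>j=1..n. (C i j)\<^sup>2)" unfolding D_def by (intro sum_mono contraction)
  finally show ?thesis .
qed

lemma quadratic_form:
  "(\<Sum>i=1..n. \<Sum>j=1..n. C i j * ((\<Sum>a=1..n. P i a * z a) * (\<Sum>b=1..n. P j b * z b)))
    = (\<Sum>a=1..n. \<Sum>b=1..n. conj_form C a b * (z a * z b))"
proof -
  have "(\<Sum>i=1..n. \<Sum>j=1..n. C i j * ((\<Sum>a=1..n. P i a * z a) * (\<Sum>b=1..n. P j b * z b)))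
      = (\<Sum>i=1..n. \<Sum>j=1..n. \<Sum>a=1..n. \<Sum>b=1..n. P a i * C i j * P j b * (z a * z b))"
  proof (intro sum.cong refl)
    fix i j
    have "C i j * ((\<Sum>a=1..n. P i a * z a) * (\<Sum>b=1..n. P j b * z b))
      = C i j * (\<Sum>a=1..n. \<Sum>b=1..n. P i a * z a * (P j b * z b))"
      by (simp only: sum_product)
    also have "\<dots> = (\<Sum>a=1..n. \<Sum>b=1..n. C i j * (P i a * z a * (P j b * z b)))"
      by (simp only: sum_distrib_left)
    also have "\<dots> = (\<Sum>a=1..n. \<Sum>b=1..n. P a i * C i j * P j b * (z a * z b))"
      by (intro sum.cong refl) (simp only: sym[of i] ac_simps)
    finally show "C i j * ((\<Sum>a=1..n. P i a * z a) * (\<Sum>b=1..n. P j b * z b))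
      = (\<Sum>a=1..n. \<Sum>b=1..n. P a i * C i j * P j b * (z a * z b))" .
  qed
  also have "\<dots> = (\<Sum>i=1..n. \<Sum>a=1..n. \<Sum>j=1..n. \<Sum>b=1..n. P a i * C i j * P j b * (z a * z b))"
    by (intro sum.cong refl sum.swap)
  also have "\<dots> = (\<Sum>a=1..n. \<Sum>i=1..n. \<Sum>j=1..n. \<Sum>b=1..n. P a i * C i j * P j b * (z a * z b))"
    by (rule sum.swap)
  also have "\<dots> = (\<Sum>a=1..n. \<Sum>i=1..n. \<Sum>b=1..n. \<Sum>j=1..n. P a i * C i j * P j b * (z a * z b))"
    by (intro sum.cong refl sum.swap)
  also have "\<dots> = (\<Sum>a=1..n. \<Sum>b=1..n. \<Sum>i=1..n. \<Sum>j=1..n. P a i * C i j * P j b * (z a * z b))"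
    by (intro sum.cong refl sum.swap)
  finally show ?thesis unfolding conj_form_def sum_distrib_right .
qed

end

section \<open>Inverse Gram matrices and the annihilator of the controls\<close>

lemma lambda_min_mat_pos_det:
  assumes A: "A \<in> carrier_mat m m" and pos: "0 < lambda_min_mat A"
  shows "Determinant.det A \<noteq> 0"
proof
  assume "Determinant.det A = 0"
  then obtain v where v: "v \<in> carrier_vec m" "v \<noteq> 0\<^sub>v m" "A *\<^sub>v v = 0\<^sub>v m"
    using det_0_iff_vec_prod_zero[OF A] by blast
  then have "eigenvalue A 0" unfolding eigenvalue_def eigenvector_def using A by (intro exI[of _ v]) auto
  \<comment> \<open>\<open>Min\<close> bounds its elements only on a finite set; the eigenvalues are
    roots of the characteristic polynomial.\<close>
  moreover have "finite {l. eigenvalue A l}"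
    unfolding eigenvalue_root_char_poly[OF A]
    by (rule poly_roots_finite) (use degree_monic_char_poly[OF A] in auto)
  ultimately have "lambda_min_mat A \<le> 0" unfolding lambda_min_mat_def by (intro Min_le) auto
  then show False using pos by simp
qed

lemma inv_mat_inverts:
  assumes A: "(A :: real Matrix.mat) \<in> carrier_mat m m" and det: "Determinant.det A \<noteq> 0"
  shows "inv_mat A \<in> carrier_mat m m" "A * inv_mat A = 1\<^sub>m m" "inv_mat A * A = 1\<^sub>m m"
proof -
  have "mat_inverse A \<noteq> None"
    using mat_inverse(1)[OF A, of "()"] det_non_zero_imp_unit[OF A det, of "()"] by blast
  then obtain B where B: "mat_inverse A = Some B" by blast
  then show "inv_mat A \<in> carrier_mat m m" "A * inv_mat A = 1\<^sub>m m" "inv_mat A * A = 1\<^sub>m m"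
    using mat_inverse(2)[OF A B] by (simp_all add: inv_mat_def)
qed

lemma inv_mat_singular:
  assumes A: "(A :: real Matrix.mat) \<in> carrier_mat m m" and det: "Determinant.det A = 0"
  shows "inv_mat A = 0\<^sub>m m m"
proof -
  have "mat_inverse A = None"
  proof (cases "mat_inverse A")
    case (Some B)
    then have B: "A * B = 1\<^sub>m m" "B \<in> carrier_mat m m" using mat_inverse(2)[OF A] by auto
    have "Determinant.det A * Determinant.det B = 1" using det_mult[OF A B(2)] B(1) by simp
    then show ?thesis using det by simp
  qed
  then show ?thesis using A by (simp add: inv_mat_def)
qed

text \<open>Expresses the entries of the inverse through determinants, the default value at singular
  matrices included. This is the form in which they are seen to be measurable.\<close>

lemma inv_mat_eq_adj:
  assumes A: "(A :: real Matrix.mat) \<in> carrier_mat m m" and ab: "a < m" "b < m"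
  shows "inv_mat A $$ (a, b) = (if Determinant.det A = 0 then 0 else adj_mat A $$ (a, b) / Determinant.det A)"
proof (cases "Determinant.det A = 0")
  case False
  note inv = inv_mat_inverts[OF A False]
  note adj = adj_mat[OF A]
  have "adj_mat A = adj_mat A * (A * inv_mat A)" using inv(2) adj(1) by simp
  also have "\<dots> = (adj_mat A * A) * inv_mat A" by (rule assoc_mult_mat[OF adj(1) A inv(1), symmetric])
  also have "\<dots> = Determinant.det A \<cdot>\<^sub>m inv_mat A"
    using inv(1) by (simp add: adj(3) mult_smult_assoc_mat[of "1\<^sub>m m" m m "inv_mat A" m])
  finally have "adj_mat A $$ (a, b) = Determinant.det A * inv_mat A $$ (a, b)"
    using inv(1) ab by (metis carrier_matD index_smult_mat(1))
  then show ?thesis using False by simp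
qed (use inv_mat_singular[OF A] ab in simp)

lemma gram_carrier: "gram n k w \<in> carrier_mat k k"
  by (simp add: gram_def)

lemma gram_index: "a < k \<Longrightarrow> b < k \<Longrightarrow> gram n k w $$ (a, b) = (\<Sum>i=1..n. w i a * w i b)"
  by (simp add: gram_def)

locale full_rank_controls =
  fixes n k :: nat and w :: "nat \<Rightarrow> nat \<Rightarrow> real"
  assumes det: "Determinant.det (gram n k w) \<noteq> 0"
begin

abbreviation "B \<equiv> inv_mat (gram n k w)"

lemma B: "B \<in> carrier_mat k k" "gram n k w * B = 1\<^sub>m k" "B * gram n k w = 1\<^sub>m k"
  using inv_mat_inverts[OF gram_carrier det] .

lemma B_gram:
  assumes "a < k" "c < k"
  shows "(\<Sum>b<k. B $$ (a, b) * (\<Sum>i=1..n. w i b * w i c)) = (if a = c then 1 else 0)"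
proof -
  have "(B * gram n k w) $$ (a, c) = (\<Sum>b<k. B $$ (a, b) * gram n k w $$ (b, c))"
    using B(1) gram_carrier[of n k w] assms
    by (auto simp: scalar_prod_def atLeast0LessThan intro!: sum.cong)
  also have "\<dots> = (\<Sum>b<k. B $$ (a, b) * (\<Sum>i=1..n. w i b * w i c))"
    using assms by (intro sum.cong refl) (simp add: gram_index)
  finally show ?thesis using B(3) assms by simp
qed

text \<open>The transpose of B is a left inverse of the symmetric Gram matrix and therefore equals
  B.\<close>

lemma B_sym: "a < k \<Longrightarrow> b < k \<Longrightarrow> B $$ (a, b) = B $$ (b, a)"
proof -
  assume ab: "a < k" "b < k"
  let ?g = "gram n k w"
  have gT: "transpose_mat ?g = ?g"
    by (rule eq_matI) (auto simp: gram_def mult.commute)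
  have BT: "transpose_mat B \<in> carrier_mat k k" using B(1) by simp
  have "transpose_mat B * ?g = transpose_mat B * transpose_mat ?g" by (simp add: gT)
  also have "\<dots> = transpose_mat (?g * B)" by (rule transpose_mult[OF gram_carrier B(1), symmetric])
  also have "\<dots> = 1\<^sub>m k" by (simp add: B(2))
  finally have "transpose_mat B * ?g = 1\<^sub>m k" .
  then have "transpose_mat B = B"
    using assoc_mult_mat[OF BT gram_carrier B(1), of n w] B(1,2) BT by simp
  then show ?thesis using ab B(1) by (metis carrier_matD index_transpose_mat(1))
qed

lemma annih_sym: "annih n k w i j = annih n k w j i"
proof -
  have "(\<Sum>a<k. \<Sum>b<k. w i a * B $$ (a, b) * w j b) = (\<Sum>b<k. \<Sum>a<k. w i a * B $$ (a, b) * w j b)"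
    by (rule sum.swap)
  also have "\<dots> = (\<Sum>a<k. \<Sum>b<k. w j a * B $$ (a, b) * w i b)"
    by (intro sum.cong refl) (simp add: B_sym ac_simps)
  finally show ?thesis unfolding annih_def by auto
qed

text \<open>In matrix form, with W the matrix of controls, M W = W - W B (W' W) = 0.\<close>

lemma annih_controls:
  assumes c: "c < k" and i: "i \<in> {1..n}"
  shows "(\<Sum>j=1..n. annih n k w i j * w j c) = 0"
proof -
  have "(\<Sum>j=1..n. annih n k w i j * w j c)
    = (\<Sum>j=1..n. (if i = j then w j c else 0)) - (\<Sum>j=1..n. \<Sum>a<k. \<Sum>b<k. w i a * (B $$ (a, b) * (w j b * w j c)))"
    unfolding annih_def left_diff_distrib sum_subtractf sum_distrib_right
    by (intro arg_cong2[where f = "(-)"] sum.cong refl) (auto simp: mult.assoc)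
  also have "(\<Sum>j=1..n. (if i = j then w j c else 0)) = w i c" using i by simp
  also have "(\<Sum>j=1..n. \<Sum>a<k. \<Sum>b<k. w i a * (B $$ (a, b) * (w j b * w j c)))
    = (\<Sum>a<k. \<Sum>b<k. \<Sum>j=1..n. w i a * (B $$ (a, b) * (w j b * w j c)))"
    by (subst sum.swap, intro sum.cong refl sum.swap)
  also have "\<dots> = (\<Sum>a<k. w i a * (\<Sum>b<k. B $$ (a, b) * (\<Sum>j=1..n. w j b * w j c)))"
    by (simp only: sum_distrib_left)
  also have "\<dots> = (\<Sum>a<k. if a = c then w i a else 0)"
    by (intro sum.cong refl) (use B_gram c in simp)
  also have "\<dots> = w i c" using c by simp
  finally show ?thesis by simp
qed

text \<open>Expanding the right-hand factor only gives M M = M - (M W) B W', and M W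
  vanishes.\<close>

sublocale sym_idem n "annih n k w"
proof
  fix i l assume i: "i \<in> {1..n}" and l: "l \<in> {1..n}"
  have "(\<Sum>j=1..n. annih n k w i j * annih n k w j l)
    = (\<Sum>j=1..n. if j = l then annih n k w i j else 0)
      - (\<Sum>j=1..n. \<Sum>a<k. \<Sum>b<k. annih n k w i j * w j a * (B $$ (a, b) * w l b))"
    unfolding annih_def[of n k w _ l] right_diff_distrib sum_subtractf sum_distrib_left
    by (intro arg_cong2[where f = "(-)"] sum.cong refl) (auto simp: mult.assoc)
  also have "(\<Sum>j=1..n. \<Sum>a<k. \<Sum>b<k. annih n k w i j * w j a * (B $$ (a, b) * w l b))
    = (\<Sum>a<k. \<Sum>b<k. \<Sum>j=1..n. annih n k w i j * w j a * (B $$ (a, b) * w l b))"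
    by (subst sum.swap, intro sum.cong refl sum.swap)
  also have "\<dots> = (\<Sum>a<k. \<Sum>b<k. (\<Sum>j=1..n. annih n k w i j * w j a) * (B $$ (a, b) * w l b))"
    by (simp only: sum_distrib_right)
  also have "\<dots> = 0" by (intro sum.neutral ballI) (use annih_controls[OF _ i] in simp)
  finally show "(\<Sum>j=1..n. annih n k w i j * annih n k w j l) = annih n k w i l" using l by simp
qed (rule annih_sym)

text \<open>Each coordinate of z, read as a vector indexed by the observations, is contracted by the
  annihilator.\<close>

lemma partial_out_norm_le:
  fixes z :: "nat \<Rightarrow> real ^ 'd"
  shows "(\<Sum>i=1..n. (norm (partial_out n k w z i))\<^sup>2) \<le> (\<Sum>i=1..n. (norm (z i))\<^sup>2)"
proof -
  have sq: "(norm v)\<^sup>2 = (\<Sum>c\<in>UNIV. (v $ c)\<^sup>2)" for v :: "real ^ 'd"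
    unfolding power2_norm_eq_inner inner_vec_def by (simp add: power2_eq_square)
  have po: "partial_out n k w z i $ c = (\<Sum>j=1..n. annih n k w i j * z j $ c)" for i c
    by (simp add: partial_out_def)
  have "(\<Sum>i=1..n. (norm (partial_out n k w z i))\<^sup>2)
      = (\<Sum>c\<in>UNIV. \<Sum>i=1..n. (\<Sum>j=1..n. annih n k w i j * z j $ c)\<^sup>2)"
    unfolding sq po by (rule sum.swap)
  also have "\<dots> \<le> (\<Sum>c\<in>UNIV. \<Sum>i=1..n. (z i $ c)\<^sup>2)" by (intro sum_mono contraction)
  also have "\<dots> = (\<Sum>i=1..n. (norm (z i))\<^sup>2)" unfolding sq by (rule sum.swap)
  finally show ?thesis .
qed

end

section \<open>Least squares after partialling out\<close>

lemma outer_mult: "outer v z *v b = (z \<bullet> b) *\<^sub>R v"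
  by (simp add: outer_def Finite_Cartesian_Product.vec_eq_iff matrix_vector_mult_def inner_vec_def sum_distrib_left mult.assoc mult.commute mult.left_commute)

lemma matrix_inv_inverts:
  assumes "invertible (A :: real ^ 'd ^ 'd)"
  shows "matrix_inv A ** A = Finite_Cartesian_Product.mat 1" "A ** matrix_inv A = Finite_Cartesian_Product.mat 1"
proof -
  have "\<exists>B. A ** B = Finite_Cartesian_Product.mat 1 \<and> B ** A = Finite_Cartesian_Product.mat 1"
    using assms by (simp add: invertible_def)
  from someI_ex[OF this] show "matrix_inv A ** A = Finite_Cartesian_Product.mat 1" "A ** matrix_inv A = Finite_Cartesian_Product.mat 1"
    unfolding matrix_inv_def by simp_all
qed

lemma sum_matrix_vector_mult:
  fixes A :: "'i \<Rightarrow> real ^ 'd ^ 'd"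
  shows "(\<Sum>i\<in>I. A i) *v b = (\<Sum>i\<in>I. A i *v b)"
  by (induction I rule: infinite_finite_induct) (auto simp: matrix_vector_mult_add_rdistrib)

context full_rank_controls
begin

lemma partial_out_idem:
  fixes z :: "nat \<Rightarrow> 'b::real_vector"
  assumes i: "i \<in> {1..n}"
  shows "partial_out n k w (partial_out n k w z) i = partial_out n k w z i"
proof -
  have "partial_out n k w (partial_out n k w z) i
      = (\<Sum>j=1..n. \<Sum>l=1..n. (annih n k w i j * annih n k w j l) *\<^sub>R z l)"
    unfolding partial_out_def by (simp add: scaleR_sum_right)
  also have "\<dots> = (\<Sum>l=1..n. (\<Sum>j=1..n. annih n k w i j * annih n k w j l) *\<^sub>R z l)"
    by (subst sum.swap) (simp add: scaleR_sum_left)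
  also have "\<dots> = partial_out n k w z i"
    unfolding partial_out_def by (intro sum.cong refl) (use idem[OF i] in simp)
  finally show ?thesis .
qed

text \<open>Transposed form of \<open>annih_controls\<close>; it removes the controls from the
  normal equations.\<close>

lemma sum_controls_partial_out:
  fixes z :: "nat \<Rightarrow> 'b::real_vector"
  assumes c: "c < k"
  shows "(\<Sum>i=1..n. w i c *\<^sub>R partial_out n k w z i) = 0"
proof -
  have "(\<Sum>i=1..n. w i c *\<^sub>R partial_out n k w z i)
      = (\<Sum>i=1..n. \<Sum>j=1..n. (annih n k w j i * w i c) *\<^sub>R z j)"
    unfolding partial_out_def by (simp add: scaleR_sum_right annih_sym mult.commute)
  also have "\<dots> = (\<Sum>j=1..n. (\<Sum>i=1..n. annih n k w j i * w i c) *\<^sub>R z j)"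
    by (subst sum.swap) (simp add: scaleR_sum_left)
  also have "\<dots> = 0" by (intro sum.neutral ballI) (use annih_controls[OF c] in simp)
  finally show ?thesis .
qed

end

locale ols_row = full_rank_controls n k w for n k w +
  fixes x :: "nat \<Rightarrow> real ^ 'd"
  assumes inv_H: "invertible (\<Sum>i=1..n. outer (partial_out n k w x i) (partial_out n k w x i))"
begin

abbreviation "v \<equiv> partial_out n k w x"

definition H :: "real ^ 'd ^ 'd" where
  "H = (\<Sum>i=1..n. outer (v i) (v i))"

definition Hi :: "real ^ 'd ^ 'd" where
  "Hi = matrix_inv H"

lemma Hi: "Hi ** H = Finite_Cartesian_Product.mat 1" "H ** Hi = Finite_Cartesian_Product.mat 1"
  using inv_H unfolding H_def[symmetric] Hi_def by (simp_all add: matrix_inv_inverts)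

lemma Hi_H: "Hi *v (H *v b) = b" "H *v (Hi *v b) = b"
  by (simp_all add: matrix_vector_mul_assoc Hi)

lemma H_mult: "H *v b = (\<Sum>i=1..n. (v i \<bullet> b) *\<^sub>R v i)"
  unfolding H_def sum_matrix_vector_mult outer_mult ..

lemma H_sym: "a \<bullet> (H *v b) = (H *v a) \<bullet> b"
  unfolding H_mult inner_sum_left inner_sum_right by (simp add: inner_commute mult.commute)

lemma Hi_sym: "a \<bullet> (Hi *v b) = (Hi *v a) \<bullet> b"
  using H_sym[of "Hi *v a" "Hi *v b"] by (simp add: Hi_H)

text \<open>X' M X = (M X)' (M X), since M is a projection. Because of this, \<open>ols\<close>,
  which multiplies raw outcomes by v, recovers the coefficient of x exactly.\<close>

lemma sum_x_v: "(\<Sum>i=1..n. (x i \<bullet> b) *\<^sub>R v i) = H *v b"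
proof -
  have vb: "v i \<bullet> b = (\<Sum>l=1..n. annih n k w i l * (x l \<bullet> b))" for i
    by (simp add: partial_out_def inner_sum_left)
  have "H *v b = (\<Sum>i=1..n. \<Sum>l=1..n. (annih n k w l i * (x l \<bullet> b)) *\<^sub>R v i)"
    unfolding H_mult vb scaleR_sum_left by (simp only: annih_sym)
  also have "\<dots> = (\<Sum>l=1..n. (x l \<bullet> b) *\<^sub>R (\<Sum>i=1..n. annih n k w l i *\<^sub>R v i))"
    by (subst sum.swap) (simp add: scaleR_sum_right mult.commute)
  also have "\<dots> = (\<Sum>l=1..n. (x l \<bullet> b) *\<^sub>R v l)"
    by (intro sum.cong refl arg_cong[where f = "scaleR _"]) (use partial_out_idem[of _ x] in \<open>simp add: partial_out_def\<close>)
  finally show ?thesis by simp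
qed

text \<open>Entries of V Hi V', where V has the rows v i and Hi inverts V' V: the orthogonal
  projection onto the columns of V.\<close>

definition hat :: "nat \<Rightarrow> nat \<Rightarrow> real" where
  "hat i j = v i \<bullet> (Hi *v v j)"

lemma hat_sum: "v i \<bullet> (Hi *v (\<Sum>l=1..n. e l *\<^sub>R v l)) = (\<Sum>l=1..n. hat i l * e l)"
proof -
  have "Hi *v (\<Sum>l=1..n. e l *\<^sub>R v l) = (\<Sum>l=1..n. e l *\<^sub>R (Hi *v v l))"
    by (simp add: linear_sum[OF matrix_vector_mul_linear] matrix_vector_mult_scaleR)
  then show ?thesis by (simp add: hat_def inner_sum_right mult.commute)
qed

sublocale hat: sym_idem n hat
proof
  show "hat i j = hat j i" for i j
    unfolding hat_def Hi_sym[of "v i"] by (rule inner_commute)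
  fix i l
  have "(\<Sum>j=1..n. hat i j * hat j l) = (\<Sum>j=1..n. hat i j * (v j \<bullet> (Hi *v v l)))"
    by (simp add: hat_def)
  also have "\<dots> = v i \<bullet> (Hi *v (H *v (Hi *v v l)))"
    unfolding H_mult hat_sum ..
  also have "\<dots> = hat i l" by (simp add: Hi_H hat_def)
  finally show "(\<Sum>j=1..n. hat i j * hat j l) = hat i l" .
qed

text \<open>Cyclic invariance of the trace, tr(V Hi V') = tr(Hi H). The value does not grow with n,
  which keeps the total fit error bounded.\<close>

lemma trace_hat: "(\<Sum>i=1..n. hat i i) = real CARD('d)"
proof -
  have "(\<Sum>i=1..n. hat i i) = (\<Sum>i=1..n. \<Sum>a\<in>UNIV. \<Sum>b\<in>UNIV. Hi $ a $ b * (v i $ b * v i $ a))"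
    by (simp add: hat_def inner_vec_def matrix_vector_mult_def sum_distrib_left mult.commute mult.left_commute)
  also have "\<dots> = (\<Sum>a\<in>UNIV. \<Sum>i=1..n. \<Sum>b\<in>UNIV. Hi $ a $ b * (v i $ b * v i $ a))"
    by (rule sum.swap)
  also have "\<dots> = (\<Sum>a\<in>UNIV. \<Sum>b\<in>UNIV. \<Sum>i=1..n. Hi $ a $ b * (v i $ b * v i $ a))"
    by (intro sum.cong refl sum.swap)
  also have "\<dots> = (\<Sum>a\<in>UNIV. (Hi ** H) $ a $ a)"
    by (simp add: matrix_matrix_mult_def H_def outer_def sum_distrib_left)
  also have "\<dots> = real CARD('d)" unfolding Hi by (simp add: Finite_Cartesian_Product.mat_def)
  finally show ?thesis .
qed

text \<open>The estimator is \<beta> + Hi s, with s the sum of the e i v i. The controls disappear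
  twice: from the normal equations, being orthogonal to v, and from the residuals, being killed by
  the annihilator. What is left is (M - P) e.\<close>

lemma residual_eq:
  assumes y: "\<And>i. i \<in> {1..n} \<Longrightarrow> y i = \<beta> \<bullet> x i + (\<Sum>a<k. \<gamma> a * w i a) + e i"
    and i: "i \<in> {1..n}"
  shows "residual n k w x y i = (\<Sum>j=1..n. annih n k w i j * e j) - (\<Sum>j=1..n. hat i j * e j)"
proof -
  define s where "s = (\<Sum>i=1..n. e i *\<^sub>R v i)"
  have ctrl: "(\<Sum>i=1..n. (\<Sum>a<k. \<gamma> a * w i a) *\<^sub>R v i) = 0"
  proof -
    have "(\<Sum>i=1..n. (\<Sum>a<k. \<gamma> a * w i a) *\<^sub>R v i) = (\<Sum>a<k. \<gamma> a *\<^sub>R (\<Sum>i=1..n. w i a *\<^sub>R v i))"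
      unfolding scaleR_sum_left scaleR_sum_right by (subst sum.swap) simp
    also have "\<dots> = 0" by (intro sum.neutral ballI) (simp add: sum_controls_partial_out[where z = x] del: One_nat_def)
    finally show ?thesis .
  qed
  have "(\<Sum>i=1..n. y i *\<^sub>R v i)
      = (\<Sum>i=1..n. (x i \<bullet> \<beta>) *\<^sub>R v i + (\<Sum>a<k. \<gamma> a * w i a) *\<^sub>R v i + e i *\<^sub>R v i)"
    by (intro sum.cong refl) (simp add: y scaleR_add_left inner_commute)
  also have "\<dots> = H *v \<beta> + s" by (simp only: sum.distrib sum_x_v ctrl s_def add_0_right)
  finally have ols: "ols n k w x y = \<beta> + Hi *v s"
    unfolding ols_def H_def[symmetric] Hi_def[symmetric] by (simp add: matrix_vector_right_distrib Hi_H)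
  have vi: "b \<bullet> v i = (\<Sum>j=1..n. annih n k w i j * (b \<bullet> x j))" for b
    by (simp add: partial_out_def inner_sum_right)
  have ctrl_i: "(\<Sum>j=1..n. annih n k w i j * (\<Sum>a<k. \<gamma> a * w j a)) = 0"
  proof -
    have "(\<Sum>j=1..n. annih n k w i j * (\<Sum>a<k. \<gamma> a * w j a)) = (\<Sum>a<k. \<gamma> a * (\<Sum>j=1..n. annih n k w i j * w j a))"
      unfolding sum_distrib_left by (subst sum.swap) (simp add: mult.left_commute)
    also have "\<dots> = 0" by (intro sum.neutral ballI) (use annih_controls[OF _ i] in simp)
    finally show ?thesis .
  qed
  have "residual n k w x y i = (\<Sum>j=1..n. annih n k w i j * (y j - ols n k w x y \<bullet> x j))"
    by (simp add: residual_def partial_out_def)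
  also have "\<dots> = (\<Sum>j=1..n. annih n k w i j * (\<Sum>a<k. \<gamma> a * w j a) + annih n k w i j * e j
      - annih n k w i j * ((Hi *v s) \<bullet> x j))"
    by (intro sum.cong refl) (simp add: y ols inner_add_left algebra_simps)
  also have "\<dots> = (\<Sum>j=1..n. annih n k w i j * e j) - (Hi *v s) \<bullet> v i"
    by (simp only: sum.distrib sum_subtractf ctrl_i vi add_0_left)
  also have "(Hi *v s) \<bullet> v i = (\<Sum>j=1..n. hat i j * e j)"
    unfolding inner_commute[of _ "v i"] s_def hat_sum ..
  finally show ?thesis .
qed

end

text \<open>The difference of the products is r i r j - e i r j - e j r i. In the mixed terms the
  large part e is weighted by s and the small part r by 1 / s, which yields the halves s / 2 and 1 /
  (2 s); the term r i r j is split evenly and adds 1 / 2.\<close>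

lemma weighted_cross_term_le:
  fixes r e :: "nat \<Rightarrow> real" and C :: "nat \<Rightarrow> nat \<Rightarrow> real"
  assumes s: "0 < s"
  shows "\<bar>\<Sum>i=1..n. \<Sum>j=1..n. C i j * ((e i - r i) * (e j - r j) - e i * e j)\<bar>
    \<le> s / 2 * (\<Sum>i=1..n. \<Sum>j=1..n. \<bar>C i j\<bar> * ((e i)\<^sup>2 + (e j)\<^sup>2))
      + (1 / (2 * s) + 1 / 2) * (\<Sum>i=1..n. \<Sum>j=1..n. \<bar>C i j\<bar> * ((r i)\<^sup>2 + (r j)\<^sup>2))"
proof -
  have amgm: "\<bar>a * b\<bar> \<le> t / 2 * a\<^sup>2 + 1 / (2 * t) * b\<^sup>2" if "0 < t" for a b t :: real
  proof -
    have "0 \<le> (t * \<bar>a\<bar> - \<bar>b\<bar>)\<^sup>2" by simp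
    then have "2 * (t * \<bar>a * b\<bar>) \<le> t\<^sup>2 * a\<^sup>2 + b\<^sup>2"
      by (simp add: power2_diff power_mult_distrib abs_mult mult.assoc)
    then have "\<bar>a * b\<bar> \<le> (t\<^sup>2 * a\<^sup>2 + b\<^sup>2) / (2 * t)"
      using that by (simp add: pos_le_divide_eq mult.commute mult.left_commute)
    also have "\<dots> = t / 2 * a\<^sup>2 + 1 / (2 * t) * b\<^sup>2"
      using that by (simp add: add_divide_distrib power2_eq_square)
    finally show ?thesis .
  qed
  have pt: "\<bar>(e i - r i) * (e j - r j) - e i * e j\<bar>
      \<le> s / 2 * ((e i)\<^sup>2 + (e j)\<^sup>2) + (1 / (2 * s) + 1 / 2) * ((r i)\<^sup>2 + (r j)\<^sup>2)" for i j
  proof -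
    have "(e i - r i) * (e j - r j) - e i * e j = r i * r j - e i * r j - e j * r i"
      by (simp add: algebra_simps)
    then have "\<bar>(e i - r i) * (e j - r j) - e i * e j\<bar> \<le> \<bar>r i * r j\<bar> + \<bar>e i * r j\<bar> + \<bar>e j * r i\<bar>"
      by argo
    then show ?thesis
      using amgm[of 1 "r i" "r j"] amgm[OF s, of "e i" "r j"] amgm[OF s, of "e j" "r i"]
      by (simp add: algebra_simps)
  qed
  have "\<bar>\<Sum>i=1..n. \<Sum>j=1..n. C i j * ((e i - r i) * (e j - r j) - e i * e j)\<bar>
      \<le> (\<Sum>i=1..n. \<Sum>j=1..n. \<bar>C i j * ((e i - r i) * (e j - r j) - e i * e j)\<bar>)"
    by (intro order.trans[OF sum_abs] sum_mono sum_abs)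
  also have "\<dots> \<le> (\<Sum>i=1..n. \<Sum>j=1..n. \<bar>C i j\<bar> * (s / 2 * ((e i)\<^sup>2 + (e j)\<^sup>2) + (1 / (2 * s) + 1 / 2) * ((r i)\<^sup>2 + (r j)\<^sup>2)))"
    unfolding abs_mult[of "C _ _"] by (intro sum_mono mult_left_mono pt) simp
  also have "\<dots> = s / 2 * (\<Sum>i=1..n. \<Sum>j=1..n. \<bar>C i j\<bar> * ((e i)\<^sup>2 + (e j)\<^sup>2))
      + (1 / (2 * s) + 1 / 2) * (\<Sum>i=1..n. \<Sum>j=1..n. \<bar>C i j\<bar> * ((r i)\<^sup>2 + (r j)\<^sup>2))"
    unfolding sum_distrib_left sum.distrib[symmetric]
    by (intro sum.cong refl) (simp only: distrib_left mult.left_commute)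
  finally show ?thesis .
qed

section \<open>Truncated moments of clustered errors\<close>

lemma integrable_integral_leI:
  fixes f :: "'a \<Rightarrow> real"
  assumes [measurable]: "f \<in> borel_measurable M" and f: "\<And>\<omega>. 0 \<le> f \<omega>"
    and le: "(\<integral>\<^sup>+\<omega>. ennreal (f \<omega>) \<partial>M) \<le> ennreal c" and c: "0 \<le> c"
  shows "integrable M f" "integral\<^sup>L M f \<le> c"
proof -
  show int: "integrable M f"
    by (rule integrableI_nonneg) (use f le in \<open>auto intro: le_less_trans\<close>)
  have "ennreal (integral\<^sup>L M f) \<le> ennreal c"
    using le nn_integral_eq_integral[OF int] f by simp
  then show "integral\<^sup>L M f \<le> c" using c by (simp add: ennreal_le_iff)
qed

text \<open>The fourth moments are bounded at every point of E and not merely almost surely, because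
  E is going to be defined by that bound. No moment is bounded off E.\<close>

locale clustered_errors = cluster_row M n k G T x w u
  for M :: "'a measure" and n k G T and x :: "'a \<Rightarrow> nat \<Rightarrow> real ^ 'd" and w u +
  fixes E :: "'a set" and B m :: real
  assumes E_F: "E \<in> sets F"
    and B0: "0 \<le> B"
    and fourth_moment: "\<And>\<omega> i. \<omega> \<in> E \<Longrightarrow> i \<in> {1..n} \<Longrightarrow>
      nn_cond_exp M F (\<lambda>\<omega>. ennreal (u \<omega> i ^ 4)) \<omega> \<le> ennreal B"
    and exog: "\<And>i. i \<in> {1..n} \<Longrightarrow> AE \<omega> in M. real_cond_exp M F (\<lambda>\<omega>. u \<omega> i) \<omega> = 0"
    and card_T: "\<And>g. g \<in> {1..G} \<Longrightarrow> real (card (T g)) \<le> m"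
begin

sublocale F: sigma_finite_subalgebra M F
  by (rule sigma_finite_subalgebraI[OF subalgebra_F])

definition cl :: "nat \<Rightarrow> nat" where
  "cl i = (SOME g. g \<in> {1..G} \<and> i \<in> T g)"

lemma cl: "i \<in> {1..n} \<Longrightarrow> cl i \<in> {1..G}" "i \<in> {1..n} \<Longrightarrow> i \<in> T (cl i)"
  using someI_ex[of "\<lambda>g. g \<in> {1..G} \<and> i \<in> T g"] cluster_ex[of i] unfolding cl_def by blast+

lemma cl_eq: "g \<in> {1..G} \<Longrightarrow> i \<in> T g \<Longrightarrow> cl i = g"
  using T_subset[of g] cl[of i] T_disjoint[of "cl i" g i] by blast

definition err_cov :: "nat \<Rightarrow> nat \<Rightarrow> 'a \<Rightarrow> real" where
  "err_cov i j = real_cond_exp M F (\<lambda>\<omega>. u \<omega> i * u \<omega> j)"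

text \<open>Coefficients that can be pulled out of conditional expectations given F and that switch
  the errors off outside E. The product of a weight with one or two errors is square integrable even
  where the errors alone are not.\<close>

definition weight :: "('a \<Rightarrow> real) \<Rightarrow> bool" where
  "weight a \<longleftrightarrow> a \<in> borel_measurable F \<and> (\<exists>C. \<forall>\<omega>. \<bar>a \<omega>\<bar> \<le> C) \<and> (\<forall>\<omega>. \<omega> \<notin> E \<longrightarrow> a \<omega> = 0)"

lemma F_imp_M: "f \<in> borel_measurable F \<Longrightarrow> f \<in> borel_measurable M"
  by (rule measurable_from_subalg[OF subalgebra_F])

lemma weight_F: "weight a \<Longrightarrow> a \<in> borel_measurable F"
  and weight_M: "weight a \<Longrightarrow> a \<in> borel_measurable M"
  unfolding weight_def by (auto intro: F_imp_M)

lemma weight_zero: "weight a \<Longrightarrow> \<omega> \<notin> E \<Longrightarrow> a \<omega> = 0"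
  by (simp add: weight_def)

lemma weight_square_integrable:
  assumes "weight a"
  shows "integrable M (\<lambda>\<omega>. (a \<omega>)\<^sup>2)"
proof -
  obtain C where C: "\<bar>a \<omega>\<bar> \<le> C" for \<omega> using assms unfolding weight_def by blast
  show ?thesis
  proof (rule integrable_const_bound[of _ "C\<^sup>2"])
    have "(a \<omega>)\<^sup>2 \<le> C\<^sup>2" for \<omega> using power_mono[OF C[of \<omega>], of 2] by simp
    then show "AE \<omega> in M. norm ((a \<omega>)\<^sup>2) \<le> C\<^sup>2" by simp
  qed (use weight_M[OF assms] in measurable)
qed

text \<open>The square of a is F-measurable, so the fourth power of the error may be replaced by its
  conditional expectation, which is at most B wherever a does not vanish. Nonnegative integrals
  deliver integrability and the bound together.\<close>

lemma weighted_fourth: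
  assumes a: "weight a" and i: "i \<in> {1..n}"
  shows "integrable M (\<lambda>\<omega>. (a \<omega>)\<^sup>2 * u \<omega> i ^ 4)"
    "(\<integral>\<omega>. (a \<omega>)\<^sup>2 * u \<omega> i ^ 4 \<partial>M) \<le> B * (\<integral>\<omega>. (a \<omega>)\<^sup>2 \<partial>M)"
proof -
  note [measurable] = weight_F[OF a] weight_M[OF a] ui_rv[OF i]
  have "(\<integral>\<^sup>+\<omega>. ennreal ((a \<omega>)\<^sup>2 * u \<omega> i ^ 4) \<partial>M) = (\<integral>\<^sup>+\<omega>. ennreal ((a \<omega>)\<^sup>2) * ennreal (u \<omega> i ^ 4) \<partial>M)"
    by (simp add: ennreal_mult')
  also have "\<dots> = (\<integral>\<^sup>+\<omega>. ennreal ((a \<omega>)\<^sup>2) * nn_cond_exp M F (\<lambda>\<omega>. ennreal (u \<omega> i ^ 4)) \<omega> \<partial>M)"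
    by (rule F.nn_cond_exp_intg[symmetric]) measurable
  also have "\<dots> \<le> (\<integral>\<^sup>+\<omega>. ennreal ((a \<omega>)\<^sup>2) * ennreal B \<partial>M)"
  proof (rule nn_integral_mono)
    fix \<omega>
    show "ennreal ((a \<omega>)\<^sup>2) * nn_cond_exp M F (\<lambda>\<omega>. ennreal (u \<omega> i ^ 4)) \<omega> \<le> ennreal ((a \<omega>)\<^sup>2) * ennreal B"
      using fourth_moment[OF _ i, of \<omega>] weight_zero[OF a, of \<omega>] by (cases "\<omega> \<in> E") (auto intro: mult_left_mono)
  qed
  also have "\<dots> = (\<integral>\<^sup>+\<omega>. ennreal (B * (a \<omega>)\<^sup>2) \<partial>M)"
    using B0 by (simp add: ennreal_mult' mult.commute)
  also have "\<dots> = ennreal (\<integral>\<omega>. B * (a \<omega>)\<^sup>2 \<partial>M)"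
    by (rule nn_integral_eq_integral) (use weight_square_integrable[OF a] B0 in auto)
  also have "\<dots> = ennreal (B * (\<integral>\<omega>. (a \<omega>)\<^sup>2 \<partial>M))" by simp
  finally have le: "(\<integral>\<^sup>+\<omega>. ennreal ((a \<omega>)\<^sup>2 * u \<omega> i ^ 4) \<partial>M) \<le> ennreal (B * (\<integral>\<omega>. (a \<omega>)\<^sup>2 \<partial>M))" .
  show "integrable M (\<lambda>\<omega>. (a \<omega>)\<^sup>2 * u \<omega> i ^ 4)"
    "(\<integral>\<omega>. (a \<omega>)\<^sup>2 * u \<omega> i ^ 4 \<partial>M) \<le> B * (\<integral>\<omega>. (a \<omega>)\<^sup>2 \<partial>M)"
    by (rule integrable_integral_leI[OF _ _ le]; use B0 in simp)+
qed

text \<open>Reduces second moments to the fourth moments, for which a bound is available; this is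
  the source of the constants 1 + B and 1 + (B + B).\<close>

lemma square_le_fourth: "(z::real)\<^sup>2 \<le> 1 + z ^ 4"
proof -
  have "0 \<le> (z\<^sup>2 - 1)\<^sup>2" by simp
  then have "2 * z\<^sup>2 \<le> z ^ 4 + 1" by (simp add: power2_diff power_mult[symmetric])
  then show ?thesis using zero_le_power2[of z] by argo
qed

lemma weighted_square:
  assumes a: "weight a" and i: "i \<in> {1..n}"
  shows "integrable M (\<lambda>\<omega>. (a \<omega> * u \<omega> i)\<^sup>2)"
    "(\<integral>\<omega>. (a \<omega> * u \<omega> i)\<^sup>2 \<partial>M) \<le> (1 + B) * (\<integral>\<omega>. (a \<omega>)\<^sup>2 \<partial>M)"
proof -
  note [measurable] = weight_M[OF a] ui_rv[OF i]
  let ?h = "\<lambda>\<omega>. (a \<omega>)\<^sup>2 + (a \<omega>)\<^sup>2 * u \<omega> i ^ 4"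
  have h: "integrable M ?h" using weight_square_integrable[OF a] weighted_fourth(1)[OF a i] by simp
  have le: "(a \<omega> * u \<omega> i)\<^sup>2 \<le> ?h \<omega>" for \<omega>
    using mult_left_mono[OF square_le_fourth[of "u \<omega> i"] zero_le_power2[of "a \<omega>"]]
    by (simp add: power_mult_distrib distrib_left)
  show int: "integrable M (\<lambda>\<omega>. (a \<omega> * u \<omega> i)\<^sup>2)"
  proof (rule Bochner_Integration.integrable_bound[OF h])
    show "AE \<omega> in M. norm ((a \<omega> * u \<omega> i)\<^sup>2) \<le> norm (?h \<omega>)"
      using le order.trans[OF zero_le_power2 le] by simp
  qed measurable
  have "(\<integral>\<omega>. (a \<omega> * u \<omega> i)\<^sup>2 \<partial>M) \<le> (\<integral>\<omega>. ?h \<omega> \<partial>M)" by (rule integral_mono[OF int h le])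
  also have "\<dots> = (\<integral>\<omega>. (a \<omega>)\<^sup>2 \<partial>M) + (\<integral>\<omega>. (a \<omega>)\<^sup>2 * u \<omega> i ^ 4 \<partial>M)"
    using weight_square_integrable[OF a] weighted_fourth(1)[OF a i] by simp
  also have "\<dots> \<le> (1 + B) * (\<integral>\<omega>. (a \<omega>)\<^sup>2 \<partial>M)"
    using weighted_fourth(2)[OF a i] unfolding distrib_right by simp
  finally show "(\<integral>\<omega>. (a \<omega> * u \<omega> i)\<^sup>2 \<partial>M) \<le> (1 + B) * (\<integral>\<omega>. (a \<omega>)\<^sup>2 \<partial>M)" .
qed

lemma weighted_product:
  assumes a: "weight a" and i: "i \<in> {1..n}" and j: "j \<in> {1..n}"
  shows "integrable M (\<lambda>\<omega>. (a \<omega> * (u \<omega> i * u \<omega> j))\<^sup>2)"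
    "(\<integral>\<omega>. (a \<omega> * (u \<omega> i * u \<omega> j))\<^sup>2 \<partial>M) \<le> B * (\<integral>\<omega>. (a \<omega>)\<^sup>2 \<partial>M)"
proof -
  note [measurable] = weight_M[OF a] ui_rv[OF i] ui_rv[OF j]
  let ?h = "\<lambda>\<omega>. ((a \<omega>)\<^sup>2 * u \<omega> i ^ 4 + (a \<omega>)\<^sup>2 * u \<omega> j ^ 4) / 2"
  note w4 = weighted_fourth[OF a i] weighted_fourth[OF a j]
  have h: "integrable M ?h" using w4 by simp
  have le: "(a \<omega> * (u \<omega> i * u \<omega> j))\<^sup>2 \<le> ?h \<omega>" for \<omega>
  proof -
    have "0 \<le> ((u \<omega> i)\<^sup>2 - (u \<omega> j)\<^sup>2)\<^sup>2" by simp
    then have "(u \<omega> i)\<^sup>2 * (u \<omega> j)\<^sup>2 \<le> (u \<omega> i ^ 4 + u \<omega> j ^ 4) / 2"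
      by (simp add: power2_diff power_mult[symmetric])
    from mult_left_mono[OF this zero_le_power2[of "a \<omega>"]]
    show ?thesis by (simp add: power_mult_distrib distrib_left)
  qed
  show int: "integrable M (\<lambda>\<omega>. (a \<omega> * (u \<omega> i * u \<omega> j))\<^sup>2)"
  proof (rule Bochner_Integration.integrable_bound[OF h])
    show "AE \<omega> in M. norm ((a \<omega> * (u \<omega> i * u \<omega> j))\<^sup>2) \<le> norm (?h \<omega>)"
    proof (rule AE_I2)
      fix \<omega>
      show "norm ((a \<omega> * (u \<omega> i * u \<omega> j))\<^sup>2) \<le> norm (?h \<omega>)"
        using le[of \<omega>] order.trans[OF zero_le_power2 le[of \<omega>]] by (simp only: real_norm_def abs_of_nonneg zero_le_power2)
    qed
  qed measurable
  have "(\<integral>\<omega>. (a \<omega> * (u \<omega> i * u \<omega> j))\<^sup>2 \<partial>M) \<le> (\<integral>\<omega>. ?h \<omega> \<partial>M)" by (rule integral_mono[OF int h le])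
  also have "\<dots> = ((\<integral>\<omega>. (a \<omega>)\<^sup>2 * u \<omega> i ^ 4 \<partial>M) + (\<integral>\<omega>. (a \<omega>)\<^sup>2 * u \<omega> j ^ 4 \<partial>M)) / 2"
    using w4 by simp
  also have "\<dots> \<le> B * (\<integral>\<omega>. (a \<omega>)\<^sup>2 \<partial>M)"
    using add_mono[OF w4(2) w4(4)] by simp
  finally show "(\<integral>\<omega>. (a \<omega> * (u \<omega> i * u \<omega> j))\<^sup>2 \<partial>M) \<le> B * (\<integral>\<omega>. (a \<omega>)\<^sup>2 \<partial>M)" .
qed

lemma err_cov_F: "err_cov i j \<in> borel_measurable F"
  unfolding err_cov_def by (rule borel_measurable_cond_exp)

text \<open>Rests on |u i u j| <= 1 + u i ^ 4 + u j ^ 4. The comparison of a conditional expectation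
  with that of the absolute value is taken in extended form, so the product need not be
  integrable.\<close>

lemma err_cov_bound:
  assumes i: "i \<in> {1..n}" and j: "j \<in> {1..n}"
  shows "AE \<omega> in M. \<omega> \<in> E \<longrightarrow> \<bar>err_cov i j \<omega>\<bar> \<le> 1 + (B + B)"
proof -
  note [measurable] = ui_rv[OF i] ui_rv[OF j]
  let ?q = "\<lambda>i \<omega>. ennreal (u \<omega> i ^ 4)"
  have 1: "AE \<omega> in M. ennreal \<bar>err_cov i j \<omega>\<bar> \<le> nn_cond_exp M F (\<lambda>\<omega>. ennreal \<bar>u \<omega> i * u \<omega> j\<bar>) \<omega>"
    unfolding err_cov_def by (rule F.real_cond_exp_abs) measurable
  have "AE \<omega> in M. ennreal \<bar>u \<omega> i * u \<omega> j\<bar> \<le> 1 + (?q i \<omega> + ?q j \<omega>)"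
  proof (rule AE_I2)
    fix \<omega>
    have "0 \<le> (\<bar>u \<omega> i\<bar> - \<bar>u \<omega> j\<bar>)\<^sup>2" by simp
    then have 1: "2 * \<bar>u \<omega> i * u \<omega> j\<bar> \<le> (u \<omega> i)\<^sup>2 + (u \<omega> j)\<^sup>2" by (simp add: power2_diff abs_mult)
    have "0 \<le> u \<omega> i ^ 4" "0 \<le> u \<omega> j ^ 4" by simp_all
    with 1 square_le_fourth[of "u \<omega> i"] square_le_fourth[of "u \<omega> j"]
    have "\<bar>u \<omega> i * u \<omega> j\<bar> \<le> 1 + (u \<omega> i ^ 4 + u \<omega> j ^ 4)" by argo
    from ennreal_leI[OF this] show "ennreal \<bar>u \<omega> i * u \<omega> j\<bar> \<le> 1 + (?q i \<omega> + ?q j \<omega>)"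
      by simp
  qed
  then have 2: "AE \<omega> in M. nn_cond_exp M F (\<lambda>\<omega>. ennreal \<bar>u \<omega> i * u \<omega> j\<bar>) \<omega>
      \<le> nn_cond_exp M F (\<lambda>\<omega>. 1 + (?q i \<omega> + ?q j \<omega>)) \<omega>"
    by (rule F.nn_cond_exp_mono) measurable
  have 3: "AE \<omega> in M. nn_cond_exp M F (\<lambda>_. 1) \<omega> + nn_cond_exp M F (\<lambda>\<omega>. ?q i \<omega> + ?q j \<omega>) \<omega>
      = nn_cond_exp M F (\<lambda>\<omega>. 1 + (?q i \<omega> + ?q j \<omega>)) \<omega>"
    by (rule F.nn_cond_exp_sum) measurable
  have 4: "AE \<omega> in M. nn_cond_exp M F (?q i) \<omega> + nn_cond_exp M F (?q j) \<omega> = nn_cond_exp M F (\<lambda>\<omega>. ?q i \<omega> + ?q j \<omega>) \<omega>"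
    by (rule F.nn_cond_exp_sum) measurable
  have 5: "AE \<omega> in M. (1::ennreal) = nn_cond_exp M F (\<lambda>_. 1) \<omega>"
    by (rule F.nn_cond_exp_F_meas) measurable
  show ?thesis using 1 2 3 4 5
  proof eventually_elim
    case (elim \<omega>)
    show ?case
    proof
      assume "\<omega> \<in> E"
      have "ennreal \<bar>err_cov i j \<omega>\<bar> \<le> 1 + (nn_cond_exp M F (?q i) \<omega> + nn_cond_exp M F (?q j) \<omega>)"
        unfolding elim(4) using order.trans[OF elim(1,2)] unfolding elim(3)[symmetric] elim(5)[symmetric] .
      also have "\<dots> \<le> 1 + (ennreal B + ennreal B)"
        by (intro add_left_mono add_mono fourth_moment \<open>\<omega> \<in> E\<close> i j)
      also have "\<dots> = ennreal (1 + (B + B))"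
        by (simp only: ennreal_plus[OF zero_le_one add_nonneg_nonneg[OF B0 B0]] ennreal_plus[OF B0 B0] ennreal_1)
      finally show "\<bar>err_cov i j \<omega>\<bar> \<le> 1 + (B + B)" using B0 by (subst (asm) ennreal_le_iff) auto
    qed
  qed
qed

lemma weighted_err_cov:
  assumes a: "weight a" and i: "i \<in> {1..n}" and j: "j \<in> {1..n}"
  shows "integrable M (\<lambda>\<omega>. (a \<omega> * err_cov i j \<omega>)\<^sup>2)"
    "(\<integral>\<omega>. (a \<omega> * err_cov i j \<omega>)\<^sup>2 \<partial>M) \<le> (1 + (B + B))\<^sup>2 * (\<integral>\<omega>. (a \<omega>)\<^sup>2 \<partial>M)"
proof -
  note [measurable] = weight_M[OF a] F_imp_M[OF err_cov_F[of i j]]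
  have le: "AE \<omega> in M. (a \<omega> * err_cov i j \<omega>)\<^sup>2 \<le> (1 + (B + B))\<^sup>2 * (a \<omega>)\<^sup>2"
    using err_cov_bound[OF i j]
  proof eventually_elim
    case (elim \<omega>)
    show ?case
    proof (cases "\<omega> \<in> E")
      case True
      then have "(err_cov i j \<omega>)\<^sup>2 \<le> (1 + (B + B))\<^sup>2" using elim power_mono[of "\<bar>err_cov i j \<omega>\<bar>" "1 + (B + B)" 2] by simp
      from mult_left_mono[OF this zero_le_power2[of "a \<omega>"]]
      show ?thesis by (simp add: power_mult_distrib mult.commute)
    qed (simp add: weight_zero[OF a])
  qed
  have h: "integrable M (\<lambda>\<omega>. (1 + (B + B))\<^sup>2 * (a \<omega>)\<^sup>2)" using weight_square_integrable[OF a] by simp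
  show int: "integrable M (\<lambda>\<omega>. (a \<omega> * err_cov i j \<omega>)\<^sup>2)"
  proof (rule Bochner_Integration.integrable_bound[OF h])
    show "AE \<omega> in M. norm ((a \<omega> * err_cov i j \<omega>)\<^sup>2) \<le> norm ((1 + (B + B))\<^sup>2 * (a \<omega>)\<^sup>2)"
      using le by eventually_elim simp
  qed measurable
  have "(\<integral>\<omega>. (a \<omega> * err_cov i j \<omega>)\<^sup>2 \<partial>M) \<le> (\<integral>\<omega>. (1 + (B + B))\<^sup>2 * (a \<omega>)\<^sup>2 \<partial>M)"
    by (rule integral_mono_AE[OF int h le])
  then show "(\<integral>\<omega>. (a \<omega> * err_cov i j \<omega>)\<^sup>2 \<partial>M) \<le> (1 + (B + B))\<^sup>2 * (\<integral>\<omega>. (a \<omega>)\<^sup>2 \<partial>M)" by simp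
qed

text \<open>Pairs from different clusters are left uncentred: their weighted products already
  integrate to zero by exogeneity, and the approximating expression contains covariances within
  clusters only.\<close>

definition centred :: "('a \<Rightarrow> real) \<Rightarrow> nat \<Rightarrow> nat \<Rightarrow> 'a \<Rightarrow> real" where
  "centred a i j \<omega> = a \<omega> * (u \<omega> i * u \<omega> j) - (if cl i = cl j then a \<omega> * err_cov i j \<omega> else 0)"

text \<open>From (s - t)^2 <= 2 s^2 + 2 t^2, where the weighted product contributes the factor B and
  its conditional mean the factor (1 + 2 B)^2.\<close>

definition quad_const :: real where
  "quad_const = 2 * B + 2 * (1 + (B + B))\<^sup>2"

lemma centred_M: "weight a \<Longrightarrow> i \<in> {1..n} \<Longrightarrow> j \<in> {1..n} \<Longrightarrow> centred a i j \<in> borel_measurable M"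
proof -
  assume a: "weight a" and i: "i \<in> {1..n}" and j: "j \<in> {1..n}"
  note [measurable] = weight_M[OF a] F_imp_M[OF err_cov_F[of i j]] ui_rv[OF i] ui_rv[OF j]
  show ?thesis unfolding centred_def[abs_def] by measurable
qed

lemma centred_square:
  assumes a: "weight a" and i: "i \<in> {1..n}" and j: "j \<in> {1..n}"
  shows "integrable M (\<lambda>\<omega>. (centred a i j \<omega>)\<^sup>2)"
    "(\<integral>\<omega>. (centred a i j \<omega>)\<^sup>2 \<partial>M) \<le> quad_const * (\<integral>\<omega>. (a \<omega>)\<^sup>2 \<partial>M)"
proof -
  note [measurable] = centred_M[OF a i j]
  note p = weighted_product[OF a i j] and c = weighted_err_cov[OF a i j]
  let ?h = "\<lambda>\<omega>. 2 * (a \<omega> * (u \<omega> i * u \<omega> j))\<^sup>2 + 2 * (a \<omega> * err_cov i j \<omega>)\<^sup>2"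
  have h: "integrable M ?h" using p(1) c(1) by simp
  have le: "(centred a i j \<omega>)\<^sup>2 \<le> ?h \<omega>" for \<omega>
  proof -
    have "(s - t)\<^sup>2 \<le> 2 * s\<^sup>2 + 2 * t\<^sup>2" for s t :: real
    proof -
      have "0 \<le> (s + t)\<^sup>2" by simp
      then show ?thesis by (simp add: power2_sum power2_diff)
    qed
    then show ?thesis by (simp add: centred_def)
  qed
  have h0: "0 \<le> ?h \<omega>" for \<omega> by simp
  show int: "integrable M (\<lambda>\<omega>. (centred a i j \<omega>)\<^sup>2)"
  proof (rule Bochner_Integration.integrable_bound[OF h])
    show "AE \<omega> in M. norm ((centred a i j \<omega>)\<^sup>2) \<le> norm (?h \<omega>)"
      using le h0 by (intro AE_I2) (simp only: real_norm_def abs_of_nonneg zero_le_power2)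
  qed measurable
  have "(\<integral>\<omega>. (centred a i j \<omega>)\<^sup>2 \<partial>M) \<le> (\<integral>\<omega>. ?h \<omega> \<partial>M)" by (rule integral_mono[OF int h le])
  also have "\<dots> = 2 * (\<integral>\<omega>. (a \<omega> * (u \<omega> i * u \<omega> j))\<^sup>2 \<partial>M) + 2 * (\<integral>\<omega>. (a \<omega> * err_cov i j \<omega>)\<^sup>2 \<partial>M)"
    using p(1) c(1) by simp
  also have "\<dots> \<le> quad_const * (\<integral>\<omega>. (a \<omega>)\<^sup>2 \<partial>M)"
    using p(2) c(2) unfolding quad_const_def distrib_right mult.assoc by argo
  finally show "(\<integral>\<omega>. (centred a i j \<omega>)\<^sup>2 \<partial>M) \<le> quad_const * (\<integral>\<omega>. (a \<omega>)\<^sup>2 \<partial>M)" .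
qed

lemma u_block: "i \<in> {1..n} \<Longrightarrow> (\<lambda>\<omega>. u \<omega> i) \<in> borel_measurable (block_algebra (cl i))"
  by (rule ui_block) (use cl in auto)

lemma u_past: "c \<in> {1..G} \<Longrightarrow> i \<in> {1..n} \<Longrightarrow> cl i \<noteq> c \<Longrightarrow> (\<lambda>\<omega>. u \<omega> i) \<in> borel_measurable (past c)"
  by (rule ui_past) (use cl_eq in auto)

lemma F_imp_past: "c \<in> {1..G} \<Longrightarrow> f \<in> borel_measurable F \<Longrightarrow> f \<in> borel_measurable (past c)"
  by (rule measurable_from_subalg[OF subalgebra_past_F])

text \<open>\<open>past_integral\<close> replaces u i by its conditional mean given F, which is
  zero, even when \<open>\<Theta>\<close> involves errors of all other clusters.\<close>

lemma integral_past_error: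
  assumes i: "i \<in> {1..n}" and \<Theta>: "\<Theta> \<in> borel_measurable (past (cl i))"
    and int: "integrable M (\<lambda>\<omega>. \<Theta> \<omega> * u \<omega> i)"
  shows "(\<integral>\<omega>. \<Theta> \<omega> * u \<omega> i \<partial>M) = 0"
proof -
  have "(\<integral>\<omega>. \<Theta> \<omega> * u \<omega> i \<partial>M) = (\<integral>\<omega>. \<Theta> \<omega> * real_cond_exp M F (\<lambda>\<omega>. u \<omega> i) \<omega> \<partial>M)"
    by (rule past_integral(2)[OF cl(1)[OF i] u_block[OF i] \<Theta> int, symmetric])
  also have "\<dots> = 0"
    by (rule integral_eq_zero_AE) (use exog[OF i] in eventually_elim, simp)
  finally show ?thesis .
qed

text \<open>Errors of different clusters are orthogonal, so an index interacts only with the at most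
  m members of its own cluster.\<close>

lemma linear_square:
  assumes a: "\<And>i. i \<in> {1..n} \<Longrightarrow> weight (a i)"
  shows "integrable M (\<lambda>\<omega>. (\<Sum>i=1..n. a i \<omega> * u \<omega> i)\<^sup>2)"
    "(\<integral>\<omega>. (\<Sum>i=1..n. a i \<omega> * u \<omega> i)\<^sup>2 \<partial>M) \<le> m * ((1 + B) * (\<Sum>i=1..n. \<integral>\<omega>. (a i \<omega>)\<^sup>2 \<partial>M))"
proof -
  have meas: "(\<lambda>\<omega>. a i \<omega> * u \<omega> i) \<in> borel_measurable M" if "i \<in> {1..n}" for i
    using weight_M[OF a[OF that]] ui_rv[OF that] by simp
  have sq: "integrable M (\<lambda>\<omega>. (a i \<omega> * u \<omega> i)\<^sup>2)" if "i \<in> {1..n}" for i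
    by (rule weighted_square(1)[OF a[OF that] that])
  have orth: "(\<integral>\<omega>. (a i \<omega> * u \<omega> i) * (a j \<omega> * u \<omega> j) \<partial>M) = 0"
    if i: "i \<in> {1..n}" and j: "j \<in> {1..n}" and ne: "\<not> cl i = cl j" for i j
  proof -
    have "(\<integral>\<omega>. (a i \<omega> * (a j \<omega> * u \<omega> j)) * u \<omega> i \<partial>M) = 0"
    proof (rule integral_past_error[OF i])
      show "(\<lambda>\<omega>. a i \<omega> * (a j \<omega> * u \<omega> j)) \<in> borel_measurable (past (cl i))"
        using F_imp_past[OF cl(1)[OF i] weight_F[OF a[OF i]]] F_imp_past[OF cl(1)[OF i] weight_F[OF a[OF j]]]
          u_past[OF cl(1)[OF i] j] ne by auto
      have "integrable M (\<lambda>\<omega>. (a i \<omega> * u \<omega> i) * (a j \<omega> * u \<omega> j))"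
        by (rule integrable_mult_of_squares[OF meas[OF i] meas[OF j] sq[OF i] sq[OF j]])
      then show "integrable M (\<lambda>\<omega>. (a i \<omega> * (a j \<omega> * u \<omega> j)) * u \<omega> i)" by (simp only: ac_simps)
    qed
    then show ?thesis by (simp only: ac_simps)
  qed
  have deg: "real (card {j \<in> {1..n}. cl i = cl j}) \<le> m" if i: "i \<in> {1..n}" for i
  proof -
    have "{j \<in> {1..n}. cl i = cl j} \<subseteq> T (cl i)" using cl(2) by auto
    then have "card {j \<in> {1..n}. cl i = cl j} \<le> card (T (cl i))" by (rule card_mono[OF finite_T[OF cl(1)[OF i]]])
    then show ?thesis using card_T[OF cl(1)[OF i]] by simp
  qed
  note main = integral_square_sum_le[where z = "\<lambda>i \<omega>. a i \<omega> * u \<omega> i" and R = "\<lambda>i j. cl i = cl j" and m = m,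
    OF finite_atLeastAtMost meas sq orth _ deg]
  show "integrable M (\<lambda>\<omega>. (\<Sum>i=1..n. a i \<omega> * u \<omega> i)\<^sup>2)" by (rule main(1)) auto
  show "(\<integral>\<omega>. (\<Sum>i=1..n. a i \<omega> * u \<omega> i)\<^sup>2 \<partial>M) \<le> m * ((1 + B) * (\<Sum>i=1..n. \<integral>\<omega>. (a i \<omega>)\<^sup>2 \<partial>M))"
  \<comment> \<open>That m is nonnegative is known only once there is a cluster, hence only for
    positive n.\<close>
  proof (cases "n = 0")
    case False
    then have "1 \<in> {1..n}" by simp
    then have "0 \<le> m" using deg[of 1] by (meson of_nat_0_le_iff order.trans)
    have "(\<integral>\<omega>. (\<Sum>i=1..n. a i \<omega> * u \<omega> i)\<^sup>2 \<partial>M) \<le> m * (\<Sum>i=1..n. \<integral>\<omega>. (a i \<omega> * u \<omega> i)\<^sup>2 \<partial>M)"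
      by (rule main(2)) auto
    also have "\<dots> \<le> m * (\<Sum>i=1..n. (1 + B) * (\<integral>\<omega>. (a i \<omega>)\<^sup>2 \<partial>M))"
      by (intro mult_left_mono sum_mono weighted_square(2) a \<open>0 \<le> m\<close>)
    finally show ?thesis by (simp only: sum_distrib_left)
  qed simp
qed

lemma centred_commute: "centred a i j = centred a j i"
  by (rule ext) (simp add: centred_def err_cov_def mult.commute)

lemma centred_past:
  assumes a: "weight a" and i: "i \<in> {1..n}" and j: "j \<in> {1..n}"
    and c: "c \<in> {1..G}" "cl i \<noteq> c" "cl j \<noteq> c"
  shows "centred a i j \<in> borel_measurable (past c)"
proof -
  note [measurable] = F_imp_past[OF c(1) weight_F[OF a]] F_imp_past[OF c(1) err_cov_F[of i j]]
    u_past[OF c(1) i c(2)] u_past[OF c(1) j c(3)]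
  show ?thesis unfolding centred_def[abs_def] by measurable
qed

text \<open>The cluster of i is absent from the second factor, which is therefore measurable with
  respect to \<open>past (cl i)\<close>. If j lies in another cluster, u i stands alone and
  exogeneity applies; if j shares the cluster of i, the product u i u j is replaced by its
  conditional mean, and that is what the centring subtracts.\<close>

lemma centred_orth_left:
  assumes a: "weight a" and b: "weight b"
    and i: "i \<in> {1..n}" and j: "j \<in> {1..n}" and p: "p \<in> {1..n}" and q: "q \<in> {1..n}"
    and ip: "cl p \<noteq> cl i" and iq: "cl q \<noteq> cl i"
  shows "(\<integral>\<omega>. centred a i j \<omega> * centred b p q \<omega> \<partial>M) = 0"
proof -
  let ?y = "centred b p q"
  note y_past = centred_past[OF b p q cl(1)[OF i] ip iq]
  note y = centred_M[OF b p q] and y2 = centred_square(1)[OF b p q]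
  have auu_M: "(\<lambda>\<omega>. a \<omega> * (u \<omega> i * u \<omega> j)) \<in> borel_measurable M"
    using weight_M[OF a] ui_rv[OF i] ui_rv[OF j] by simp
  have int: "integrable M (\<lambda>\<omega>. (a \<omega> * (u \<omega> i * u \<omega> j)) * ?y \<omega>)"
    by (rule integrable_mult_of_squares[OF auu_M y weighted_product(1)[OF a i j] y2])
  note a_past = F_imp_past[OF cl(1)[OF i] weight_F[OF a]]
  show ?thesis
  proof (cases "cl j = cl i")
    case False
    have "(\<integral>\<omega>. (a \<omega> * u \<omega> j * ?y \<omega>) * u \<omega> i \<partial>M) = 0"
    proof (rule integral_past_error[OF i])
      show "(\<lambda>\<omega>. a \<omega> * u \<omega> j * ?y \<omega>) \<in> borel_measurable (past (cl i))"
        using a_past y_past u_past[OF cl(1)[OF i] j False] by simp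
      show "integrable M (\<lambda>\<omega>. (a \<omega> * u \<omega> j * ?y \<omega>) * u \<omega> i)" using int by (simp only: ac_simps)
    qed
    then show ?thesis using False by (simp add: centred_def[of a] ac_simps)
  next
    case True
    have \<Theta>: "(\<lambda>\<omega>. a \<omega> * ?y \<omega>) \<in> borel_measurable (past (cl i))" using a_past y_past by simp
    have uu: "(\<lambda>\<omega>. u \<omega> i * u \<omega> j) \<in> borel_measurable (block_algebra (cl i))"
      using u_block[OF i] u_block[OF j] True by simp
    have int': "integrable M (\<lambda>\<omega>. (a \<omega> * ?y \<omega>) * (u \<omega> i * u \<omega> j))" using int by (simp only: ac_simps)
    note pi = past_integral[OF cl(1)[OF i] uu \<Theta> int', folded err_cov_def]
    have "(\<integral>\<omega>. centred a i j \<omega> * ?y \<omega> \<partial>M)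
      = (\<integral>\<omega>. (a \<omega> * ?y \<omega>) * (u \<omega> i * u \<omega> j) - (a \<omega> * ?y \<omega>) * err_cov i j \<omega> \<partial>M)"
      using True by (intro Bochner_Integration.integral_cong refl) (simp add: centred_def[of a] algebra_simps)
    also have "\<dots> = 0" using pi int' by simp
    finally show ?thesis .
  qed
qed

text \<open>Of two different sets of clusters, one has a member that the other lacks. Exchanging the
  indices or the factors brings this cluster to the position of
  \<open>centred_orth_left\<close>.\<close>

lemma centred_orth:
  assumes a: "weight a" and b: "weight b"
    and i: "i \<in> {1..n}" and j: "j \<in> {1..n}" and p: "p \<in> {1..n}" and q: "q \<in> {1..n}"
    and ne: "{cl i, cl j} \<noteq> {cl p, cl q}"
  shows "(\<integral>\<omega>. centred a i j \<omega> * centred b p q \<omega> \<partial>M) = 0"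
proof -
  consider "cl p \<noteq> cl i" "cl q \<noteq> cl i" | "cl p \<noteq> cl j" "cl q \<noteq> cl j"
    | "cl i \<noteq> cl p" "cl j \<noteq> cl p" | "cl i \<noteq> cl q" "cl j \<noteq> cl q"
    using ne by (auto simp: doubleton_eq_iff)
  then show ?thesis
  proof cases
    case 1 then show ?thesis by (rule centred_orth_left[OF a b i j p q])
  next
    case 2 then show ?thesis using centred_orth_left[OF a b j i p q] by (simp add: centred_commute[of a i])
  next
    case 3 then show ?thesis using centred_orth_left[OF b a p q i j] by (simp add: mult.commute)
  next
    case 4 then show ?thesis
      using centred_orth_left[OF b a q p i j] by (simp add: mult.commute centred_commute[of b p])
  qed
qed

lemma quadratic_square:
  assumes a: "\<And>i j. i \<in> {1..n} \<Longrightarrow> j \<in> {1..n} \<Longrightarrow> weight (a i j)"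
  shows "integrable M (\<lambda>\<omega>. (\<Sum>i=1..n. \<Sum>j=1..n. centred (a i j) i j \<omega>)\<^sup>2)"
    "(\<integral>\<omega>. (\<Sum>i=1..n. \<Sum>j=1..n. centred (a i j) i j \<omega>)\<^sup>2 \<partial>M)
      \<le> 2 * m\<^sup>2 * (quad_const * (\<Sum>i=1..n. \<Sum>j=1..n. \<integral>\<omega>. (a i j \<omega>)\<^sup>2 \<partial>M))"
proof -
  let ?I = "{1..n} \<times> {1..n}"
  let ?z = "\<lambda>p \<omega>. centred (a (fst p) (snd p)) (fst p) (snd p) \<omega>"
  let ?R = "\<lambda>p q. {cl (fst p), cl (snd p)} = {cl (fst q), cl (snd q)}"
  have fin: "finite ?I" by simp
  have meas: "?z p \<in> borel_measurable M" if "p \<in> ?I" for p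
    using that by (auto intro!: centred_M a)
  have sq: "integrable M (\<lambda>\<omega>. (?z p \<omega>)\<^sup>2)" if "p \<in> ?I" for p
    using that by (auto intro!: centred_square(1) a)
  have orth: "(\<integral>\<omega>. ?z p \<omega> * ?z q \<omega> \<partial>M) = 0" if "p \<in> ?I" "q \<in> ?I" "\<not> ?R p q" for p q
    by (rule centred_orth) (use that in \<open>auto intro!: a\<close>)
  \<comment> \<open>The same unordered pair of clusters is met by at most m^2 pairs of indices in
    each of its two orders.\<close>
  have deg: "real (card {q \<in> ?I. ?R p q}) \<le> 2 * m\<^sup>2" if p: "p \<in> ?I" for p
  proof -
    let ?A = "T (cl (fst p))" and ?B = "T (cl (snd p))"
    have c: "cl (fst p) \<in> {1..G}" "cl (snd p) \<in> {1..G}" using p cl(1) by auto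
    have fin: "finite ?A" "finite ?B" using c finite_T by auto
    have "{q \<in> ?I. ?R p q} \<subseteq> ?A \<times> ?B \<union> ?B \<times> ?A"
    proof
      fix q assume "q \<in> {q \<in> ?I. ?R p q}"
      then have q: "fst q \<in> {1..n}" "snd q \<in> {1..n}" "?R p q" by auto
      from q(3) consider "cl (fst q) = cl (fst p)" "cl (snd q) = cl (snd p)"
        | "cl (fst q) = cl (snd p)" "cl (snd q) = cl (fst p)" by (auto simp: doubleton_eq_iff)
      then show "q \<in> ?A \<times> ?B \<union> ?B \<times> ?A"
        using cl(2)[OF q(1)] cl(2)[OF q(2)] by cases (auto simp: mem_Times_iff)
    qed
    then have "card {q \<in> ?I. ?R p q} \<le> card (?A \<times> ?B \<union> ?B \<times> ?A)" using fin by (intro card_mono) auto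
    also have "\<dots> \<le> card ?A * card ?B + card ?B * card ?A"
      using card_Un_le[of "?A \<times> ?B" "?B \<times> ?A"] by (simp add: card_cartesian_product)
    finally have "card {q \<in> ?I. ?R p q} \<le> 2 * (card ?A * card ?B)" by (simp add: mult.commute)
    from of_nat_mono[OF this, where 'a = real]
    have "real (card {q \<in> ?I. ?R p q}) \<le> 2 * (real (card ?A) * real (card ?B))"
      by (simp only: of_nat_mult of_nat_numeral)
    also have "\<dots> \<le> 2 * (m * m)"
      using card_T[OF c(1)] card_T[OF c(2)] order.trans[OF of_nat_0_le_iff card_T[OF c(1)]]
      by (intro mult_left_mono mult_mono) simp_all
    finally show ?thesis by (simp add: power2_eq_square)
  qed
  note main = integral_square_sum_le[where z = ?z and R = ?R and m = "2 * m\<^sup>2", OF fin meas sq orth _ deg]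
  have sum_eq: "(\<Sum>i=1..n. \<Sum>j=1..n. f i j) = (\<Sum>p\<in>?I. f (fst p) (snd p))" for f :: "nat \<Rightarrow> nat \<Rightarrow> real"
    by (simp add: sum.cartesian_product case_prod_beta)
  show "integrable M (\<lambda>\<omega>. (\<Sum>i=1..n. \<Sum>j=1..n. centred (a i j) i j \<omega>)\<^sup>2)"
    unfolding sum_eq by (rule main(1)) auto
  have "(\<integral>\<omega>. (\<Sum>p\<in>?I. ?z p \<omega>)\<^sup>2 \<partial>M) \<le> 2 * m\<^sup>2 * (\<Sum>p\<in>?I. \<integral>\<omega>. (?z p \<omega>)\<^sup>2 \<partial>M)"
    by (rule main(2)) auto
  also have "\<dots> \<le> 2 * m\<^sup>2 * (\<Sum>p\<in>?I. quad_const * (\<integral>\<omega>. (a (fst p) (snd p) \<omega>)\<^sup>2 \<partial>M))"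
    by (intro mult_left_mono sum_mono centred_square(2) a) auto
  finally show "(\<integral>\<omega>. (\<Sum>i=1..n. \<Sum>j=1..n. centred (a i j) i j \<omega>)\<^sup>2 \<partial>M)
      \<le> 2 * m\<^sup>2 * (quad_const * (\<Sum>i=1..n. \<Sum>j=1..n. \<integral>\<omega>. (a i j \<omega>)\<^sup>2 \<partial>M))"
    unfolding sum_eq sum_distrib_left .
qed

end

section \<open>Measurability\<close>

lemma control_component:
  assumes w: "w \<in> measurable N (control_space n k)" and i: "i \<in> {1..n}" and a: "a < k"
  shows "(\<lambda>\<omega>. w \<omega> i a) \<in> borel_measurable N"
proof -
  have "(\<lambda>\<omega>. w \<omega> i) \<in> measurable N (Pi\<^sub>M {..<k} (\<lambda>_. borel))"
    using measurable_compose[OF w[unfolded control_space_def] measurable_component_singleton[OF i]] .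
  from measurable_compose[OF this measurable_component_singleton, of a] show ?thesis using a by simp
qed

lemma borel_measurable_det_mat:
  assumes "\<And>\<omega>. A \<omega> \<in> carrier_mat m m"
    and "\<And>i j. i < m \<Longrightarrow> j < m \<Longrightarrow> (\<lambda>\<omega>. A \<omega> $$ (i, j)) \<in> borel_measurable N"
  shows "(\<lambda>\<omega>. Determinant.det (A \<omega>) :: real) \<in> borel_measurable N"
proof -
  have eq: "(\<lambda>\<omega>. Determinant.det (A \<omega>))
      = (\<lambda>\<omega>. \<Sum>p \<in> {p. p permutes {0..<m}}. signof p * (\<Prod>i = 0..<m. A \<omega> $$ (i, p i)))"
    by (rule ext) (rule det_def'[OF assms(1)])
  show ?thesis unfolding eq
    by (intro borel_measurable_sum borel_measurable_times borel_measurable_const borel_measurable_prod assms(2))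
       (use permutes_in_image[of _ "{0..<m}"] in fastforce)+
qed

lemma gram_measurable:
  assumes w: "w \<in> measurable N (control_space n k)" and ab: "a < k" "b < k"
  shows "(\<lambda>\<omega>. gram n k (w \<omega>) $$ (a, b)) \<in> borel_measurable N"
  unfolding gram_index[OF ab]
  by (intro borel_measurable_sum borel_measurable_times control_component[OF w] ab)

lemma det_gram_measurable:
  assumes w: "w \<in> measurable N (control_space n k)"
  shows "(\<lambda>\<omega>. Determinant.det (gram n k (w \<omega>))) \<in> borel_measurable N"
  by (rule borel_measurable_det_mat[OF gram_carrier gram_measurable[OF w]])

text \<open>The adjugate formula reduces the claim to the determinant and one minor of the Gram
  matrix, both polynomials in measurable entries.\<close>

lemma inv_gram_measurable:
  assumes w: "w \<in> measurable N (control_space n k)" and ab: "a < k" "b < k"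
  shows "(\<lambda>\<omega>. inv_mat (gram n k (w \<omega>)) $$ (a, b)) \<in> borel_measurable N"
proof -
  have c: "dim_row (gram n k z) = k" "dim_col (gram n k z) = k" for z by (simp_all add: gram_def)
  have minor: "mat_delete (gram n k z) b a \<in> carrier_mat (k - 1) (k - 1)" for z
    by (rule mat_delete_carrier[OF gram_carrier])
  have minor_m: "(\<lambda>\<omega>. Determinant.det (mat_delete (gram n k (w \<omega>)) b a)) \<in> borel_measurable N"
  proof (rule borel_measurable_det_mat[OF minor])
    fix i j assume ij: "i < k - 1" "j < k - 1"
    have "mat_delete (gram n k z) b a $$ (i, j)
        = gram n k z $$ (if i < b then i else Suc i, if j < a then j else Suc j)" for z
      using ij by (simp add: mat_delete_def c)
    moreover have "(if i < b then i else Suc i) < k" "(if j < a then j else Suc j) < k" using ij by auto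
    ultimately show "(\<lambda>\<omega>. mat_delete (gram n k (w \<omega>)) b a $$ (i, j)) \<in> borel_measurable N"
      using gram_measurable[OF w] by presburger
  qed
  have eq: "inv_mat (gram n k z) $$ (a, b) = (if Determinant.det (gram n k z) = 0 then 0
      else (- 1) ^ (b + a) * Determinant.det (mat_delete (gram n k z) b a) / Determinant.det (gram n k z))" for z
    unfolding inv_mat_eq_adj[OF gram_carrier ab] using ab by (simp add: adj_mat_def cofactor_def c)
  note [measurable] = minor_m det_gram_measurable[OF w]
  show ?thesis unfolding eq by measurable
qed

lemma annih_measurable:
  assumes w: "w \<in> measurable N (control_space n k)" and ij: "i \<in> {1..n}" "j \<in> {1..n}"
  shows "(\<lambda>\<omega>. annih n k (w \<omega>) i j) \<in> borel_measurable N"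
  unfolding annih_def
  by (intro borel_measurable_diff borel_measurable_const borel_measurable_sum borel_measurable_times
      control_component[OF w] inv_gram_measurable[OF w] ij; simp)

lemma borel_measurable_vec_nth:
  assumes "f \<in> borel_measurable N"
  shows "(\<lambda>\<omega>. f \<omega> $ a :: 'b::topological_space) \<in> borel_measurable N"
proof -
  have "(\<lambda>v. v $ a :: 'b) \<in> borel_measurable borel"
    by (intro borel_measurable_continuous_onI continuous_intros)
  from measurable_compose[OF assms this] show ?thesis .
qed

lemma borel_measurable_vecI:
  fixes f :: "'a \<Rightarrow> ('b::euclidean_space) ^ 'd"
  assumes "\<And>a. (\<lambda>\<omega>. f \<omega> $ a) \<in> borel_measurable N"
  shows "f \<in> borel_measurable N"
proof -
  have "(\<lambda>\<omega>. f \<omega> \<bullet> i) \<in> borel_measurable N" if "i \<in> Basis" for i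
  proof -
    from that obtain a b where i: "i = axis a b" by (auto simp: Basis_vec_def)
    show ?thesis unfolding i inner_axis using assms[of a] by measurable
  qed
  then show ?thesis by (simp add: borel_measurable_euclidean_space[of f])
qed

lemma partial_out_measurable:
  assumes w: "w \<in> measurable N (control_space n k)" and i: "i \<in> {1..n}"
    and z: "\<And>j. j \<in> {1..n} \<Longrightarrow> (\<lambda>\<omega>. z \<omega> j :: 'b::{second_countable_topology, real_normed_vector}) \<in> borel_measurable N"
  shows "(\<lambda>\<omega>. partial_out n k (w \<omega>) (z \<omega>) i) \<in> borel_measurable N"
  unfolding partial_out_def
  by (intro borel_measurable_sum borel_measurable_scaleR annih_measurable[OF w] i z)

lemma borel_measurable_det:
  fixes A :: "'a \<Rightarrow> real ^ 'd ^ 'd"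
  assumes "\<And>a b. (\<lambda>\<omega>. A \<omega> $ a $ b) \<in> borel_measurable N"
  shows "(\<lambda>\<omega>. Determinants.det (A \<omega>)) \<in> borel_measurable N"
  unfolding Determinants.det_def
  by (intro borel_measurable_sum borel_measurable_times borel_measurable_const borel_measurable_prod assms)

lemma pred_invertible:
  fixes A :: "'a \<Rightarrow> real ^ 'd ^ 'd"
  assumes "\<And>a b. (\<lambda>\<omega>. A \<omega> $ a $ b) \<in> borel_measurable N"
  shows "Measurable.pred N (\<lambda>\<omega>. invertible (A \<omega>))"
  unfolding invertible_det_nz using borel_measurable_det[OF assms] by measurable

text \<open>\<open>matrix_inv\<close> is a choice, unknown but constant on singular matrices: there
  the defining predicate is identically false, just as at 0, so the same element is chosen. On
  regular matrices Cramer's rule gives a quotient of determinants. Together this makes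
  \<open>matrix_inv\<close> measurable without any assumption of regularity.\<close>

lemma matrix_inv_eq_cramer:
  fixes A :: "real ^ 'd ^ 'd"
  shows "matrix_inv A $ a $ b =
    (if Determinants.det A = 0 then matrix_inv 0 $ a $ b
     else Determinants.det (\<chi> i j. if j = a then (if i = b then 1 else 0) else A $ i $ j) / Determinants.det A)"
proof (cases "Determinants.det A = 0")
  case True
  have "(A ** X = Finite_Cartesian_Product.mat 1 \<and> X ** A = Finite_Cartesian_Product.mat 1) = False" for X
    using True invertible_det_nz[of A] unfolding invertible_def by blast
  moreover have "((0 :: real ^ 'd ^ 'd) ** X = Finite_Cartesian_Product.mat 1 \<and> X ** 0 = Finite_Cartesian_Product.mat 1) = False" for X
  proof -
    have "((0 :: real ^ 'd ^ 'd) ** X) $ a $ a \<noteq> Finite_Cartesian_Product.mat 1 $ a $ a"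
      by (simp add: matrix_matrix_mult_def Finite_Cartesian_Product.mat_def)
    then show ?thesis by metis
  qed
  ultimately have "matrix_inv A = matrix_inv 0" unfolding matrix_inv_def by (simp only:)
  then show ?thesis using True by simp
next
  case False
  let ?e = "(\<chi> i. if i = b then 1 else 0) :: real ^ 'd"
  have inv: "invertible A" using False by (simp add: invertible_det_nz)
  have "A *v (matrix_inv A *v ?e) = ?e"
    by (simp add: matrix_vector_mul_assoc matrix_inv_inverts(2)[OF inv])
  then have "matrix_inv A *v ?e = (\<chi> k. Determinants.det (\<chi> i j. if j = k then ?e $ i else A $ i $ j) / Determinants.det A)"
    using cramer[OF False] by blast
  then have "(matrix_inv A *v ?e) $ a = Determinants.det (\<chi> i j. if j = a then (if i = b then 1 else 0) else A $ i $ j) / Determinants.det A"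
    by (simp only: vec_lambda_beta)
  moreover have "(matrix_inv A *v ?e) $ a = matrix_inv A $ a $ b"
    by (simp add: matrix_vector_mult_def if_distrib cong: if_cong)
  ultimately show ?thesis using False by simp
qed

lemma matrix_inv_measurable:
  fixes A :: "'a \<Rightarrow> real ^ 'd ^ 'd"
  assumes A: "\<And>a b. (\<lambda>\<omega>. A \<omega> $ a $ b) \<in> borel_measurable N"
  shows "(\<lambda>\<omega>. matrix_inv (A \<omega>) $ a $ b) \<in> borel_measurable N"
proof -
  have "(\<lambda>\<omega>. Determinants.det (\<chi> i j. if j = a then (if i = b then 1 else 0) else A \<omega> $ i $ j)) \<in> borel_measurable N"
    by (rule borel_measurable_det) (use A in auto)
  note [measurable] = this borel_measurable_det[OF A]
  show ?thesis unfolding matrix_inv_eq_cramer[of "A _"] by measurable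
qed

lemma H_component_measurable:
  fixes x :: "'a \<Rightarrow> nat \<Rightarrow> real ^ 'd"
  assumes w: "w \<in> measurable N (control_space n k)"
    and x: "\<And>i. i \<in> {1..n} \<Longrightarrow> (\<lambda>\<omega>. x \<omega> i) \<in> borel_measurable N"
  shows "(\<lambda>\<omega>. (\<Sum>i=1..n. outer (partial_out n k (w \<omega>) (x \<omega>) i) (partial_out n k (w \<omega>) (x \<omega>) i)) $ a $ b)
    \<in> borel_measurable N"
  unfolding sum_component outer_def vec_lambda_beta
  by (intro borel_measurable_sum borel_measurable_times borel_measurable_vec_nth partial_out_measurable[OF w] x)

lemma residual_measurable:
  fixes x :: "'a \<Rightarrow> nat \<Rightarrow> real ^ 'd" and y :: "'a \<Rightarrow> nat \<Rightarrow> real"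
  assumes w: "w \<in> measurable N (control_space n k)"
    and x: "\<And>i. i \<in> {1..n} \<Longrightarrow> (\<lambda>\<omega>. x \<omega> i) \<in> borel_measurable N"
    and y: "\<And>i. i \<in> {1..n} \<Longrightarrow> (\<lambda>\<omega>. y \<omega> i) \<in> borel_measurable N"
    and i: "i \<in> {1..n}"
  shows "(\<lambda>\<omega>. residual n k (w \<omega>) (x \<omega>) (y \<omega>) i) \<in> borel_measurable N"
proof -
  have "(\<lambda>\<omega>. ols n k (w \<omega>) (x \<omega>) (y \<omega>)) \<in> borel_measurable N"
  proof (rule borel_measurable_vecI)
    fix a
    show "(\<lambda>\<omega>. ols n k (w \<omega>) (x \<omega>) (y \<omega>) $ a) \<in> borel_measurable N"
      unfolding ols_def matrix_vector_mult_def vec_lambda_beta sum_component[of _ "{1..n}"] vector_scaleR_component real_scaleR_def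
      by (intro borel_measurable_sum borel_measurable_times matrix_inv_measurable H_component_measurable[OF w x]
          borel_measurable_vec_nth partial_out_measurable[OF w] x y)
  qed
  then show ?thesis unfolding residual_def
    by (intro partial_out_measurable[OF w i] borel_measurable_diff borel_measurable_inner x y)
qed

section \<open>The estimation error of a component\<close>

text \<open>In the sums to be treated all cluster indices precede the observation indices. Moving a
  cluster sum inwards puts each cluster next to its own members, after which the sums run over
  triples.\<close>

lemma sum_push2:
  fixes f :: "'a \<Rightarrow> 'b \<Rightarrow> 'c \<Rightarrow> 'e::comm_monoid_add"
  shows "(\<Sum>g\<in>A. \<Sum>i\<in>B. \<Sum>j\<in>C i. f g i j) = (\<Sum>i\<in>B. \<Sum>j\<in>C i. \<Sum>g\<in>A. f g i j)"
  by (subst sum.swap, intro sum.cong refl sum.swap)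

lemma sum_push4:
  fixes f :: "'a \<Rightarrow> 'b \<Rightarrow> 'c \<Rightarrow> 'd \<Rightarrow> 'f \<Rightarrow> 'e::comm_monoid_add"
  shows "(\<Sum>g\<in>A. \<Sum>i\<in>B. \<Sum>j\<in>C. \<Sum>k\<in>D. \<Sum>l\<in>E. f g i j k l)
    = (\<Sum>i\<in>B. \<Sum>j\<in>C. \<Sum>k\<in>D. \<Sum>l\<in>E. \<Sum>g\<in>A. f g i j k l)"
  by (subst sum_push2) (intro sum.cong refl sum_push2)

context clustered_errors
begin

text \<open>A pair (g, i) with i in T g is determined by i, because g is then
  \<open>cl i\<close>.\<close>

lemma sum_clusters:
  fixes f :: "nat \<Rightarrow> nat \<Rightarrow> 'c::comm_monoid_add"
  shows "(\<Sum>g=1..G. \<Sum>i\<in>T g. f g i) = (\<Sum>i=1..n. f (cl i) i)"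
proof -
  have "(\<Sum>i=1..n. f (cl i) i) = (\<Sum>i\<in>\<Union>(T ` {1..G}). f (cl i) i)"
    using partition_onD1[OF partition(1)] by simp
  also have "\<dots> = (\<Sum>g=1..G. \<Sum>i\<in>T g. f (cl i) i)"
    by (rule sum.UNION_disjoint) (use finite_T T_disjoint in blast)+
  also have "\<dots> = (\<Sum>g=1..G. \<Sum>i\<in>T g. f g i)"
    by (intro sum.cong refl) (simp add: cl_eq)
  finally show ?thesis ..
qed

lemma sum_T: "i \<in> {1..n} \<Longrightarrow> (\<Sum>j\<in>T (cl i). h j) = (\<Sum>j=1..n. if cl i = cl j then h j else 0)"
  for h :: "nat \<Rightarrow> 'c::comm_monoid_add"
proof -
  assume i: "i \<in> {1..n}"
  have "T (cl i) = {j \<in> {1..n}. cl i = cl j}"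
  proof (intro equalityI subsetI)
    fix j assume "j \<in> T (cl i)"
    then show "j \<in> {j \<in> {1..n}. cl i = cl j}"
      using T_subset[OF cl(1)[OF i]] cl_eq[OF cl(1)[OF i]] by fastforce
  next
    fix j assume "j \<in> {j \<in> {1..n}. cl i = cl j}"
    then show "j \<in> T (cl i)" using cl(2)[of j] by simp
  qed
  then show ?thesis using sum.inter_filter[of "{1..n}" h "\<lambda>j. cl i = cl j"] by (simp only: finite_atLeastAtMost)
qed

lemma sum_cluster_pairs:
  fixes f :: "nat \<Rightarrow> nat \<Rightarrow> nat \<Rightarrow> 'c::comm_monoid_add"
  shows "(\<Sum>g=1..G. \<Sum>i\<in>T g. \<Sum>j\<in>T g. f g i j)
    = (\<Sum>i=1..n. \<Sum>j=1..n. if cl i = cl j then f (cl i) i j else 0)"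
  unfolding sum_clusters by (intro sum.cong refl sum_T)

lemma sum_idx:
  fixes f :: "nat \<times> nat \<times> nat \<Rightarrow> 'c::comm_monoid_add"
  shows "(\<Sum>g=1..G. \<Sum>i\<in>T g. \<Sum>j\<in>T g. f (g, i, j)) = (\<Sum>p\<in>idx G T. f p)"
proof -
  have "(\<Sum>p\<in>idx G T. f p) = (\<Sum>g=1..G. \<Sum>q\<in>T g \<times> T g. f (g, q))"
    unfolding idx_def using finite_T by (subst sum.Sigma) (auto simp: case_prod_beta)
  then show ?thesis by (simp add: sum.cartesian_product case_prod_beta)
qed

lemma sum_idx2:
  fixes f :: "nat \<times> nat \<times> nat \<Rightarrow> nat \<times> nat \<times> nat \<Rightarrow> 'c::comm_monoid_add"
  shows "(\<Sum>g1=1..G. \<Sum>i1\<in>T g1. \<Sum>j1\<in>T g1. \<Sum>g2=1..G. \<Sum>i2\<in>T g2. \<Sum>j2\<in>T g2.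
      f (g1, i1, j1) (g2, i2, j2)) = (\<Sum>p\<in>idx G T. \<Sum>q\<in>idx G T. f p q)"
  unfolding sum_idx[of "f p" for p] by (rule sum_idx[of "\<lambda>p. \<Sum>q\<in>idx G T. f p q"])

lemma sum_idx3:
  fixes f :: "nat \<times> nat \<times> nat \<Rightarrow> nat \<times> nat \<times> nat \<Rightarrow> nat \<times> nat \<times> nat \<Rightarrow> 'c::comm_monoid_add"
  shows "(\<Sum>g1=1..G. \<Sum>i1\<in>T g1. \<Sum>j1\<in>T g1. \<Sum>g2=1..G. \<Sum>i2\<in>T g2. \<Sum>j2\<in>T g2.
      \<Sum>g3=1..G. \<Sum>i3\<in>T g3. \<Sum>j3\<in>T g3. f (g1, i1, j1) (g2, i2, j2) (g3, i3, j3))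
    = (\<Sum>p\<in>idx G T. \<Sum>q\<in>idx G T. \<Sum>s\<in>idx G T. f p q s)"
  unfolding sum_idx[of "f p q" for p q] by (rule sum_idx2[of "\<lambda>p q. \<Sum>s\<in>idx G T. f p q s"])

lemma idx_cl: "i \<in> {1..n} \<Longrightarrow> j \<in> {1..n} \<Longrightarrow> cl i = cl j \<Longrightarrow> (cl i, i, j) \<in> idx G T"
  unfolding idx_def using cl[of i] cl[of j] by auto

end

section \<open>Splitting an entry of the estimation error\<close>

locale weighted_row = clustered_errors M n k G T x w u E B m
  for M :: "'a measure" and n k G T and x :: "'a \<Rightarrow> nat \<Rightarrow> real ^ 'd" and w u E B m +
  fixes y :: "'a \<Rightarrow> nat \<Rightarrow> real" and \<kappa> :: "(nat \<Rightarrow> nat \<Rightarrow> real) \<Rightarrow> weights"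
    and \<beta> :: "real ^ 'd" and \<gamma> :: "nat \<Rightarrow> real" and \<delta> :: real
  assumes n0: "0 < n"
    and model: "\<And>i \<omega>. i \<in> {1..n} \<Longrightarrow> \<omega> \<in> space M \<Longrightarrow>
      y \<omega> i = \<beta> \<bullet> x \<omega> i + (\<Sum>a<k. \<gamma> a * w \<omega> i a) + u \<omega> i"
    and \<kappa>_meas: "\<And>p q. p \<in> idx G T \<Longrightarrow> q \<in> idx G T \<Longrightarrow>
      (\<lambda>z. \<kappa> z p q) \<in> borel_measurable (control_space n k)"
    and \<kappa>_sym: "\<And>z p q. z \<in> space (control_space n k) \<Longrightarrow>
      p \<in> idx G T \<Longrightarrow> q \<in> idx G T \<Longrightarrow> \<kappa> z p q = \<kappa> z q p"
    and \<kappa>_le: "\<And>\<omega> p. \<omega> \<in> E \<Longrightarrow> p \<in> idx G T \<Longrightarrow> (\<Sum>q\<in>idx G T. \<bar>\<kappa> (w \<omega>) p q\<bar>) \<le> B"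
    and full_rank: "\<And>\<omega>. \<omega> \<in> E \<Longrightarrow> Determinant.det (gram n k (w \<omega>)) \<noteq> 0"
    and inv_H: "\<And>\<omega>. \<omega> \<in> E \<Longrightarrow> invertible (\<Sum>i=1..n. outer (partial_out n k (w \<omega>) (x \<omega>) i) (partial_out n k (w \<omega>) (x \<omega>) i))"
    and \<delta>0: "0 < \<delta>"
    and max_v: "\<And>\<omega> i. \<omega> \<in> E \<Longrightarrow> i \<in> {1..n} \<Longrightarrow> (norm (partial_out n k (w \<omega>) (x \<omega>) i))\<^sup>2 \<le> real n * \<delta>"
    and sum_v: "\<And>\<omega>. \<omega> \<in> E \<Longrightarrow> (\<Sum>i=1..n. (norm (partial_out n k (w \<omega>) (x \<omega>) i))\<^sup>2) \<le> real n * B"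
begin

abbreviation vv :: "'a \<Rightarrow> nat \<Rightarrow> real ^ 'd" where
  "vv \<omega> i \<equiv> partial_out n k (w \<omega>) (x \<omega>) i"

abbreviation ann :: "'a \<Rightarrow> nat \<Rightarrow> nat \<Rightarrow> real" where
  "ann \<omega> i j \<equiv> annih n k (w \<omega>) i j"

text \<open>Repeats \<open>ols_row.hat\<close> as a function on the whole sample space: the locale
  \<open>ols_row\<close> can be entered only at points of E, whereas measurability concerns all
  points.\<close>

definition hatm :: "'a \<Rightarrow> nat \<Rightarrow> nat \<Rightarrow> real" where
  "hatm \<omega> i j = vv \<omega> i \<bullet> (matrix_inv (\<Sum>i=1..n. outer (vv \<omega> i) (vv \<omega> i)) *v vv \<omega> j)"

text \<open>Matrix of the quadratic form in the residuals that yields entry (a, b) of the estimator.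
  Summation over the first triple of the weights is absorbed here, and what remains is block
  diagonal with respect to the clusters.\<close>

definition Th :: "'d \<Rightarrow> 'd \<Rightarrow> 'a \<Rightarrow> nat \<Rightarrow> nat \<Rightarrow> real" where
  "Th a b \<omega> i j = (if cl i = cl j then
     (1 / real n) * (\<Sum>p\<in>idx G T. \<kappa> (w \<omega>) p (cl i, i, j) * (vv \<omega> (fst (snd p)) $ a * vv \<omega> (snd (snd p)) $ b)) else 0)"

definition conj_Th :: "'d \<Rightarrow> 'd \<Rightarrow> 'a \<Rightarrow> nat \<Rightarrow> nat \<Rightarrow> real" where
  "conj_Th a b \<omega> p l = (\<Sum>i=1..n. \<Sum>j=1..n. ann \<omega> p i * Th a b \<omega> i j * ann \<omega> j l)"

definition proj_err :: "'a \<Rightarrow> nat \<Rightarrow> real" where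
  "proj_err \<omega> i = (\<Sum>j=1..n. ann \<omega> i j * u \<omega> j)"

definition fit_err :: "'a \<Rightarrow> nat \<Rightarrow> real" where
  "fit_err \<omega> i = (\<Sum>j=1..n. hatm \<omega> i j * u \<omega> j)"

definition target :: "'a \<Rightarrow> real ^ 'd ^ 'd" where
  "target \<omega> = (1 / real n) *\<^sub>R
    (\<Sum>g1=1..G. \<Sum>g2=1..G. \<Sum>g3=1..G.
     \<Sum>i1\<in>T g1. \<Sum>j1\<in>T g1. \<Sum>i2\<in>T g2. \<Sum>j2\<in>T g2. \<Sum>i3\<in>T g3. \<Sum>j3\<in>T g3.
      (\<kappa> (w \<omega>) (g1, i1, j1) (g2, i2, j2) * ann \<omega> i2 j3 * ann \<omega> j2 i3
       * real_cond_exp M F (\<lambda>\<omega>. u \<omega> i3 * u \<omega> j3) \<omega>)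
      *\<^sub>R outer (vv \<omega> i1) (vv \<omega> j1))"

definition deviation :: "'a \<Rightarrow> real ^ 'd ^ 'd" where
  "deviation \<omega> = Sigma_hat n k (w \<omega>) (x \<omega>) (y \<omega>) G T (\<kappa> (w \<omega>)) - target \<omega>"

lemma E_space: "\<omega> \<in> E \<Longrightarrow> \<omega> \<in> space M"
  using sets.sets_into_space[OF E_F] spaces(2) by blast

lemma ols_row: "\<omega> \<in> E \<Longrightarrow> ols_row n k (w \<omega>) (x \<omega>)"
  by unfold_locales (rule full_rank inv_H; assumption)+

lemma hatm_eq: "\<omega> \<in> E \<Longrightarrow> hatm \<omega> = ols_row.hat n k (w \<omega>) (x \<omega>)"
  using ols_row[of \<omega>] by (simp add: fun_eq_iff hatm_def ols_row.hat_def ols_row.Hi_def ols_row.H_def)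

lemma sym_idem_ann: "\<omega> \<in> E \<Longrightarrow> sym_idem n (ann \<omega>)"
proof -
  assume "\<omega> \<in> E"
  then interpret ols_row n k "w \<omega>" "x \<omega>" by (rule ols_row)
  show ?thesis by unfold_locales
qed

lemma sym_idem_hat: "\<omega> \<in> E \<Longrightarrow> sym_idem n (hatm \<omega>)"
proof -
  assume \<omega>: "\<omega> \<in> E"
  then interpret ols_row n k "w \<omega>" "x \<omega>" by (rule ols_row)
  show ?thesis unfolding hatm_eq[OF \<omega>] by unfold_locales
qed

lemma residual_split:
  assumes \<omega>: "\<omega> \<in> E" and i: "i \<in> {1..n}"
  shows "residual n k (w \<omega>) (x \<omega>) (y \<omega>) i = proj_err \<omega> i - fit_err \<omega> i"
  unfolding proj_err_def fit_err_def hatm_eq[OF \<omega>]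
  by (rule ols_row.residual_eq[OF ols_row[OF \<omega>] model[OF _ E_space[OF \<omega>]] i])

lemma Sigma_hat_component:
  "Sigma_hat n k (w \<omega>) (x \<omega>) (y \<omega>) G T (\<kappa> (w \<omega>)) $ a $ b
    = (\<Sum>i=1..n. \<Sum>j=1..n. Th a b \<omega> i j * (residual n k (w \<omega>) (x \<omega>) (y \<omega>) i * residual n k (w \<omega>) (x \<omega>) (y \<omega>) j))"
proof -
  let ?r = "residual n k (w \<omega>) (x \<omega>) (y \<omega>)"
  let ?f = "\<lambda>p q. \<kappa> (w \<omega>) p q * (vv \<omega> (fst (snd p)) $ a * vv \<omega> (snd (snd p)) $ b)"
  let ?h = "\<lambda>q. ?r (fst (snd q)) * ?r (snd (snd q))"
  have "Sigma_hat n k (w \<omega>) (x \<omega>) (y \<omega>) G T (\<kappa> (w \<omega>)) $ a $ b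
    = (1 / real n) * (\<Sum>g1=1..G. \<Sum>g2=1..G. \<Sum>i1\<in>T g1. \<Sum>j1\<in>T g1. \<Sum>i2\<in>T g2. \<Sum>j2\<in>T g2.
        ?f (g1, i1, j1) (g2, i2, j2) * ?h (g2, i2, j2))"
    unfolding Sigma_hat_def vector_scaleR_component sum_component outer_def vec_lambda_beta real_scaleR_def
    by (simp only: fst_conv snd_conv ac_simps)
  also have "\<dots> = (1 / real n) * (\<Sum>g1=1..G. \<Sum>i1\<in>T g1. \<Sum>j1\<in>T g1. \<Sum>g2=1..G. \<Sum>i2\<in>T g2. \<Sum>j2\<in>T g2.
        ?f (g1, i1, j1) (g2, i2, j2) * ?h (g2, i2, j2))"
    by (intro arg_cong[where f = "\<lambda>t. (1 / real n) * t"] sum.cong refl sum_push2)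
  also have "\<dots> = (1 / real n) * (\<Sum>p\<in>idx G T. \<Sum>q\<in>idx G T. ?f p q * ?h q)"
    by (rule arg_cong[where f = "\<lambda>t. (1 / real n) * t"], rule sum_idx2[of "\<lambda>p q. ?f p q * ?h q"])
  also have "\<dots> = (\<Sum>q\<in>idx G T. ((1 / real n) * (\<Sum>p\<in>idx G T. ?f p q)) * ?h q)"
    by (subst sum.swap) (simp add: sum_distrib_left sum_distrib_right ac_simps)
  also have "\<dots> = (\<Sum>g=1..G. \<Sum>i\<in>T g. \<Sum>j\<in>T g. ((1 / real n) * (\<Sum>p\<in>idx G T. ?f p (g, i, j))) * ?h (g, i, j))"
    by (rule sum_idx[symmetric])
  also have "\<dots> = (\<Sum>i=1..n. \<Sum>j=1..n. Th a b \<omega> i j * (?r i * ?r j))"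
    unfolding sum_cluster_pairs by (intro sum.cong refl) (simp add: Th_def)
  finally show ?thesis .
qed

text \<open>The factors M i2 j3 and M j2 i3 cross the indices of the third triple. The covariance of
  u i3 and u j3 is symmetric, so the crossing can be undone, and the sums over i2 and j2 become an
  entry of M Th M.\<close>

lemma target_component:
  "target \<omega> $ a $ b = (\<Sum>i=1..n. \<Sum>j=1..n. conj_Th a b \<omega> i j * (if cl i = cl j then err_cov i j \<omega> else 0))"
  if sym: "\<And>i j. ann \<omega> i j = ann \<omega> j i"
proof -
  let ?f = "\<lambda>p q. \<kappa> (w \<omega>) p q * (vv \<omega> (fst (snd p)) $ a * vv \<omega> (snd (snd p)) $ b)"
  let ?c = "\<lambda>i j. (if cl i = cl j then err_cov i j \<omega> else 0)"
  let ?h = "\<lambda>q s. ann \<omega> (fst (snd q)) (snd (snd s)) * ann \<omega> (snd (snd q)) (fst (snd s)) * err_cov (fst (snd s)) (snd (snd s)) \<omega>"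
  have "target \<omega> $ a $ b
    = (1 / real n) * (\<Sum>g1=1..G. \<Sum>g2=1..G. \<Sum>g3=1..G. \<Sum>i1\<in>T g1. \<Sum>j1\<in>T g1. \<Sum>i2\<in>T g2. \<Sum>j2\<in>T g2. \<Sum>i3\<in>T g3. \<Sum>j3\<in>T g3.
        ?f (g1, i1, j1) (g2, i2, j2) * ?h (g2, i2, j2) (g3, i3, j3))"
    unfolding target_def vector_scaleR_component sum_component outer_def vec_lambda_beta real_scaleR_def err_cov_def[symmetric]
    by (simp only: fst_conv snd_conv ac_simps)
  also have "\<dots> = (1 / real n) * (\<Sum>g1=1..G. \<Sum>g2=1..G. \<Sum>i1\<in>T g1. \<Sum>j1\<in>T g1. \<Sum>i2\<in>T g2. \<Sum>j2\<in>T g2. \<Sum>g3=1..G. \<Sum>i3\<in>T g3. \<Sum>j3\<in>T g3.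
        ?f (g1, i1, j1) (g2, i2, j2) * ?h (g2, i2, j2) (g3, i3, j3))"
    by (intro arg_cong[where f = "\<lambda>t. (1 / real n) * t"] sum.cong refl sum_push4)
  also have "\<dots> = (1 / real n) * (\<Sum>g1=1..G. \<Sum>i1\<in>T g1. \<Sum>j1\<in>T g1. \<Sum>g2=1..G. \<Sum>i2\<in>T g2. \<Sum>j2\<in>T g2. \<Sum>g3=1..G. \<Sum>i3\<in>T g3. \<Sum>j3\<in>T g3.
        ?f (g1, i1, j1) (g2, i2, j2) * ?h (g2, i2, j2) (g3, i3, j3))"
    by (intro arg_cong[where f = "\<lambda>t. (1 / real n) * t"] sum.cong refl sum_push2)
  also have "\<dots> = (1 / real n) * (\<Sum>p\<in>idx G T. \<Sum>q\<in>idx G T. \<Sum>s\<in>idx G T. ?f p q * ?h q s)"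
    by (rule arg_cong[where f = "\<lambda>t. (1 / real n) * t"], rule sum_idx3[of "\<lambda>p q s. ?f p q * ?h q s"])
  also have "\<dots> = (\<Sum>q\<in>idx G T. ((1 / real n) * (\<Sum>p\<in>idx G T. ?f p q)) * (\<Sum>s\<in>idx G T. ?h q s))"
  proof -
    have "(1 / real n) * (\<Sum>p\<in>idx G T. \<Sum>q\<in>idx G T. \<Sum>s\<in>idx G T. ?f p q * ?h q s)
      = (1 / real n) * (\<Sum>q\<in>idx G T. (\<Sum>p\<in>idx G T. ?f p q) * (\<Sum>s\<in>idx G T. ?h q s))"
      by (subst sum.swap) (simp only: sum_product)
    then show ?thesis by (subst (asm) sum_distrib_left) (simp only: mult.assoc)
  qed
  also have "\<dots> = (\<Sum>i=1..n. \<Sum>j=1..n. Th a b \<omega> i j * (\<Sum>i3=1..n. \<Sum>j3=1..n. ann \<omega> i j3 * ann \<omega> j i3 * ?c i3 j3))"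
  proof -
    have s: "(\<Sum>s\<in>idx G T. ?h q s)
      = (\<Sum>i3=1..n. \<Sum>j3=1..n. ann \<omega> (fst (snd q)) j3 * ann \<omega> (snd (snd q)) i3 * ?c i3 j3)" for q
      unfolding sum_idx[of "?h q", symmetric] sum_cluster_pairs by (intro sum.cong refl) simp
    show ?thesis unfolding s
      by (subst sum_idx[symmetric], subst sum_cluster_pairs, intro sum.cong refl) (simp add: Th_def)
  qed
  also have "\<dots> = (\<Sum>i=1..n. \<Sum>j=1..n. \<Sum>i3=1..n. \<Sum>j3=1..n. (ann \<omega> j3 i * Th a b \<omega> i j * ann \<omega> j i3) * ?c j3 i3)"
    unfolding sum_distrib_left
    by (intro sum.cong refl) (simp add: err_cov_def sym[of _ j] sym[of j] mult.commute sym mult.left_commute)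
  also have "\<dots> = (\<Sum>i=1..n. \<Sum>j=1..n. \<Sum>j3=1..n. \<Sum>i3=1..n. (ann \<omega> j3 i * Th a b \<omega> i j * ann \<omega> j i3) * ?c j3 i3)"
    by (intro sum.cong refl sum.swap)
  also have "\<dots> = (\<Sum>i=1..n. \<Sum>j3=1..n. \<Sum>i3=1..n. \<Sum>j=1..n. (ann \<omega> j3 i * Th a b \<omega> i j * ann \<omega> j i3) * ?c j3 i3)"
    by (intro sum.cong refl sum_push2)
  also have "\<dots> = (\<Sum>j3=1..n. \<Sum>i3=1..n. \<Sum>i=1..n. \<Sum>j=1..n. (ann \<omega> j3 i * Th a b \<omega> i j * ann \<omega> j i3) * ?c j3 i3)"
    by (rule sum_push2)
  finally show ?thesis unfolding conj_Th_def sum_distrib_right .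
qed

text \<open>Those terms of the quadratic form in M u - P u that contain at least one factor P
  u.\<close>

definition fit_part :: "'d \<Rightarrow> 'd \<Rightarrow> 'a \<Rightarrow> real" where
  "fit_part a b \<omega> = (\<Sum>i=1..n. \<Sum>j=1..n. Th a b \<omega> i j *
     ((proj_err \<omega> i - fit_err \<omega> i) * (proj_err \<omega> j - fit_err \<omega> j) - proj_err \<omega> i * proj_err \<omega> j))"

definition noise_part :: "'d \<Rightarrow> 'd \<Rightarrow> 'a \<Rightarrow> real" where
  "noise_part a b \<omega> = (\<Sum>i=1..n. \<Sum>j=1..n. centred (\<lambda>\<omega>. conj_Th a b \<omega> i j) i j \<omega>)"

text \<open>The form in M u with matrix Th is the form in u with matrix M Th M, and subtracting
  \<open>target\<close> centres exactly its entries within clusters.\<close>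

lemma deviation_split:
  assumes \<omega>: "\<omega> \<in> E"
  shows "deviation \<omega> $ a $ b = fit_part a b \<omega> + noise_part a b \<omega>"
proof -
  interpret P: sym_idem n "ann \<omega>" by (rule sym_idem_ann[OF \<omega>])
  have A: "conj_Th a b \<omega> = P.conj_form (Th a b \<omega>)"
    by (simp add: fun_eq_iff conj_Th_def P.conj_form_def)
  have 1: "Sigma_hat n k (w \<omega>) (x \<omega>) (y \<omega>) G T (\<kappa> (w \<omega>)) $ a $ b
      = fit_part a b \<omega> + (\<Sum>i=1..n. \<Sum>j=1..n. Th a b \<omega> i j * (proj_err \<omega> i * proj_err \<omega> j))"
    unfolding Sigma_hat_component fit_part_def sum.distrib[symmetric]
    by (intro sum.cong refl) (simp add: residual_split[OF \<omega>] algebra_simps)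
  have 2: "(\<Sum>i=1..n. \<Sum>j=1..n. Th a b \<omega> i j * (proj_err \<omega> i * proj_err \<omega> j))
      = (\<Sum>i=1..n. \<Sum>j=1..n. conj_Th a b \<omega> i j * (u \<omega> i * u \<omega> j))"
    unfolding proj_err_def A by (rule P.quadratic_form)
  have "noise_part a b \<omega> = (\<Sum>i=1..n. \<Sum>j=1..n. conj_Th a b \<omega> i j * (u \<omega> i * u \<omega> j))
      - (\<Sum>i=1..n. \<Sum>j=1..n. conj_Th a b \<omega> i j * (if cl i = cl j then err_cov i j \<omega> else 0))"
    unfolding noise_part_def centred_def sum_subtractf[symmetric] by (intro sum.cong refl) simp
  then show ?thesis
    unfolding deviation_def vector_minus_component 1 2 target_component[OF P.sym] by simp
qed

end

section \<open>The deviation on the good event\<close>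

context weighted_row
begin

lemma indicator_E_F: "(indicator E :: 'a \<Rightarrow> real) \<in> borel_measurable F"
  by (rule borel_measurable_indicator[OF E_F])

lemma weightI:
  assumes f: "f \<in> borel_measurable F" and C: "\<And>\<omega>. \<omega> \<in> E \<Longrightarrow> \<bar>f \<omega>\<bar> \<le> C"
  shows "weight (\<lambda>\<omega>. indicator E \<omega> * f \<omega>)"
  unfolding weight_def
proof (intro conjI)
  show "(\<lambda>\<omega>. indicator E \<omega> * f \<omega>) \<in> borel_measurable F" using indicator_E_F f by simp
  have "\<bar>indicator E \<omega> * f \<omega>\<bar> \<le> \<bar>C\<bar>" for \<omega>
    using C[of \<omega>] by (cases "\<omega> \<in> E") auto
  then show "\<exists>C. \<forall>\<omega>. \<bar>indicator E \<omega> * f \<omega>\<bar> \<le> C" by blast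
qed simp

lemma integrable_indicator_E:
  assumes f: "f \<in> borel_measurable F" and C: "\<And>\<omega>. \<omega> \<in> E \<Longrightarrow> \<bar>f \<omega>\<bar> \<le> C"
  shows "integrable M (\<lambda>\<omega>. indicator E \<omega> * f \<omega> :: real)"
proof (rule integrable_const_bound[of _ "\<bar>C\<bar>"])
  have "\<bar>indicator E \<omega> * f \<omega>\<bar> \<le> \<bar>C\<bar>" for \<omega>
    using C[of \<omega>] by (cases "\<omega> \<in> E") auto
  then show "AE \<omega> in M. norm (indicator E \<omega> * f \<omega>) \<le> \<bar>C\<bar>" by simp
  show "(\<lambda>\<omega>. indicator E \<omega> * f \<omega>) \<in> borel_measurable M"
    using F_imp_M[OF indicator_E_F] F_imp_M[OF f] by simp
qed

lemma integral_indicator_E_le: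
  fixes f :: "'a \<Rightarrow> real"
  assumes f: "f \<in> borel_measurable F" and f0: "\<And>\<omega>. \<omega> \<in> E \<Longrightarrow> 0 \<le> f \<omega>" and C: "\<And>\<omega>. \<omega> \<in> E \<Longrightarrow> f \<omega> \<le> C" and C0: "0 \<le> C"
  shows "(\<integral>\<omega>. indicator E \<omega> * f \<omega> \<partial>M) \<le> C"
proof -
  have "(\<integral>\<omega>. indicator E \<omega> * f \<omega> \<partial>M) \<le> (\<integral>\<omega>. C \<partial>M)"
  proof (rule integral_mono)
    show "integrable M (\<lambda>\<omega>. indicator E \<omega> * f \<omega>)"
      by (rule integrable_indicator_E[OF f, of C]) (use f0 C in \<open>simp add: abs_of_nonneg\<close>)
    show "indicator E \<omega> * f \<omega> \<le> C" for \<omega> using C C0 by (cases "\<omega> \<in> E") auto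
  qed simp
  then show ?thesis by (simp add: prob_space)
qed

lemma ann_F: "i \<in> {1..n} \<Longrightarrow> j \<in> {1..n} \<Longrightarrow> (\<lambda>\<omega>. ann \<omega> i j) \<in> borel_measurable F"
  by (rule annih_measurable[OF w_F])

lemma vv_F: "i \<in> {1..n} \<Longrightarrow> (\<lambda>\<omega>. vv \<omega> i) \<in> borel_measurable F"
  by (rule partial_out_measurable[OF w_F _ xi_F])

lemma vv_component_F: "i \<in> {1..n} \<Longrightarrow> (\<lambda>\<omega>. vv \<omega> i $ a) \<in> borel_measurable F"
  by (rule borel_measurable_vec_nth[OF vv_F])

lemma hatm_F: "i \<in> {1..n} \<Longrightarrow> j \<in> {1..n} \<Longrightarrow> (\<lambda>\<omega>. hatm \<omega> i j) \<in> borel_measurable F"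
  unfolding hatm_def inner_vec_def matrix_vector_mult_def vec_lambda_beta inner_real_def
  by (intro borel_measurable_sum borel_measurable_times vv_component_F matrix_inv_measurable
      H_component_measurable[OF w_F xi_F])

lemma idx_range: "p \<in> idx G T \<Longrightarrow> fst (snd p) \<in> {1..n} \<and> snd (snd p) \<in> {1..n}"
  unfolding idx_def using T_subset by fastforce

lemma \<kappa>_F: "p \<in> idx G T \<Longrightarrow> q \<in> idx G T \<Longrightarrow> (\<lambda>\<omega>. \<kappa> (w \<omega>) p q) \<in> borel_measurable F"
  by (rule measurable_compose[OF w_F \<kappa>_meas])

lemma Th_F:
  assumes "i \<in> {1..n}" "j \<in> {1..n}"
  shows "(\<lambda>\<omega>. Th a b \<omega> i j) \<in> borel_measurable F"
proof (cases "cl i = cl j")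
  case True
  have "(\<lambda>\<omega>. (1 / real n) * (\<Sum>p\<in>idx G T. \<kappa> (w \<omega>) p (cl i, i, j) * (vv \<omega> (fst (snd p)) $ a * vv \<omega> (snd (snd p)) $ b)))
      \<in> borel_measurable F"
    by (intro borel_measurable_times borel_measurable_const borel_measurable_sum \<kappa>_F vv_component_F
        idx_cl[OF assms True] conjunct1[OF idx_range] conjunct2[OF idx_range])
  then show ?thesis using True by (simp add: Th_def)
qed (simp add: Th_def)

lemma conj_Th_F: "i \<in> {1..n} \<Longrightarrow> j \<in> {1..n} \<Longrightarrow> (\<lambda>\<omega>. conj_Th a b \<omega> i j) \<in> borel_measurable F"
  unfolding conj_Th_def by (intro borel_measurable_sum borel_measurable_times ann_F Th_F)

lemma m0: "0 \<le> m"
proof -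
  have "1 \<in> {1..n}" using n0 by simp
  then show ?thesis using card_T[OF cl(1)[of 1]] by (meson of_nat_0_le_iff order.trans)
qed

lemma cluster_sum_le:
  assumes i: "i \<in> {1..n}" and c: "0 \<le> c"
  shows "(\<Sum>j=1..n. if cl i = cl j then c else 0) \<le> m * c"
proof -
  have "(\<Sum>j=1..n. if cl i = cl j then c else 0) = real (card (T (cl i))) * c"
    unfolding sum_T[OF i, symmetric] by simp
  then show ?thesis using mult_right_mono[OF card_T[OF cl(1)[OF i]] c] by simp
qed

lemma vv_product_le: "\<bar>vv \<omega> i $ a * vv \<omega> j $ b\<bar> \<le> ((norm (vv \<omega> i))\<^sup>2 + (norm (vv \<omega> j))\<^sup>2) / 2"
proof -
  have "\<bar>vv \<omega> i $ a * vv \<omega> j $ b\<bar> \<le> norm (vv \<omega> i) * norm (vv \<omega> j)"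
    unfolding abs_mult by (intro mult_mono component_le_norm_cart) auto
  also have "\<dots> \<le> ((norm (vv \<omega> i))\<^sup>2 + (norm (vv \<omega> j))\<^sup>2) / 2"
  proof -
    have "0 \<le> (norm (vv \<omega> i) - norm (vv \<omega> j))\<^sup>2" by simp
    then show ?thesis by (simp add: power2_diff)
  qed
  finally show ?thesis .
qed

text \<open>The norm of the weights bounds row sums, while Th sums along a column; symmetry of the
  weights exchanges the two. The factor n in \<open>max_v\<close> cancels against 1 / n.\<close>

lemma Th_abs_le:
  assumes \<omega>: "\<omega> \<in> E" and i: "i \<in> {1..n}" and j: "j \<in> {1..n}"
  shows "\<bar>Th a b \<omega> i j\<bar> \<le> (if cl i = cl j then B * \<delta> else 0)"
proof (cases "cl i = cl j")
  case True
  let ?q = "(cl i, i, j)"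
  have q: "?q \<in> idx G T" by (rule idx_cl[OF i j True])
  have wsp: "w \<omega> \<in> space (control_space n k)" by (rule measurable_space[OF w_rv E_space[OF \<omega>]])
  have "\<bar>\<Sum>p\<in>idx G T. \<kappa> (w \<omega>) p ?q * (vv \<omega> (fst (snd p)) $ a * vv \<omega> (snd (snd p)) $ b)\<bar>
      \<le> (\<Sum>p\<in>idx G T. \<bar>\<kappa> (w \<omega>) ?q p\<bar> * (real n * \<delta>))"
  proof (rule order.trans[OF sum_abs sum_mono])
    fix p assume p: "p \<in> idx G T"
    have "\<bar>vv \<omega> (fst (snd p)) $ a * vv \<omega> (snd (snd p)) $ b\<bar> \<le> real n * \<delta>"
      using vv_product_le[of \<omega> "fst (snd p)" a "snd (snd p)" b]
        max_v[OF \<omega> conjunct1[OF idx_range[OF p]]] max_v[OF \<omega> conjunct2[OF idx_range[OF p]]] by simp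
    then show "\<bar>\<kappa> (w \<omega>) p ?q * (vv \<omega> (fst (snd p)) $ a * vv \<omega> (snd (snd p)) $ b)\<bar> \<le> \<bar>\<kappa> (w \<omega>) ?q p\<bar> * (real n * \<delta>)"
      unfolding abs_mult[of "\<kappa> _ _ _"] \<kappa>_sym[OF wsp p q] by (rule mult_left_mono) simp
  qed
  also have "\<dots> \<le> B * (real n * \<delta>)"
    unfolding sum_distrib_right[symmetric] by (rule mult_right_mono[OF \<kappa>_le[OF \<omega> q]]) (use \<delta>0 in simp)
  finally have S: "\<bar>\<Sum>p\<in>idx G T. \<kappa> (w \<omega>) p ?q * (vv \<omega> (fst (snd p)) $ a * vv \<omega> (snd (snd p)) $ b)\<bar>
      \<le> B * (real n * \<delta>)" .
  have "\<bar>Th a b \<omega> i j\<bar> \<le> (1 / real n) * (B * (real n * \<delta>))"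
    unfolding Th_def if_P[OF True] abs_mult[of "1 / real n"] by (rule mult_mono[OF _ S]) simp_all
  also have "\<dots> = B * \<delta>" using n0 by simp
  finally show ?thesis using True by simp
qed (simp add: Th_def)

lemma Th_abs_le': "\<omega> \<in> E \<Longrightarrow> i \<in> {1..n} \<Longrightarrow> j \<in> {1..n} \<Longrightarrow> \<bar>Th a b \<omega> i j\<bar> \<le> B * \<delta>"
  using Th_abs_le[of \<omega> i j a b] B0 \<delta>0 by (auto split: if_splits intro: order.trans)

text \<open>Summing over the second triple first makes the row bound B available for each first
  triple p. What remains is a sum of squared norms over pairs within clusters, in which each index
  occurs at most m times on either side, so that \<open>sum_v\<close> applies.\<close>

lemma Th_abs_sum:
  assumes \<omega>: "\<omega> \<in> E"
  shows "(\<Sum>i=1..n. \<Sum>j=1..n. \<bar>Th a b \<omega> i j\<bar>) \<le> m * B\<^sup>2"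
proof -
  let ?v = "\<lambda>p. \<bar>vv \<omega> (fst (snd p)) $ a * vv \<omega> (snd (snd p)) $ b\<bar>"
  have "(\<Sum>i=1..n. \<Sum>j=1..n. \<bar>Th a b \<omega> i j\<bar>)
      \<le> (\<Sum>i=1..n. \<Sum>j=1..n. if cl i = cl j then (1 / real n) * (\<Sum>p\<in>idx G T. \<bar>\<kappa> (w \<omega>) p (cl i, i, j)\<bar> * ?v p) else 0)"
  proof (intro sum_mono)
    fix i j
    have "\<bar>\<Sum>p\<in>idx G T. \<kappa> (w \<omega>) p (cl i, i, j) * (vv \<omega> (fst (snd p)) $ a * vv \<omega> (snd (snd p)) $ b)\<bar>
      \<le> (\<Sum>p\<in>idx G T. \<bar>\<kappa> (w \<omega>) p (cl i, i, j)\<bar> * ?v p)"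
      unfolding abs_mult[of "\<kappa> _ _ _", symmetric] by (rule sum_abs)
    then have "\<bar>(1 / real n) * (\<Sum>p\<in>idx G T. \<kappa> (w \<omega>) p (cl i, i, j) * (vv \<omega> (fst (snd p)) $ a * vv \<omega> (snd (snd p)) $ b))\<bar>
      \<le> (1 / real n) * (\<Sum>p\<in>idx G T. \<bar>\<kappa> (w \<omega>) p (cl i, i, j)\<bar> * ?v p)"
      unfolding abs_mult[of "1 / real n"] by (intro mult_mono) simp_all
    then show "\<bar>Th a b \<omega> i j\<bar> \<le> (if cl i = cl j then (1 / real n) * (\<Sum>p\<in>idx G T. \<bar>\<kappa> (w \<omega>) p (cl i, i, j)\<bar> * ?v p) else 0)"
      unfolding Th_def by (simp only: split: if_split) simp
  qed
  also have "\<dots> = (\<Sum>g=1..G. \<Sum>i\<in>T g. \<Sum>j\<in>T g. (1 / real n) * (\<Sum>p\<in>idx G T. \<bar>\<kappa> (w \<omega>) p (g, i, j)\<bar> * ?v p))"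
    by (rule sum_cluster_pairs[symmetric])
  also have "\<dots> = (\<Sum>q\<in>idx G T. (1 / real n) * (\<Sum>p\<in>idx G T. \<bar>\<kappa> (w \<omega>) p q\<bar> * ?v p))"
    by (rule sum_idx)
  also have "\<dots> = (1 / real n) * (\<Sum>p\<in>idx G T. (\<Sum>q\<in>idx G T. \<bar>\<kappa> (w \<omega>) p q\<bar>) * ?v p)"
    unfolding sum_distrib_left[symmetric] sum_distrib_right by (subst sum.swap) (rule refl)
  also have "\<dots> \<le> (1 / real n) * (\<Sum>p\<in>idx G T. B * (((norm (vv \<omega> (fst (snd p))))\<^sup>2 + (norm (vv \<omega> (snd (snd p))))\<^sup>2) / 2))"
    by (intro mult_left_mono sum_mono mult_mono \<kappa>_le[OF \<omega>] vv_product_le B0) auto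
  also have "\<dots> = (1 / real n) * (B * (\<Sum>p\<in>idx G T. ((norm (vv \<omega> (fst (snd p))))\<^sup>2 + (norm (vv \<omega> (snd (snd p))))\<^sup>2) / 2))"
    by (simp only: sum_distrib_left)
  also have "\<dots> \<le> (1 / real n) * (B * (m * (real n * B)))"
  proof (intro mult_left_mono B0)
    let ?c = "\<lambda>i j. if cl i = cl j then (norm (vv \<omega> i))\<^sup>2 else 0"
    have half: "(\<Sum>i=1..n. \<Sum>j=1..n. ?c i j) \<le> m * (real n * B)"
    proof -
      have "(\<Sum>i=1..n. \<Sum>j=1..n. ?c i j) \<le> (\<Sum>i=1..n. m * (norm (vv \<omega> i))\<^sup>2)"
        by (intro sum_mono cluster_sum_le) auto
      also have "\<dots> \<le> m * (real n * B)"
        unfolding sum_distrib_left[symmetric] by (rule mult_left_mono[OF sum_v[OF \<omega>] m0])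
      finally show ?thesis .
    qed
    have "(\<Sum>p\<in>idx G T. ((norm (vv \<omega> (fst (snd p))))\<^sup>2 + (norm (vv \<omega> (snd (snd p))))\<^sup>2) / 2)
        = (\<Sum>i=1..n. \<Sum>j=1..n. if cl i = cl j then ((norm (vv \<omega> i))\<^sup>2 + (norm (vv \<omega> j))\<^sup>2) / 2 else 0)"
      by (subst sum_idx[symmetric], subst sum_cluster_pairs) (simp only: fst_conv snd_conv)
    also have "\<dots> = (\<Sum>i=1..n. \<Sum>j=1..n. ?c i j) / 2 + (\<Sum>i=1..n. \<Sum>j=1..n. ?c j i) / 2"
      unfolding sum_divide_distrib sum.distrib[symmetric]
      by (intro sum.cong refl) (simp add: add_divide_distrib)
    also have "(\<Sum>i=1..n. \<Sum>j=1..n. ?c j i) = (\<Sum>i=1..n. \<Sum>j=1..n. ?c i j)" by (rule sum.swap)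
    finally show "(\<Sum>p\<in>idx G T. ((norm (vv \<omega> (fst (snd p))))\<^sup>2 + (norm (vv \<omega> (snd (snd p))))\<^sup>2) / 2) \<le> m * (real n * B)"
      using half by simp
  qed auto
  also have "\<dots> = m * B\<^sup>2" using n0 by (simp add: power2_eq_square)
  finally show ?thesis .
qed

text \<open>Largest entry times sum of absolute values; the small factor \<open>\<delta>\<close>
  enters through the largest entry.\<close>

lemma Th_square_sum:
  assumes \<omega>: "\<omega> \<in> E"
  shows "(\<Sum>i=1..n. \<Sum>j=1..n. (Th a b \<omega> i j)\<^sup>2) \<le> (B * \<delta>) * (m * B\<^sup>2)"
proof -
  have "(\<Sum>i=1..n. \<Sum>j=1..n. (Th a b \<omega> i j)\<^sup>2) \<le> (\<Sum>i=1..n. \<Sum>j=1..n. (B * \<delta>) * \<bar>Th a b \<omega> i j\<bar>)"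
  proof (intro sum_mono)
    fix i j assume ij: "i \<in> {1..n}" "j \<in> {1..n}"
    have "(Th a b \<omega> i j)\<^sup>2 = \<bar>Th a b \<omega> i j\<bar> * \<bar>Th a b \<omega> i j\<bar>" by (simp add: power2_eq_square)
    also have "\<dots> \<le> (B * \<delta>) * \<bar>Th a b \<omega> i j\<bar>" by (rule mult_right_mono[OF Th_abs_le'[OF \<omega> ij]]) simp
    finally show "(Th a b \<omega> i j)\<^sup>2 \<le> (B * \<delta>) * \<bar>Th a b \<omega> i j\<bar>" .
  qed
  also have "\<dots> \<le> (B * \<delta>) * (m * B\<^sup>2)"
    unfolding sum_distrib_left[symmetric] by (rule mult_left_mono[OF Th_abs_sum[OF \<omega>]]) (use B0 \<delta>0 in simp)
  finally show ?thesis .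
qed

text \<open>The square root of \<open>\<Phi>\<close> is moved into the weights so that
  \<open>linear_square\<close> applies, and the squares in row i of a projection add up to its
  diagonal entry. It serves for the annihilator with \<open>\<Phi>\<close> = |Th| and for the hat
  matrix with \<open>\<Phi>\<close> = 1.\<close>

lemma weighted_projection:
  assumes P: "\<And>i j. i \<in> {1..n} \<Longrightarrow> j \<in> {1..n} \<Longrightarrow> (\<lambda>\<omega>. P \<omega> i j) \<in> borel_measurable F"
    and proj: "\<And>\<omega>. \<omega> \<in> E \<Longrightarrow> sym_idem n (P \<omega>)"
    and \<Phi>: "\<Phi> \<in> borel_measurable F" and \<Phi>0: "\<And>\<omega>. 0 \<le> \<Phi> \<omega>" and C: "\<And>\<omega>. \<omega> \<in> E \<Longrightarrow> \<Phi> \<omega> \<le> C"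
    and i: "i \<in> {1..n}"
  shows "integrable M (\<lambda>\<omega>. indicator E \<omega> * (\<Phi> \<omega> * (\<Sum>l=1..n. P \<omega> i l * u \<omega> l)\<^sup>2))"
    "(\<integral>\<omega>. indicator E \<omega> * (\<Phi> \<omega> * (\<Sum>l=1..n. P \<omega> i l * u \<omega> l)\<^sup>2) \<partial>M)
      \<le> m * ((1 + B) * (\<integral>\<omega>. indicator E \<omega> * (\<Phi> \<omega> * P \<omega> i i) \<partial>M))"
proof -
  let ?a = "\<lambda>l \<omega>. indicator E \<omega> * (sqrt (\<Phi> \<omega>) * P \<omega> i l)"
  have P1: "(P \<omega> i l)\<^sup>2 \<le> 1" if "\<omega> \<in> E" "l \<in> {1..n}" for \<omega> l
    by (rule sym_idem.square_le_1[OF proj[OF that(1)] i that(2)])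
  have a: "weight (?a l)" if l: "l \<in> {1..n}" for l
  proof (rule weightI[where C = "sqrt C"])
    show "(\<lambda>\<omega>. sqrt (\<Phi> \<omega>) * P \<omega> i l) \<in> borel_measurable F" using P[OF i l] \<Phi> by simp
    fix \<omega> assume \<omega>: "\<omega> \<in> E"
    have "\<bar>P \<omega> i l\<bar> \<le> 1" using P1[OF \<omega> l] by (simp add: abs_square_le_1)
    then have "\<bar>sqrt (\<Phi> \<omega>)\<bar> * \<bar>P \<omega> i l\<bar> \<le> sqrt C * 1"
      using C[OF \<omega>] \<Phi>0[of \<omega>] by (intro mult_mono) auto
    then show "\<bar>sqrt (\<Phi> \<omega>) * P \<omega> i l\<bar> \<le> sqrt C" by (simp add: abs_mult)
  qed
  have eq: "(\<Sum>l=1..n. ?a l \<omega> * u \<omega> l)\<^sup>2 = indicator E \<omega> * (\<Phi> \<omega> * (\<Sum>l=1..n. P \<omega> i l * u \<omega> l)\<^sup>2)" for \<omega>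
  proof -
    have "(\<Sum>l=1..n. ?a l \<omega> * u \<omega> l) = indicator E \<omega> * (sqrt (\<Phi> \<omega>) * (\<Sum>l=1..n. P \<omega> i l * u \<omega> l))"
      by (simp only: sum_distrib_left mult.assoc)
    then show ?thesis using \<Phi>0[of \<omega>] by (simp add: power_mult_distrib indicator_def)
  qed
  have a2: "(?a l \<omega>)\<^sup>2 = indicator E \<omega> * (\<Phi> \<omega> * (P \<omega> i l)\<^sup>2)" for l \<omega>
    using \<Phi>0[of \<omega>] by (simp add: power_mult_distrib indicator_def)
  show "integrable M (\<lambda>\<omega>. indicator E \<omega> * (\<Phi> \<omega> * (\<Sum>l=1..n. P \<omega> i l * u \<omega> l)\<^sup>2))"
    unfolding eq[symmetric] by (rule linear_square(1)[where a = ?a, OF a])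
  have "(\<Sum>l=1..n. \<integral>\<omega>. (?a l \<omega>)\<^sup>2 \<partial>M) = (\<integral>\<omega>. (\<Sum>l=1..n. (?a l \<omega>)\<^sup>2) \<partial>M)"
    by (rule Bochner_Integration.integral_sum[symmetric]) (rule weight_square_integrable[OF a])
  also have "\<dots> = (\<integral>\<omega>. indicator E \<omega> * (\<Phi> \<omega> * P \<omega> i i) \<partial>M)"
  proof (intro Bochner_Integration.integral_cong refl)
    fix \<omega>
    show "(\<Sum>l=1..n. (?a l \<omega>)\<^sup>2) = indicator E \<omega> * (\<Phi> \<omega> * P \<omega> i i)"
      unfolding a2 sum_distrib_left[symmetric]
      by (cases "\<omega> \<in> E", simp only: sym_idem.row_square[OF proj i], simp)
  qed
  finally have sum: "(\<Sum>l=1..n. \<integral>\<omega>. (?a l \<omega>)\<^sup>2 \<partial>M) = (\<integral>\<omega>. indicator E \<omega> * (\<Phi> \<omega> * P \<omega> i i) \<partial>M)" .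
  show "(\<integral>\<omega>. indicator E \<omega> * (\<Phi> \<omega> * (\<Sum>l=1..n. P \<omega> i l * u \<omega> l)\<^sup>2) \<partial>M)
      \<le> m * ((1 + B) * (\<integral>\<omega>. indicator E \<omega> * (\<Phi> \<omega> * P \<omega> i i) \<partial>M))"
    using linear_square(2)[where a = ?a, OF a] unfolding eq sum .
qed

lemma proj_err_weighted:
  assumes i: "i \<in> {1..n}" and j: "p \<in> {1..n}" and q: "q \<in> {1..n}"
  shows "integrable M (\<lambda>\<omega>. indicator E \<omega> * (\<bar>Th a b \<omega> p q\<bar> * (proj_err \<omega> i)\<^sup>2))"
    "(\<integral>\<omega>. indicator E \<omega> * (\<bar>Th a b \<omega> p q\<bar> * (proj_err \<omega> i)\<^sup>2) \<partial>M)
      \<le> m * ((1 + B) * (\<integral>\<omega>. indicator E \<omega> * \<bar>Th a b \<omega> p q\<bar> \<partial>M))"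
proof -
  have abs_F: "(\<lambda>\<omega>. \<bar>Th a b \<omega> p q\<bar>) \<in> borel_measurable F" using Th_F[OF j q] by simp
  note wp = weighted_projection[where P = "\<lambda>\<omega>. ann \<omega>" and \<Phi> = "\<lambda>\<omega>. \<bar>Th a b \<omega> p q\<bar>" and C = "B * \<delta>",
      OF ann_F sym_idem_ann abs_F abs_ge_zero Th_abs_le'[OF _ j q] i, folded proj_err_def]
  show "integrable M (\<lambda>\<omega>. indicator E \<omega> * (\<bar>Th a b \<omega> p q\<bar> * (proj_err \<omega> i)\<^sup>2))" by (rule wp(1))
  have "(\<integral>\<omega>. indicator E \<omega> * (\<bar>Th a b \<omega> p q\<bar> * ann \<omega> i i) \<partial>M) \<le> (\<integral>\<omega>. indicator E \<omega> * \<bar>Th a b \<omega> p q\<bar> \<partial>M)"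
  proof (rule integral_mono)
    have a1: "\<bar>ann \<omega> i i\<bar> \<le> 1" if "\<omega> \<in> E" for \<omega>
      using sym_idem.square_le_1[OF sym_idem_ann[OF that] i i] by (simp add: abs_square_le_1)
    show "integrable M (\<lambda>\<omega>. indicator E \<omega> * (\<bar>Th a b \<omega> p q\<bar> * ann \<omega> i i))"
    proof (rule integrable_indicator_E[where C = "B * \<delta> * 1"])
      show "(\<lambda>\<omega>. \<bar>Th a b \<omega> p q\<bar> * ann \<omega> i i) \<in> borel_measurable F" using abs_F ann_F[OF i i] by simp
      fix \<omega> assume \<omega>: "\<omega> \<in> E"
      show "\<bar>\<bar>Th a b \<omega> p q\<bar> * ann \<omega> i i\<bar> \<le> B * \<delta> * 1"
        unfolding abs_mult abs_idempotent using B0 \<delta>0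
        by (intro mult_mono Th_abs_le'[OF \<omega> j q] a1[OF \<omega>]) auto
    qed
    show "integrable M (\<lambda>\<omega>. indicator E \<omega> * \<bar>Th a b \<omega> p q\<bar>)"
      by (rule integrable_indicator_E[OF abs_F, of "B * \<delta>"]) (use Th_abs_le'[OF _ j q] in simp)
    fix \<omega>
    show "indicator E \<omega> * (\<bar>Th a b \<omega> p q\<bar> * ann \<omega> i i) \<le> indicator E \<omega> * \<bar>Th a b \<omega> p q\<bar>"
    proof (cases "\<omega> \<in> E")
      case True
      then show ?thesis using mult_left_mono[OF abs_le_D1[OF a1[OF True]], of "\<bar>Th a b \<omega> p q\<bar>"] by simp
    qed simp
  qed
  then have "m * ((1 + B) * (\<integral>\<omega>. indicator E \<omega> * (\<bar>Th a b \<omega> p q\<bar> * ann \<omega> i i) \<partial>M))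
      \<le> m * ((1 + B) * (\<integral>\<omega>. indicator E \<omega> * \<bar>Th a b \<omega> p q\<bar> \<partial>M))"
    by (intro mult_left_mono) (use m0 B0 in auto)
  with wp(2) show "(\<integral>\<omega>. indicator E \<omega> * (\<bar>Th a b \<omega> p q\<bar> * (proj_err \<omega> i)\<^sup>2) \<partial>M)
      \<le> m * ((1 + B) * (\<integral>\<omega>. indicator E \<omega> * \<bar>Th a b \<omega> p q\<bar> \<partial>M))" by (rule order.trans)
qed

lemma Th_abs_integral_sum:
  "(\<Sum>i=1..n. \<Sum>j=1..n. \<integral>\<omega>. indicator E \<omega> * \<bar>Th a b \<omega> i j\<bar> \<partial>M) \<le> m * B\<^sup>2"
proof -
  have abs_F: "(\<lambda>\<omega>. \<bar>Th a b \<omega> p q\<bar>) \<in> borel_measurable F" if "p \<in> {1..n}" "q \<in> {1..n}" for p q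
    using Th_F[OF that] by simp
  have int: "integrable M (\<lambda>\<omega>. indicator E \<omega> * \<bar>Th a b \<omega> p q\<bar>)" if "p \<in> {1..n}" "q \<in> {1..n}" for p q
    by (rule integrable_indicator_E[OF abs_F[OF that], of "B * \<delta>"]) (use Th_abs_le'[OF _ that] in simp)
  have "(\<Sum>i=1..n. \<Sum>j=1..n. \<integral>\<omega>. indicator E \<omega> * \<bar>Th a b \<omega> i j\<bar> \<partial>M)
      = (\<integral>\<omega>. (\<Sum>i=1..n. \<Sum>j=1..n. indicator E \<omega> * \<bar>Th a b \<omega> i j\<bar>) \<partial>M)"
    by (simp only: Bochner_Integration.integral_sum Bochner_Integration.integrable_sum int cong: sum.cong)
  also have "\<dots> = (\<integral>\<omega>. indicator E \<omega> * (\<Sum>i=1..n. \<Sum>j=1..n. \<bar>Th a b \<omega> i j\<bar>) \<partial>M)"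
    by (simp only: sum_distrib_left)
  also have "\<dots> \<le> m * B\<^sup>2"
    by (rule integral_indicator_E_le) (use Th_abs_sum m0 in \<open>auto intro!: borel_measurable_sum abs_F sum_nonneg simp del: One_nat_def\<close>)
  finally show ?thesis .
qed

lemma fit_err_square:
  assumes i: "i \<in> {1..n}"
  shows "integrable M (\<lambda>\<omega>. indicator E \<omega> * (fit_err \<omega> i)\<^sup>2)"
    "(\<integral>\<omega>. indicator E \<omega> * (fit_err \<omega> i)\<^sup>2 \<partial>M) \<le> m * ((1 + B) * (\<integral>\<omega>. indicator E \<omega> * hatm \<omega> i i \<partial>M))"
  using weighted_projection[where P = hatm and \<Phi> = "\<lambda>_. 1" and C = 1, OF hatm_F sym_idem_hat _ _ _ i, folded fit_err_def]
  by simp_all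

text \<open>The diagonal of the hat matrix adds up to the number of regressors, so no factor n
  appears.\<close>

lemma fit_err_square_sum:
  "(\<Sum>i=1..n. \<integral>\<omega>. indicator E \<omega> * (fit_err \<omega> i)\<^sup>2 \<partial>M) \<le> m * ((1 + B) * real CARD('d))"
proof -
  have int: "integrable M (\<lambda>\<omega>. indicator E \<omega> * hatm \<omega> i i)" if i: "i \<in> {1..n}" for i
    by (rule integrable_indicator_E[OF hatm_F[OF i i], of 1])
       (use sym_idem.square_le_1[OF sym_idem_hat i i] in \<open>simp add: abs_square_le_1\<close>)
  have "(\<Sum>i=1..n. \<integral>\<omega>. indicator E \<omega> * (fit_err \<omega> i)\<^sup>2 \<partial>M)
      \<le> (\<Sum>i=1..n. m * ((1 + B) * (\<integral>\<omega>. indicator E \<omega> * hatm \<omega> i i \<partial>M)))"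
    by (intro sum_mono fit_err_square(2))
  also have "\<dots> = m * ((1 + B) * (\<integral>\<omega>. (\<Sum>i=1..n. indicator E \<omega> * hatm \<omega> i i) \<partial>M))"
    by (simp only: Bochner_Integration.integral_sum int sum_distrib_left cong: sum.cong)
  also have "(\<integral>\<omega>. (\<Sum>i=1..n. indicator E \<omega> * hatm \<omega> i i) \<partial>M) = (\<integral>\<omega>. indicator E \<omega> * (\<Sum>i=1..n. hatm \<omega> i i) \<partial>M)"
    by (simp only: sum_distrib_left)
  also have "m * ((1 + B) * (\<integral>\<omega>. indicator E \<omega> * (\<Sum>i=1..n. hatm \<omega> i i) \<partial>M)) \<le> m * ((1 + B) * real CARD('d))"
  proof (intro mult_left_mono integral_indicator_E_le)
    show "(\<lambda>\<omega>. \<Sum>i=1..n. hatm \<omega> i i) \<in> borel_measurable F" by (intro borel_measurable_sum hatm_F)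
    fix \<omega> assume \<omega>: "\<omega> \<in> E"
    have "(\<Sum>i=1..n. hatm \<omega> i i) = real CARD('d)"
      unfolding hatm_eq[OF \<omega>] by (rule ols_row.trace_hat[OF ols_row[OF \<omega>]])
    then show "0 \<le> (\<Sum>i=1..n. hatm \<omega> i i)" "(\<Sum>i=1..n. hatm \<omega> i i) \<le> real CARD('d)" by simp_all
  qed (use m0 B0 in auto)
  finally show ?thesis .
qed

text \<open>An integrable majorant of |\<open>fit_part\<close>| on E that is defined off E as well,
  ready for Markov's inequality. The factor 2 m B \<open>\<delta>\<close> bounds the row sums plus
  the column sums of |Th|.\<close>

definition fit_major :: "real \<Rightarrow> 'd \<Rightarrow> 'd \<Rightarrow> 'a \<Rightarrow> real" where
  "fit_major s a b \<omega> =
    s / 2 * (\<Sum>i=1..n. \<Sum>j=1..n. indicator E \<omega> * (\<bar>Th a b \<omega> i j\<bar> * (proj_err \<omega> i)\<^sup>2) + indicator E \<omega> * (\<bar>Th a b \<omega> i j\<bar> * (proj_err \<omega> j)\<^sup>2))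
    + (1 / (2 * s) + 1 / 2) * (2 * (m * (B * \<delta>)) * (\<Sum>i=1..n. indicator E \<omega> * (fit_err \<omega> i)\<^sup>2))"

text \<open>\<open>weighted_cross_term_le\<close> with e = M u and r = P u. In the part with r, the
  entries of Th are replaced by their bound B \<open>\<delta>\<close>, with at most m of them
  nonzero in each row and each column.\<close>

lemma fit_part_le:
  assumes \<omega>: "\<omega> \<in> E" and s: "0 < s"
  shows "\<bar>fit_part a b \<omega>\<bar> \<le> fit_major s a b \<omega>"
proof -
  have half: "(\<Sum>i=1..n. \<Sum>j=1..n. \<bar>Th a b \<omega> i j\<bar> * (fit_err \<omega> i)\<^sup>2) \<le> m * (B * \<delta>) * (\<Sum>i=1..n. (fit_err \<omega> i)\<^sup>2)"
    and half': "(\<Sum>i=1..n. \<Sum>j=1..n. \<bar>Th a b \<omega> j i\<bar> * (fit_err \<omega> i)\<^sup>2) \<le> m * (B * \<delta>) * (\<Sum>i=1..n. (fit_err \<omega> i)\<^sup>2)"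
  proof -
    have row: "(\<Sum>j=1..n. c j) \<le> m * (B * \<delta>)"
      if c: "\<And>j. j \<in> {1..n} \<Longrightarrow> c j \<le> (if cl i = cl j then B * \<delta> else 0)" and i: "i \<in> {1..n}" for c i
    proof -
      have "(\<Sum>j=1..n. c j) \<le> (\<Sum>j=1..n. if cl i = cl j then B * \<delta> else 0)" by (intro sum_mono c)
      also have "\<dots> \<le> m * (B * \<delta>)" by (rule cluster_sum_le[OF i]) (use B0 \<delta>0 in simp)
      finally show ?thesis .
    qed
    show "(\<Sum>i=1..n. \<Sum>j=1..n. \<bar>Th a b \<omega> i j\<bar> * (fit_err \<omega> i)\<^sup>2) \<le> m * (B * \<delta>) * (\<Sum>i=1..n. (fit_err \<omega> i)\<^sup>2)"
      unfolding sum_distrib_right[symmetric] sum_distrib_left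
      by (rule sum_mono, rule mult_right_mono[OF row[OF Th_abs_le[OF \<omega>]]]) simp_all
    have col: "\<bar>Th a b \<omega> j i\<bar> \<le> (if cl i = cl j then B * \<delta> else 0)" if "i \<in> {1..n}" "j \<in> {1..n}" for i j
      using Th_abs_le[OF \<omega> that(2,1), of a b] by (simp only: eq_commute[of "cl j"])
    show "(\<Sum>i=1..n. \<Sum>j=1..n. \<bar>Th a b \<omega> j i\<bar> * (fit_err \<omega> i)\<^sup>2) \<le> m * (B * \<delta>) * (\<Sum>i=1..n. (fit_err \<omega> i)\<^sup>2)"
      unfolding sum_distrib_right[symmetric] sum_distrib_left
      by (rule sum_mono, rule mult_right_mono[OF row[OF col]]) simp_all
  qed
  have "(\<Sum>i=1..n. \<Sum>j=1..n. \<bar>Th a b \<omega> i j\<bar> * ((fit_err \<omega> i)\<^sup>2 + (fit_err \<omega> j)\<^sup>2))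
      = (\<Sum>i=1..n. \<Sum>j=1..n. \<bar>Th a b \<omega> i j\<bar> * (fit_err \<omega> i)\<^sup>2) + (\<Sum>i=1..n. \<Sum>j=1..n. \<bar>Th a b \<omega> i j\<bar> * (fit_err \<omega> j)\<^sup>2)"
    by (simp only: distrib_left sum.distrib)
  also have "(\<Sum>i=1..n. \<Sum>j=1..n. \<bar>Th a b \<omega> i j\<bar> * (fit_err \<omega> j)\<^sup>2) = (\<Sum>i=1..n. \<Sum>j=1..n. \<bar>Th a b \<omega> j i\<bar> * (fit_err \<omega> i)\<^sup>2)"
    by (rule sum.swap)
  also have "(\<Sum>i=1..n. \<Sum>j=1..n. \<bar>Th a b \<omega> i j\<bar> * (fit_err \<omega> i)\<^sup>2) + (\<Sum>i=1..n. \<Sum>j=1..n. \<bar>Th a b \<omega> j i\<bar> * (fit_err \<omega> i)\<^sup>2)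
      \<le> m * (B * \<delta>) * (\<Sum>i=1..n. (fit_err \<omega> i)\<^sup>2) + m * (B * \<delta>) * (\<Sum>i=1..n. (fit_err \<omega> i)\<^sup>2)"
    by (rule add_mono[OF half half'])
  also have "\<dots> = 2 * (m * (B * \<delta>)) * (\<Sum>i=1..n. (fit_err \<omega> i)\<^sup>2)"
    by (simp only: mult_2 distrib_right)
  finally have r: "(\<Sum>i=1..n. \<Sum>j=1..n. \<bar>Th a b \<omega> i j\<bar> * ((fit_err \<omega> i)\<^sup>2 + (fit_err \<omega> j)\<^sup>2))
      \<le> 2 * (m * (B * \<delta>)) * (\<Sum>i=1..n. (fit_err \<omega> i)\<^sup>2)" .
  have "\<bar>fit_part a b \<omega>\<bar>
      \<le> s / 2 * (\<Sum>i=1..n. \<Sum>j=1..n. \<bar>Th a b \<omega> i j\<bar> * ((proj_err \<omega> i)\<^sup>2 + (proj_err \<omega> j)\<^sup>2))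
      + (1 / (2 * s) + 1 / 2) * (\<Sum>i=1..n. \<Sum>j=1..n. \<bar>Th a b \<omega> i j\<bar> * ((fit_err \<omega> i)\<^sup>2 + (fit_err \<omega> j)\<^sup>2))"
    unfolding fit_part_def by (rule weighted_cross_term_le[OF s])
  also have "\<dots> \<le> s / 2 * (\<Sum>i=1..n. \<Sum>j=1..n. \<bar>Th a b \<omega> i j\<bar> * ((proj_err \<omega> i)\<^sup>2 + (proj_err \<omega> j)\<^sup>2))
      + (1 / (2 * s) + 1 / 2) * (2 * (m * (B * \<delta>)) * (\<Sum>i=1..n. (fit_err \<omega> i)\<^sup>2))"
    by (intro add_left_mono mult_left_mono r) (use s in simp)
  also have "\<dots> = fit_major s a b \<omega>"
    unfolding fit_major_def using \<omega> by (simp only: indicator_simps distrib_left mult_1_left if_True simp_thms)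
  finally show ?thesis .
qed

lemma fit_major:
  assumes s: "0 < s"
  shows "integrable M (fit_major s a b)"
    "integral\<^sup>L M (fit_major s a b) \<le> s * (m * ((1 + B) * (m * B\<^sup>2)))
      + (1 / (2 * s) + 1 / 2) * (2 * (m * (B * \<delta>)) * (m * ((1 + B) * real CARD('d))))"
    "0 \<le> fit_major s a b \<omega>"
proof -
  let ?p = "\<lambda>i j \<omega>. indicator E \<omega> * (\<bar>Th a b \<omega> i j\<bar> * (proj_err \<omega> i)\<^sup>2) + indicator E \<omega> * (\<bar>Th a b \<omega> i j\<bar> * (proj_err \<omega> j)\<^sup>2)"
  have pi: "integrable M (?p i j)" if "i \<in> {1..n}" "j \<in> {1..n}" for i j
    by (intro Bochner_Integration.integrable_add proj_err_weighted(1) that)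
  have i1: "integrable M (\<lambda>\<omega>. \<Sum>i=1..n. \<Sum>j=1..n. ?p i j \<omega>)" by (intro Bochner_Integration.integrable_sum pi)
  have i2: "integrable M (\<lambda>\<omega>. \<Sum>i=1..n. indicator E \<omega> * (fit_err \<omega> i)\<^sup>2)"
    by (intro Bochner_Integration.integrable_sum fit_err_square(1))
  show "integrable M (fit_major s a b)"
    unfolding fit_major_def[abs_def] by (intro Bochner_Integration.integrable_add integrable_mult_right i1 i2)
  have "(\<integral>\<omega>. (\<Sum>i=1..n. \<Sum>j=1..n. ?p i j \<omega>) \<partial>M) = (\<Sum>i=1..n. \<Sum>j=1..n. \<integral>\<omega>. ?p i j \<omega> \<partial>M)"
    by (simp only: Bochner_Integration.integral_sum Bochner_Integration.integrable_sum pi cong: sum.cong)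
  also have "\<dots> \<le> (\<Sum>i=1..n. \<Sum>j=1..n. 2 * (m * ((1 + B) * (\<integral>\<omega>. indicator E \<omega> * \<bar>Th a b \<omega> i j\<bar> \<partial>M))))"
  proof (intro sum_mono)
    fix i j assume ij: "i \<in> {1..n}" "j \<in> {1..n}"
    have "(\<integral>\<omega>. ?p i j \<omega> \<partial>M) = (\<integral>\<omega>. indicator E \<omega> * (\<bar>Th a b \<omega> i j\<bar> * (proj_err \<omega> i)\<^sup>2) \<partial>M)
      + (\<integral>\<omega>. indicator E \<omega> * (\<bar>Th a b \<omega> i j\<bar> * (proj_err \<omega> j)\<^sup>2) \<partial>M)"
      by (intro Bochner_Integration.integral_add proj_err_weighted(1) ij)
    then show "(\<integral>\<omega>. ?p i j \<omega> \<partial>M) \<le> 2 * (m * ((1 + B) * (\<integral>\<omega>. indicator E \<omega> * \<bar>Th a b \<omega> i j\<bar> \<partial>M)))"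
      using add_mono[OF proj_err_weighted(2)[OF ij(1) ij, of a b] proj_err_weighted(2)[OF ij(2) ij, of a b]] by simp
  qed
  also have "\<dots> = 2 * (m * ((1 + B) * (\<Sum>i=1..n. \<Sum>j=1..n. \<integral>\<omega>. indicator E \<omega> * \<bar>Th a b \<omega> i j\<bar> \<partial>M)))"
    by (simp only: sum_distrib_left)
  also have "\<dots> \<le> 2 * (m * ((1 + B) * (m * B\<^sup>2)))"
    by (intro mult_left_mono Th_abs_integral_sum) (use m0 B0 in auto)
  finally have b1: "(\<integral>\<omega>. (\<Sum>i=1..n. \<Sum>j=1..n. ?p i j \<omega>) \<partial>M) \<le> 2 * (m * ((1 + B) * (m * B\<^sup>2)))" .
  have b2: "(\<integral>\<omega>. (\<Sum>i=1..n. indicator E \<omega> * (fit_err \<omega> i)\<^sup>2) \<partial>M) \<le> m * ((1 + B) * real CARD('d))"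
    by (subst Bochner_Integration.integral_sum) (rule fit_err_square(1) fit_err_square_sum; assumption?)+
  have "integral\<^sup>L M (fit_major s a b) = s / 2 * (\<integral>\<omega>. (\<Sum>i=1..n. \<Sum>j=1..n. ?p i j \<omega>) \<partial>M)
      + (1 / (2 * s) + 1 / 2) * (2 * (m * (B * \<delta>)) * (\<integral>\<omega>. (\<Sum>i=1..n. indicator E \<omega> * (fit_err \<omega> i)\<^sup>2) \<partial>M))"
    unfolding fit_major_def[abs_def]
    by (subst Bochner_Integration.integral_add) (intro integrable_mult_right i1 i2 | simp only: integral_mult_right_zero)+
  also have "\<dots> \<le> s / 2 * (2 * (m * ((1 + B) * (m * B\<^sup>2))))
      + (1 / (2 * s) + 1 / 2) * (2 * (m * (B * \<delta>)) * (m * ((1 + B) * real CARD('d))))"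
    by (intro add_mono mult_left_mono b1 b2) (use s m0 B0 \<delta>0 in auto)
  finally show "integral\<^sup>L M (fit_major s a b) \<le> s * (m * ((1 + B) * (m * B\<^sup>2)))
      + (1 / (2 * s) + 1 / 2) * (2 * (m * (B * \<delta>)) * (m * ((1 + B) * real CARD('d))))" by simp
  show "0 \<le> fit_major s a b \<omega>"
    unfolding fit_major_def using s m0 B0 \<delta>0
    by (intro add_nonneg_nonneg mult_nonneg_nonneg sum_nonneg) auto
qed

text \<open>Cutting off the coefficients makes them weights in the sense of
  \<open>quadratic_square\<close>; on E nothing changes.\<close>

definition noise_trunc :: "'d \<Rightarrow> 'd \<Rightarrow> 'a \<Rightarrow> real" where
  "noise_trunc a b \<omega> = (\<Sum>i=1..n. \<Sum>j=1..n. centred (\<lambda>\<omega>. indicator E \<omega> * conj_Th a b \<omega> i j) i j \<omega>)"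

lemma noise_trunc_eq: "\<omega> \<in> E \<Longrightarrow> noise_trunc a b \<omega> = noise_part a b \<omega>"
  by (simp add: noise_trunc_def noise_part_def centred_def cong: if_cong)

lemma conj_Th_square_sum:
  assumes \<omega>: "\<omega> \<in> E"
  shows "(\<Sum>i=1..n. \<Sum>j=1..n. (conj_Th a b \<omega> i j)\<^sup>2) \<le> (B * \<delta>) * (m * B\<^sup>2)"
proof -
  interpret P: sym_idem n "ann \<omega>" by (rule sym_idem_ann[OF \<omega>])
  have A: "conj_Th a b \<omega> = P.conj_form (Th a b \<omega>)"
    by (simp add: fun_eq_iff conj_Th_def P.conj_form_def)
  show ?thesis unfolding A using P.conj_form_square_le Th_square_sum[OF \<omega>] by (rule order.trans)
qed

text \<open>Near orthogonality of the centred products bounds the second moment by the squared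
  Frobenius norm of M Th M, up to constants, and that norm carries the factor
  \<open>\<delta>\<close>.\<close>

lemma noise_trunc:
  "integrable M (\<lambda>\<omega>. (noise_trunc a b \<omega>)\<^sup>2)"
  "(\<integral>\<omega>. (noise_trunc a b \<omega>)\<^sup>2 \<partial>M) \<le> 2 * m\<^sup>2 * (quad_const * ((B * \<delta>) * (m * B\<^sup>2)))"
proof -
  let ?C = "(B * \<delta>) * (m * B\<^sup>2)"
  have C0: "0 \<le> ?C" using B0 \<delta>0 m0 by simp
  have le: "(conj_Th a b \<omega> i j)\<^sup>2 \<le> ?C" if "\<omega> \<in> E" "i \<in> {1..n}" "j \<in> {1..n}" for \<omega> i j
  proof -
    have "(conj_Th a b \<omega> i j)\<^sup>2 \<le> (\<Sum>j=1..n. (conj_Th a b \<omega> i j)\<^sup>2)"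
      by (rule member_le_sum[OF that(3)]) auto
    also have "\<dots> \<le> (\<Sum>i=1..n. \<Sum>j=1..n. (conj_Th a b \<omega> i j)\<^sup>2)"
      by (rule member_le_sum[OF that(2), of "\<lambda>i. \<Sum>j=1..n. (conj_Th a b \<omega> i j)\<^sup>2"]) (auto intro!: sum_nonneg)
    finally show ?thesis using conj_Th_square_sum[OF that(1), of a b] by simp
  qed
  have wt: "weight (\<lambda>\<omega>. indicator E \<omega> * conj_Th a b \<omega> i j)" if ij: "i \<in> {1..n}" "j \<in> {1..n}" for i j
  proof (rule weightI[OF conj_Th_F[OF ij], where C = "sqrt ?C"])
    fix \<omega> assume "\<omega> \<in> E"
    then show "\<bar>conj_Th a b \<omega> i j\<bar> \<le> sqrt ?C" using real_sqrt_le_mono[OF le[OF _ ij, of \<omega>]] by simp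
  qed
  note q = quadratic_square[where a = "\<lambda>i j \<omega>. indicator E \<omega> * conj_Th a b \<omega> i j", OF wt, folded noise_trunc_def]
  show "integrable M (\<lambda>\<omega>. (noise_trunc a b \<omega>)\<^sup>2)" by (rule q(1))
  have qc: "0 \<le> quad_const" unfolding quad_const_def using B0 by simp
  have "(\<Sum>i=1..n. \<Sum>j=1..n. \<integral>\<omega>. (indicator E \<omega> * conj_Th a b \<omega> i j)\<^sup>2 \<partial>M)
      = (\<integral>\<omega>. (\<Sum>i=1..n. \<Sum>j=1..n. (indicator E \<omega> * conj_Th a b \<omega> i j)\<^sup>2) \<partial>M)"
    by (simp only: Bochner_Integration.integral_sum Bochner_Integration.integrable_sum weight_square_integrable[OF wt] cong: sum.cong)
  also have "\<dots> = (\<integral>\<omega>. indicator E \<omega> * (\<Sum>i=1..n. \<Sum>j=1..n. (conj_Th a b \<omega> i j)\<^sup>2) \<partial>M)"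
  proof (intro Bochner_Integration.integral_cong refl)
    fix \<omega>
    show "(\<Sum>i=1..n. \<Sum>j=1..n. (indicator E \<omega> * conj_Th a b \<omega> i j)\<^sup>2)
      = indicator E \<omega> * (\<Sum>i=1..n. \<Sum>j=1..n. (conj_Th a b \<omega> i j)\<^sup>2)"
      by (cases "\<omega> \<in> E") simp_all
  qed
  also have "\<dots> \<le> ?C"
    by (rule integral_indicator_E_le[OF _ _ conj_Th_square_sum C0])
       (auto intro!: borel_measurable_sum borel_measurable_power conj_Th_F sum_nonneg simp del: One_nat_def)
  finally have "2 * m\<^sup>2 * (quad_const * (\<Sum>i=1..n. \<Sum>j=1..n. \<integral>\<omega>. (indicator E \<omega> * conj_Th a b \<omega> i j)\<^sup>2 \<partial>M))
      \<le> 2 * m\<^sup>2 * (quad_const * ?C)"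
    by (intro mult_left_mono) (use qc in auto)
  with q(2) show "(\<integral>\<omega>. (noise_trunc a b \<omega>)\<^sup>2 \<partial>M) \<le> 2 * m\<^sup>2 * (quad_const * ?C)"
    by (rule order.trans)
qed

text \<open>The choice \<open>\<delta> = s\<^sup>2\<close> balances the two terms of the fit error.\<close>

lemma deviation_prob:
  assumes s: "0 < s" "\<delta> = s\<^sup>2" and \<epsilon>: "0 < \<epsilon>"
  shows "measure M {\<omega> \<in> E. \<epsilon> < \<bar>deviation \<omega> $ a $ b\<bar>}
    \<le> (s * (m * ((1 + B) * (m * B\<^sup>2))) + (s + s\<^sup>2) * (m * B * (m * ((1 + B) * real CARD('d))))) / (\<epsilon> / 2)
      + s\<^sup>2 * (2 * m\<^sup>2 * ((2 * B + 2 * (1 + (B + B))\<^sup>2) * (B * (m * B\<^sup>2)))) / (\<epsilon> / 2)\<^sup>2"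
proof -
  let ?X = "{\<omega> \<in> space M. \<epsilon> / 2 \<le> fit_major s a b \<omega>}" and ?Y = "{\<omega> \<in> space M. (\<epsilon> / 2)\<^sup>2 \<le> (noise_trunc a b \<omega>)\<^sup>2}"
  note fm = fit_major[OF s(1), of a b] and nt = noise_trunc[of a b]
  note [measurable] = borel_measurable_integrable[OF fm(1)] borel_measurable_integrable[OF nt(1)]
  \<comment> \<open>Each part receives half of \<open>\<epsilon>\<close>. Markov's inequality is
    applied to the first moment of the fit part and to the second moment of the noise.\<close>
  have "{\<omega> \<in> E. \<epsilon> < \<bar>deviation \<omega> $ a $ b\<bar>} \<subseteq> ?X \<union> ?Y"
  proof
    fix \<omega> assume "\<omega> \<in> {\<omega> \<in> E. \<epsilon> < \<bar>deviation \<omega> $ a $ b\<bar>}"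
    then have \<omega>: "\<omega> \<in> E" and lt: "\<epsilon> < \<bar>fit_part a b \<omega> + noise_part a b \<omega>\<bar>" using deviation_split by auto
    have "\<epsilon> / 2 \<le> \<bar>fit_part a b \<omega>\<bar> \<or> \<epsilon> / 2 \<le> \<bar>noise_part a b \<omega>\<bar>" using lt by argo
    then show "\<omega> \<in> ?X \<union> ?Y"
    proof
      assume "\<epsilon> / 2 \<le> \<bar>fit_part a b \<omega>\<bar>"
      then have "\<epsilon> / 2 \<le> fit_major s a b \<omega>" using fit_part_le[OF \<omega> s(1)] by (rule order.trans)
      then show ?thesis using E_space[OF \<omega>] by blast
    next
      assume "\<epsilon> / 2 \<le> \<bar>noise_part a b \<omega>\<bar>"
      then have "(\<epsilon> / 2)\<^sup>2 \<le> \<bar>noise_part a b \<omega>\<bar>\<^sup>2" using \<epsilon> by (intro power_mono) auto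
      then have "(\<epsilon> / 2)\<^sup>2 \<le> (noise_trunc a b \<omega>)\<^sup>2" by (simp only: power2_abs noise_trunc_eq[OF \<omega>])
      then show ?thesis using E_space[OF \<omega>] by blast
    qed
  qed
  then have "measure M {\<omega> \<in> E. \<epsilon> < \<bar>deviation \<omega> $ a $ b\<bar>} \<le> measure M (?X \<union> ?Y)"
    by (rule finite_measure_mono) measurable
  also have "\<dots> \<le> measure M ?X + measure M ?Y"
    by (rule measure_Un_le) measurable
  also have "measure M ?X \<le> integral\<^sup>L M (fit_major s a b) / (\<epsilon> / 2)"
    by (rule integral_Markov_inequality_measure[OF fm(1) sets.empty_sets]) (use fm(3) \<epsilon> in auto)
  also have "\<dots> \<le> (s * (m * ((1 + B) * (m * B\<^sup>2))) + (s + s\<^sup>2) * (m * B * (m * ((1 + B) * real CARD('d))))) / (\<epsilon> / 2)"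
  proof (rule divide_right_mono)
    have "(1 / (2 * s) + 1 / 2) * (2 * (m * (B * \<delta>)) * (m * ((1 + B) * real CARD('d))))
        = ((1 / (2 * s) + 1 / 2) * (2 * s\<^sup>2)) * (m * B * (m * ((1 + B) * real CARD('d))))"
      unfolding s(2) by (simp only: ac_simps)
    also have "(1 / (2 * s) + 1 / 2) * (2 * s\<^sup>2) = s + s\<^sup>2" using s(1) by (simp add: field_simps power2_eq_square)
    finally have eq: "(1 / (2 * s) + 1 / 2) * (2 * (m * (B * \<delta>)) * (m * ((1 + B) * real CARD('d))))
        = (s + s\<^sup>2) * (m * B * (m * ((1 + B) * real CARD('d))))" .
    show "integral\<^sup>L M (fit_major s a b)
        \<le> s * (m * ((1 + B) * (m * B\<^sup>2))) + (s + s\<^sup>2) * (m * B * (m * ((1 + B) * real CARD('d))))"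
      using fm(2) unfolding eq .
  qed (use \<epsilon> in simp)
  also have "measure M ?Y \<le> (\<integral>\<omega>. (noise_trunc a b \<omega>)\<^sup>2 \<partial>M) / (\<epsilon> / 2)\<^sup>2"
    by (rule integral_Markov_inequality_measure[OF nt(1) sets.empty_sets]) (use \<epsilon> in auto)
  also have "\<dots> \<le> s\<^sup>2 * (2 * m\<^sup>2 * ((2 * B + 2 * (1 + (B + B))\<^sup>2) * (B * (m * B\<^sup>2)))) / (\<epsilon> / 2)\<^sup>2"
  proof (rule divide_right_mono)
    have "2 * m\<^sup>2 * (quad_const * ((B * \<delta>) * (m * B\<^sup>2))) = s\<^sup>2 * (2 * m\<^sup>2 * ((2 * B + 2 * (1 + (B + B))\<^sup>2) * (B * (m * B\<^sup>2))))"
      unfolding quad_const_def s(2) by (simp only: ac_simps)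
    then show "(\<integral>\<omega>. (noise_trunc a b \<omega>)\<^sup>2 \<partial>M) \<le> s\<^sup>2 * (2 * m\<^sup>2 * ((2 * B + 2 * (1 + (B + B))\<^sup>2) * (B * (m * B\<^sup>2))))"
      using nt(2) by (simp only:)
  qed simp
  finally show ?thesis by simp
qed

end

section \<open>The good event has probability close to one\<close>

text \<open>The X i need not be integrable; only their products with the F-measurable coefficients
  have to be, as in \<open>real_cond_exp_mult\<close>.\<close>

lemma (in sigma_finite_subalgebra) real_cond_exp_lincomb:
  assumes "finite I"
    and "\<And>i. i \<in> I \<Longrightarrow> c i \<in> borel_measurable F" "\<And>i. i \<in> I \<Longrightarrow> X i \<in> borel_measurable M"
    and "\<And>i. i \<in> I \<Longrightarrow> integrable M (\<lambda>\<omega>. c i \<omega> * X i \<omega>)"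
  shows "AE \<omega> in M. real_cond_exp M F (\<lambda>\<omega>. \<Sum>i\<in>I. c i \<omega> * X i \<omega>) \<omega> = (\<Sum>i\<in>I. c i \<omega> * real_cond_exp M F (X i) \<omega>)"
  using assms
proof (induction I rule: finite_induct)
  case empty
  have "AE \<omega> in M. real_cond_exp M F (\<lambda>_. 0) \<omega> = 0" by (rule real_cond_exp_F_meas) auto
  then show ?case by simp
next
  case (insert j I)
  have j: "AE \<omega> in M. real_cond_exp M F (\<lambda>\<omega>. c j \<omega> * X j \<omega>) \<omega> = c j \<omega> * real_cond_exp M F (X j) \<omega>"
    by (rule real_cond_exp_mult) (use insert.prems in auto)
  have I: "AE \<omega> in M. real_cond_exp M F (\<lambda>\<omega>. \<Sum>i\<in>I. c i \<omega> * X i \<omega>) \<omega> = (\<Sum>i\<in>I. c i \<omega> * real_cond_exp M F (X i) \<omega>)"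
    by (rule insert.IH) (use insert.prems in auto)
  have "AE \<omega> in M. real_cond_exp M F (\<lambda>\<omega>. c j \<omega> * X j \<omega> + (\<Sum>i\<in>I. c i \<omega> * X i \<omega>)) \<omega>
      = real_cond_exp M F (\<lambda>\<omega>. c j \<omega> * X j \<omega>) \<omega> + real_cond_exp M F (\<lambda>\<omega>. \<Sum>i\<in>I. c i \<omega> * X i \<omega>) \<omega>"
    by (rule real_cond_exp_add) (use insert.prems in auto)
  then show ?case unfolding sum.insert[OF insert.hyps] using j I by eventually_elim simp
qed

lemma singular_kernel:
  assumes "\<not> invertible (A :: real ^ 'd ^ 'd)"
  obtains z where "z \<noteq> 0" "A *v z = 0"
  using assms unfolding invertible_left_inverse matrix_left_invertible_ker by blast

section \<open>The conditional variance and invertibility of the regressor matrix\<close>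

context clustered_errors
begin

lemma weight_mult_integrable:
  assumes c: "weight c" and f: "f \<in> borel_measurable M" and sq: "integrable M (\<lambda>\<omega>. (c \<omega> * f \<omega>)\<^sup>2)"
  shows "integrable M (\<lambda>\<omega>. c \<omega> * f \<omega>)"
proof -
  have "integrable M (\<lambda>\<omega>. (c \<omega> * f \<omega>) * 1)"
    by (rule integrable_mult_of_squares) (use weight_M[OF c] f sq in auto)
  then show ?thesis by simp
qed

text \<open>On E the conditional mean subtracted in \<open>cond_variance\<close> vanishes by
  exogeneity, so only the conditional covariances of the errors remain. The score may fail to be
  integrable; the indicator of E, an F-measurable factor, makes all terms integrable and leaves
  conditional expectations on E unchanged.\<close>

lemma Sigma_pop_eq:
  assumes bd: "\<And>\<omega> i. \<omega> \<in> E \<Longrightarrow> i \<in> {1..n} \<Longrightarrow> norm (partial_out n k (w \<omega>) (x \<omega>) i) \<le> C"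
  shows "AE \<omega> in M. \<omega> \<in> E \<longrightarrow> Sigma_pop M n k x w u \<omega> $ a $ b
    = (1 / real n) * (\<Sum>i=1..n. \<Sum>j=1..n. err_cov i j \<omega> *
        (partial_out n k (w \<omega>) (x \<omega>) i $ a * partial_out n k (w \<omega>) (x \<omega>) j $ b))"
proof -
  let ?v = "\<lambda>i \<omega>. partial_out n k (w \<omega>) (x \<omega>) i"
  let ?r = "1 / sqrt (real n)"
  let ?S = "\<lambda>\<omega>. ?r *\<^sub>R (\<Sum>i=1..n. u \<omega> i *\<^sub>R ?v i \<omega>)"
  let ?V = "vec_cond_exp M F ?S"
  let ?f = "\<lambda>\<omega>. outer (?S \<omega> - ?V \<omega>) (?S \<omega> - ?V \<omega>) $ a $ b"
  have C0: "\<bar>?v i \<omega> $ c\<bar> \<le> \<bar>C\<bar>" if "\<omega> \<in> E" "i \<in> {1..n}" for \<omega> i c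
    using component_le_norm_cart[of "?v i \<omega>" c] bd[OF that] by simp
  have vF: "(\<lambda>\<omega>. ?v i \<omega> $ c) \<in> borel_measurable F" if "i \<in> {1..n}" for i c
    by (rule borel_measurable_vec_nth[OF partial_out_measurable[OF w_F that xi_F]])
  have indF: "(indicator E :: 'a \<Rightarrow> real) \<in> borel_measurable F" by (rule borel_measurable_indicator[OF E_F])
  have indM [measurable]: "(indicator E :: 'a \<Rightarrow> real) \<in> borel_measurable M" by (rule F_imp_M[OF indF])
  let ?c1 = "\<lambda>c i \<omega>. indicator E \<omega> * (?r * ?v i \<omega> $ c)"
  let ?c2 = "\<lambda>p \<omega>. indicator E \<omega> * ((1 / real n) * (?v (fst p) \<omega> $ a * ?v (snd p) \<omega> $ b))"
  let ?uu = "\<lambda>p \<omega>. u \<omega> (fst p) * u \<omega> (snd p)"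
  have wt1: "weight (?c1 c i)" if i: "i \<in> {1..n}" for c i
    unfolding weight_def
  proof (intro conjI)
    show "?c1 c i \<in> borel_measurable F" using indF vF[OF i] by simp
    have "\<bar>?c1 c i \<omega>\<bar> \<le> ?r * \<bar>C\<bar>" for \<omega>
    proof (cases "\<omega> \<in> E")
      case True
      then show ?thesis using C0[OF True i, of c] by (simp add: abs_mult divide_right_mono)
    qed simp
    then show "\<exists>C. \<forall>\<omega>. \<bar>?c1 c i \<omega>\<bar> \<le> C" by blast
  qed simp
  have wt2: "weight (?c2 p)" if p: "p \<in> {1..n} \<times> {1..n}" for p
    unfolding weight_def
  proof (intro conjI)
    have fp: "fst p \<in> {1..n}" "snd p \<in> {1..n}" using p by auto
    show "?c2 p \<in> borel_measurable F" using indF vF[OF fp(1)] vF[OF fp(2)] by simp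
    have "\<bar>?c2 p \<omega>\<bar> \<le> (1 / real n) * (\<bar>C\<bar> * \<bar>C\<bar>)" for \<omega>
    proof (cases "\<omega> \<in> E")
      case True
      have "\<bar>?v (fst p) \<omega> $ a * ?v (snd p) \<omega> $ b\<bar> \<le> \<bar>C\<bar> * \<bar>C\<bar>"
        unfolding abs_mult[of "_ $ a"] by (intro mult_mono C0[OF True] fp) auto
      then have "\<bar>(1 / real n) * (?v (fst p) \<omega> $ a * ?v (snd p) \<omega> $ b)\<bar> \<le> (1 / real n) * (\<bar>C\<bar> * \<bar>C\<bar>)"
        unfolding abs_mult[of "1 / real n"] by (intro mult_mono) simp_all
      then show ?thesis using True by simp
    qed simp
    then show "\<exists>C. \<forall>\<omega>. \<bar>?c2 p \<omega>\<bar> \<le> C" by blast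
  qed simp
  have int1: "integrable M (\<lambda>\<omega>. ?c1 c i \<omega> * u \<omega> i)" if i: "i \<in> {1..n}" for c i
    by (rule weight_mult_integrable[OF wt1[OF i] ui_rv[OF i] weighted_square(1)[OF wt1[OF i] i]])
  have int2: "integrable M (\<lambda>\<omega>. ?c2 p \<omega> * ?uu p \<omega>)" if p: "p \<in> {1..n} \<times> {1..n}" for p
  proof -
    have fp: "fst p \<in> {1..n}" "snd p \<in> {1..n}" using p by auto
    show ?thesis
      by (rule weight_mult_integrable[OF wt2[OF p] borel_measurable_times[OF ui_rv[OF fp(1)] ui_rv[OF fp(2)]] weighted_product(1)[OF wt2[OF p] fp]])
  qed
  have S_comp: "indicator E \<omega> * ?S \<omega> $ c = (\<Sum>i=1..n. ?c1 c i \<omega> * u \<omega> i)" for c \<omega>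
    by (simp add: sum_distrib_left mult.commute mult.left_commute del: One_nat_def)
  have S_meas [measurable]: "(\<lambda>\<omega>. ?S \<omega> $ c) \<in> borel_measurable M" for c
    unfolding vector_scaleR_component sum_component real_scaleR_def
    by (intro borel_measurable_times borel_measurable_const borel_measurable_sum ui_rv F_imp_M[OF vF])
  \<comment> \<open>Times the indicator of E, the score is a combination of the errors with weights
    as coefficients, so conditioning acts on each error separately.\<close>
  have V0: "AE \<omega> in M. \<omega> \<in> E \<longrightarrow> ?V \<omega> $ c = 0" for c
  proof -
    have "AE \<omega> in M. real_cond_exp M F (\<lambda>\<omega>. indicator E \<omega> * ?S \<omega> $ c) \<omega> = indicator E \<omega> * real_cond_exp M F (\<lambda>\<omega>. ?S \<omega> $ c) \<omega>"
      by (rule F.real_cond_exp_mult[OF indF S_meas]) (simp only: S_comp, intro Bochner_Integration.integrable_sum int1)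
    moreover have "AE \<omega> in M. real_cond_exp M F (\<lambda>\<omega>. indicator E \<omega> * ?S \<omega> $ c) \<omega>
        = (\<Sum>i=1..n. ?c1 c i \<omega> * real_cond_exp M F (\<lambda>\<omega>. u \<omega> i) \<omega>)"
      unfolding S_comp
      by (rule F.real_cond_exp_lincomb[where c = "?c1 c" and X = "\<lambda>i \<omega>. u \<omega> i"]) (simp, (erule weight_F[OF wt1] ui_rv int1)+)
    moreover have "AE \<omega> in M. \<forall>i\<in>{1..n}. real_cond_exp M F (\<lambda>\<omega>. u \<omega> i) \<omega> = 0"
      by (rule AE_finite_allI) (simp, erule exog)
    ultimately show ?thesis
    proof eventually_elim
      case (elim \<omega>)
      have "(\<Sum>i=1..n. ?c1 c i \<omega> * real_cond_exp M F (\<lambda>\<omega>. u \<omega> i) \<omega>) = 0"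
        by (intro sum.neutral ballI) (simp only: bspec[OF elim(3)] mult_zero_right)
      then have "indicator E \<omega> * real_cond_exp M F (\<lambda>\<omega>. ?S \<omega> $ c) \<omega> = 0"
        using elim(1,2) by (simp only:)
      then show ?case unfolding vec_cond_exp_def vec_lambda_beta by (cases "\<omega> \<in> E") simp_all
    qed
  qed
  have V_meas [measurable]: "(\<lambda>\<omega>. ?V \<omega> $ c) \<in> borel_measurable M" for c
    by (simp add: vec_cond_exp_def)
  have f_eq: "?f \<omega> = (?S \<omega> $ a - ?V \<omega> $ a) * (?S \<omega> $ b - ?V \<omega> $ b)" for \<omega>
    by (simp only: outer_def vec_lambda_beta vector_minus_component)
  have f_meas [measurable]: "?f \<in> borel_measurable M" unfolding f_eq by measurable
  let ?g = "\<lambda>\<omega>. \<Sum>p\<in>{1..n} \<times> {1..n}. ?c2 p \<omega> * ?uu p \<omega>"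
  have g_int: "integrable M ?g" by (intro Bochner_Integration.integrable_sum int2)
  have fg: "AE \<omega> in M. indicator E \<omega> * ?f \<omega> = ?g \<omega>"
    using V0[of a] V0[of b]
  proof eventually_elim
    case (elim \<omega>)
    show ?case
    proof (cases "\<omega> \<in> E")
      case True
      have rr: "?r * ?r = 1 / real n" by simp
      have "?f \<omega> = ?S \<omega> $ a * ?S \<omega> $ b" using elim True by (simp only: f_eq diff_zero simp_thms)
      also have "\<dots> = (?r * ?r) * (\<Sum>i=1..n. \<Sum>j=1..n. (u \<omega> i * ?v i \<omega> $ a) * (u \<omega> j * ?v j \<omega> $ b))"
        unfolding vector_scaleR_component sum_component real_scaleR_def sum_product[symmetric] by (simp only: ac_simps)
      also have "\<dots> = (\<Sum>i=1..n. \<Sum>j=1..n. ((1 / real n) * (?v i \<omega> $ a * ?v j \<omega> $ b)) * (u \<omega> i * u \<omega> j))"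
        unfolding rr sum_distrib_left by (intro sum.cong refl) (simp only: ac_simps)
      also have "\<dots> = ?g \<omega>" unfolding sum.cartesian_product using True
        by (intro sum.cong refl) (simp add: case_prod_beta)
      finally show ?thesis using True by simp
    qed simp
  qed
  note ef_meas = borel_measurable_times[OF indM f_meas] and g_meas = borel_measurable_integrable[OF g_int]
  have f_int: "integrable M (\<lambda>\<omega>. indicator E \<omega> * ?f \<omega>)"
    by (rule integrable_cong_AE[OF ef_meas g_meas fg, THEN iffD2, OF g_int])
  have 1: "AE \<omega> in M. real_cond_exp M F (\<lambda>\<omega>. indicator E \<omega> * ?f \<omega>) \<omega> = indicator E \<omega> * real_cond_exp M F ?f \<omega>"
    by (rule F.real_cond_exp_mult[OF indF f_meas f_int])
  have 2: "AE \<omega> in M. real_cond_exp M F (\<lambda>\<omega>. indicator E \<omega> * ?f \<omega>) \<omega> = real_cond_exp M F ?g \<omega>"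
    by (rule F.real_cond_exp_cong[OF fg ef_meas g_meas])
  have 3: "AE \<omega> in M. real_cond_exp M F ?g \<omega> = (\<Sum>p\<in>{1..n} \<times> {1..n}. ?c2 p \<omega> * real_cond_exp M F (?uu p) \<omega>)"
  proof (rule F.real_cond_exp_lincomb[where c = ?c2 and X = ?uu])
    fix p assume p: "p \<in> {1..n} \<times> {1..n}"
    then show "?c2 p \<in> borel_measurable F" "integrable M (\<lambda>\<omega>. ?c2 p \<omega> * ?uu p \<omega>)"
      by (rule weight_F[OF wt2], rule int2)
    have fp: "fst p \<in> {1..n}" "snd p \<in> {1..n}" using p by auto
    show "?uu p \<in> borel_measurable M" by (rule borel_measurable_times[OF ui_rv[OF fp(1)] ui_rv[OF fp(2)]])
  qed simp
  show ?thesis using 1 2 3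
  proof eventually_elim
    case (elim \<omega>)
    show ?case
    proof
      assume \<omega>: "\<omega> \<in> E"
      have "Sigma_pop M n k x w u \<omega> $ a $ b = real_cond_exp M F ?f \<omega>"
        unfolding Sigma_pop_def cond_variance_def mat_cond_exp_def vec_lambda_beta ..
      also have "\<dots> = (\<Sum>p\<in>{1..n} \<times> {1..n}. ?c2 p \<omega> * real_cond_exp M F (?uu p) \<omega>)"
        using elim \<omega> by simp
      also have "\<dots> = (\<Sum>i=1..n. \<Sum>j=1..n. (1 / real n) * (err_cov i j \<omega> * (?v i \<omega> $ a * ?v j \<omega> $ b)))"
        unfolding sum.cartesian_product using \<omega>
        by (intro sum.cong refl) (simp add: case_prod_beta err_cov_def)
      finally show "Sigma_pop M n k x w u \<omega> $ a $ b = (1 / real n) * (\<Sum>i=1..n. \<Sum>j=1..n. err_cov i j \<omega> * (?v i \<omega> $ a * ?v j \<omega> $ b))"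
        by (simp only: sum_distrib_left)
    qed
  qed
qed

text \<open>A kernel vector of \<open>H\<close> is orthogonal to every residual, hence in the kernel of \<^const>\<open>Sigma_pop\<close>.\<close>

lemma invertible_H:
  assumes bd: "\<And>\<omega> i. \<omega> \<in> E \<Longrightarrow> i \<in> {1..n} \<Longrightarrow> norm (partial_out n k (w \<omega>) (x \<omega>) i) \<le> C"
  shows "AE \<omega> in M. \<omega> \<in> E \<longrightarrow> invertible (Sigma_pop M n k x w u \<omega>) \<longrightarrow>
    invertible (\<Sum>i=1..n. outer (partial_out n k (w \<omega>) (x \<omega>) i) (partial_out n k (w \<omega>) (x \<omega>) i))"
proof -
  let ?v = "\<lambda>i \<omega>. partial_out n k (w \<omega>) (x \<omega>) i"
  have "AE \<omega> in M. \<forall>a\<in>UNIV. \<forall>b\<in>UNIV. \<omega> \<in> E \<longrightarrow> Sigma_pop M n k x w u \<omega> $ a $ b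
    = (1 / real n) * (\<Sum>i=1..n. \<Sum>j=1..n. err_cov i j \<omega> * (?v i \<omega> $ a * ?v j \<omega> $ b))"
    by (rule AE_finite_allI[OF finite], rule AE_finite_allI[OF finite], rule Sigma_pop_eq[OF bd])
  then show ?thesis
  proof eventually_elim
    case (elim \<omega>)
    show ?case
    proof (intro impI, rule ccontr)
      assume \<omega>: "\<omega> \<in> E" and S: "invertible (Sigma_pop M n k x w u \<omega>)"
        and H: "\<not> invertible (\<Sum>i=1..n. outer (?v i \<omega>) (?v i \<omega>))"
      obtain z where z: "z \<noteq> 0" "(\<Sum>i=1..n. outer (?v i \<omega>) (?v i \<omega>)) *v z = 0"
        by (rule singular_kernel[OF H])
      \<comment> \<open>z' H z is a sum of squares, so its vanishing forces each inner product to
        vanish.\<close>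
      have "(\<Sum>i=1..n. (?v i \<omega> \<bullet> z)\<^sup>2) = z \<bullet> ((\<Sum>i=1..n. outer (?v i \<omega>) (?v i \<omega>)) *v z)"
        unfolding sum_matrix_vector_mult outer_mult
        by (simp add: inner_sum_right power2_eq_square inner_commute)
      then have "(\<Sum>i=1..n. (?v i \<omega> \<bullet> z)\<^sup>2) = 0" using z by simp
      then have vz: "?v i \<omega> \<bullet> z = 0" if "i \<in> {1..n}" for i
        using that by (subst (asm) sum_nonneg_eq_0_iff) auto
      have "Sigma_pop M n k x w u \<omega> *v z = 0"
      proof (rule Finite_Cartesian_Product.vec_eq_iff[THEN iffD2], rule allI)
        fix a
        have "(Sigma_pop M n k x w u \<omega> *v z) $ a
          = (\<Sum>b\<in>UNIV. (\<Sum>i=1..n. \<Sum>j=1..n. (1 / real n) * (err_cov i j \<omega> * (?v i \<omega> $ a * (?v j \<omega> $ b * z $ b)))))"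
          unfolding matrix_vector_mult_def vec_lambda_beta using elim \<omega>
          by (intro sum.cong refl) (simp add: sum_distrib_left sum_distrib_right mult.assoc)
        also have "\<dots> = (\<Sum>i=1..n. \<Sum>j=1..n. \<Sum>b\<in>UNIV. (1 / real n) * (err_cov i j \<omega> * (?v i \<omega> $ a * (?v j \<omega> $ b * z $ b))))"
          by (rule sum_push2)
        also have "\<dots> = (\<Sum>i=1..n. \<Sum>j=1..n. (1 / real n) * (err_cov i j \<omega> * (?v i \<omega> $ a * (?v j \<omega> \<bullet> z))))"
          unfolding inner_vec_def inner_real_def sum_distrib_left ..
        also have "\<dots> = 0" by (intro sum.neutral ballI) (simp only: vz mult_zero_right)
        finally show "(Sigma_pop M n k x w u \<omega> *v z) $ a = 0 $ a" by simp
      qed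
      then have "matrix_inv (Sigma_pop M n k x w u \<omega>) *v (Sigma_pop M n k x w u \<omega> *v z) = 0" by simp
      then have "z = 0" by (simp only: matrix_vector_mul_assoc matrix_inv_inverts(1)[OF S] matrix_vector_mul_lid)
      then show False using z by simp
    qed
  qed
qed

end

section \<open>Size of the partialled-out regressors\<close>

context full_rank_controls
begin

text \<open>M W = 0 removes any combination of the controls whose coefficients are common to all
  observations.\<close>

lemma partial_out_shift:
  fixes z :: "nat \<Rightarrow> 'b::real_vector"
  assumes x: "\<And>j. j \<in> {1..n} \<Longrightarrow> x j = z j + (\<Sum>b<k. w j b *\<^sub>R d b)" and i: "i \<in> {1..n}"
  shows "partial_out n k w x i = partial_out n k w z i"
proof -
  have "partial_out n k w x i = (\<Sum>j=1..n. annih n k w i j *\<^sub>R z j + (\<Sum>b<k. (annih n k w i j * w j b) *\<^sub>R d b))"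
    unfolding partial_out_def by (intro sum.cong refl) (simp add: x scaleR_add_right scaleR_sum_right)
  also have "\<dots> = partial_out n k w z i + (\<Sum>b<k. (\<Sum>j=1..n. annih n k w i j * w j b) *\<^sub>R d b)"
    unfolding sum.distrib partial_out_def scaleR_sum_left by (subst sum.swap) (rule refl)
  also have "(\<Sum>b<k. (\<Sum>j=1..n. annih n k w i j * w j b) *\<^sub>R d b) = 0"
    by (intro sum.neutral ballI) (use annih_controls[OF _ i] in simp)
  finally show ?thesis by simp
qed

end

context cluster_row
begin

lemma vec_cond_exp_measurable: "vec_cond_exp M N f \<in> borel_measurable N"
  by (rule borel_measurable_vecI) (simp add: vec_cond_exp_def)

lemma V_dev_measurable: "i \<in> {1..n} \<Longrightarrow> (\<lambda>\<omega>. V_dev M n k x w \<omega> i) \<in> borel_measurable M"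
  unfolding V_dev_def
  by (intro borel_measurable_diff measurable_from_subalg[OF subalgebra_F xi_F]
      measurable_from_subalg[OF subalgebra_W vec_cond_exp_measurable])

text \<open>\<open>v_proj\<close> subtracts from x a combination of the controls with nonrandom
  coefficients d. That combination is W-measurable and passes through the conditional expectation,
  so V plus the conditional mean of \<open>v_proj\<close> differs from x by it alone. Since any
  nonrandom d will do, the default value of \<open>inv_mat\<close> does no harm.\<close>

lemma regressor_decomposition:
  assumes x_int: "\<And>i. i \<in> {1..n} \<Longrightarrow> integrable M (\<lambda>\<omega>. x \<omega> i)"
    and ww_int: "\<And>i a. i \<in> {1..n} \<Longrightarrow> a < k \<Longrightarrow> integrable M (\<lambda>\<omega>. w \<omega> i a * w \<omega> i a)"
  obtains d where "AE \<omega> in M. \<forall>i\<in>{1..n}. x \<omega> i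
    = (V_dev M n k x w \<omega> i + vec_cond_exp M W (\<lambda>\<omega>. v_proj M n k x w \<omega> i) \<omega>) + (\<Sum>b<k. w \<omega> i b *\<^sub>R d b)"
proof -
  interpret W: sigma_finite_subalgebra M W by (rule sigma_finite_subalgebraI[OF subalgebra_W])
  define Bm where "Bm = inv_mat (Matrix.mat k k (\<lambda>(a, b). \<Sum>j=1..n. \<integral>\<omega>. w \<omega> j a * w \<omega> j b \<partial>M))"
  define c :: "nat \<Rightarrow> real ^ 'd" where "c a = (\<chi> c. \<Sum>j=1..n. \<integral>\<omega>. x \<omega> j $ c * w \<omega> j a \<partial>M)" for a
  define d where "d b = (\<Sum>a<k. Bm $$ (a, b) *\<^sub>R c a)" for b
  have vp: "v_proj M n k x w \<omega> i = x \<omega> i - (\<Sum>b<k. w \<omega> i b *\<^sub>R d b)" for \<omega> i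
  proof -
    have "(\<Sum>a<k. \<Sum>b<k. (Bm $$ (a, b) * w \<omega> i b) *\<^sub>R c a) = (\<Sum>b<k. w \<omega> i b *\<^sub>R d b)"
      unfolding d_def scaleR_sum_right by (subst sum.swap) (simp add: mult.commute)
    then show ?thesis unfolding v_proj_def Let_def Bm_def[symmetric] c_def[symmetric] by simp
  qed
  have wW: "(\<lambda>\<omega>. w \<omega> i b) \<in> borel_measurable W" if "i \<in> {1..n}" "b < k" for i b
    by (rule control_component[OF w_W that])
  \<comment> \<open>On a probability space integrable squares give integrable controls, which taking
    conditional expectations of the combination requires.\<close>
  have w_int: "integrable M (\<lambda>\<omega>. w \<omega> i b)" if "i \<in> {1..n}" "b < k" for i b
  proof -
    have "integrable M (\<lambda>\<omega>. w \<omega> i b * 1)"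
      by (rule integrable_mult_of_squares)
         (use measurable_from_subalg[OF subalgebra_W wW[OF that]] ww_int[OF that] in \<open>auto simp: power2_eq_square\<close>)
    then show ?thesis by simp
  qed
  have comp: "AE \<omega> in M. vec_cond_exp M W (\<lambda>\<omega>. v_proj M n k x w \<omega> i) \<omega> $ c
      = vec_cond_exp M W (\<lambda>\<omega>. x \<omega> i) \<omega> $ c - (\<Sum>b<k. w \<omega> i b *\<^sub>R d b) $ c" if i: "i \<in> {1..n}" for i c
  proof -
    let ?h = "\<lambda>\<omega>. \<Sum>b<k. w \<omega> i b * d b $ c"
    have h: "?h \<in> borel_measurable W" "integrable M ?h"
      using wW[OF i] w_int[OF i] by (auto intro!: borel_measurable_sum)
    have x_c: "integrable M (\<lambda>\<omega>. x \<omega> i $ c)"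
      by (rule integrable_bounded_linear[OF bounded_linear_vec_nth x_int[OF i]])
    have "AE \<omega> in M. real_cond_exp M W (\<lambda>\<omega>. x \<omega> i $ c - ?h \<omega>) \<omega>
        = real_cond_exp M W (\<lambda>\<omega>. x \<omega> i $ c) \<omega> - real_cond_exp M W ?h \<omega>"
      by (rule W.real_cond_exp_diff[OF x_c h(2)])
    moreover have "AE \<omega> in M. real_cond_exp M W ?h \<omega> = ?h \<omega>"
      by (rule W.real_cond_exp_F_meas[OF h(2,1)])
    ultimately show ?thesis
      unfolding vec_cond_exp_def vec_lambda_beta vp vector_minus_component sum_component vector_scaleR_component real_scaleR_def
      by eventually_elim simp
  qed
  have "AE \<omega> in M. \<forall>i\<in>{1..n}. \<forall>c\<in>UNIV. vec_cond_exp M W (\<lambda>\<omega>. v_proj M n k x w \<omega> i) \<omega> $ c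
      = vec_cond_exp M W (\<lambda>\<omega>. x \<omega> i) \<omega> $ c - (\<Sum>b<k. w \<omega> i b *\<^sub>R d b) $ c"
    by (rule AE_finite_allI[OF finite_atLeastAtMost], rule AE_finite_allI[OF finite], rule comp)
  then have "AE \<omega> in M. \<forall>i\<in>{1..n}. x \<omega> i
    = (V_dev M n k x w \<omega> i + vec_cond_exp M W (\<lambda>\<omega>. v_proj M n k x w \<omega> i) \<omega>) + (\<Sum>b<k. w \<omega> i b *\<^sub>R d b)"
  proof eventually_elim
    case (elim \<omega>)
    show ?case
    proof
      fix i assume "i \<in> {1..n}"
      then have "vec_cond_exp M W (\<lambda>\<omega>. v_proj M n k x w \<omega> i) \<omega>
        = vec_cond_exp M W (\<lambda>\<omega>. x \<omega> i) \<omega> - (\<Sum>b<k. w \<omega> i b *\<^sub>R d b)"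
        using elim by (simp add: Finite_Cartesian_Product.vec_eq_iff)
      then show "x \<omega> i = (V_dev M n k x w \<omega> i + vec_cond_exp M W (\<lambda>\<omega>. v_proj M n k x w \<omega> i) \<omega>) + (\<Sum>b<k. w \<omega> i b *\<^sub>R d b)"
        unfolding V_dev_def by simp
    qed
  qed
  then show thesis by (rule that)
qed

text \<open>Partialling out removes the controls and contracts, so the square sum is at most that of
  V + Q, hence at most twice that of V plus twice that of Q. On A the sum for V has mean at most n
  (1 + B) by the conditional fourth moments, and the sum for Q has mean at most n X by
  \<open>chi\<close>. Markov's inequality for the two sums yields the exceptional set N.\<close>

lemma residual_norm_prob:
  assumes x_int: "\<And>i. i \<in> {1..n} \<Longrightarrow> integrable M (\<lambda>\<omega>. x \<omega> i)"
    and ww_int: "\<And>i a. i \<in> {1..n} \<Longrightarrow> a < k \<Longrightarrow> integrable M (\<lambda>\<omega>. w \<omega> i a * w \<omega> i a)"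
    and n0: "0 < n" and R: "0 < R" and B0: "0 \<le> B" and X0: "0 \<le> X"
    and chi: "chi_pop M n k x w \<le> ennreal X"
  defines "A \<equiv> {\<omega> \<in> space M. \<forall>i\<in>{1..n}. nn_cond_exp M W (\<lambda>\<omega>. ennreal (norm (V_dev M n k x w \<omega> i) ^ 4)) \<omega> \<le> ennreal B}"
  obtains N where "N \<in> sets M" "measure M N \<le> (4 * (1 + B) + 4 * X) / R"
    "AE \<omega> in M. \<omega> \<in> A \<longrightarrow> \<omega> \<notin> N \<longrightarrow> Determinant.det (gram n k (w \<omega>)) \<noteq> 0 \<longrightarrow>
      (\<Sum>i=1..n. (norm (partial_out n k (w \<omega>) (x \<omega>) i))\<^sup>2) \<le> real n * R"
proof -
  interpret W: sigma_finite_subalgebra M W by (rule sigma_finite_subalgebraI[OF subalgebra_W])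
  let ?V = "V_dev M n k x w" and ?Q = "\<lambda>i. vec_cond_exp M W (\<lambda>\<omega>. v_proj M n k x w \<omega> i)"
  have V_meas: "(\<lambda>\<omega>. ?V \<omega> i) \<in> borel_measurable M" if "i \<in> {1..n}" for i by (rule V_dev_measurable[OF that])
  have Q_meas: "?Q i \<in> borel_measurable M" for i
    by (rule measurable_from_subalg[OF subalgebra_W vec_cond_exp_measurable])
  have AW: "A \<in> sets W"
  proof -
    have "{\<omega> \<in> space W. \<forall>i\<in>{1..n}. nn_cond_exp M W (\<lambda>\<omega>. ennreal (norm (?V \<omega> i) ^ 4)) \<omega> \<le> ennreal B} \<in> sets W"
      by measurable
    then show ?thesis unfolding A_def spaces(1) .
  qed
  have AM: "A \<in> sets M" using AW subalgebra_W by (auto simp: subalgebra_def)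
  have V_int: "integrable M (\<lambda>\<omega>. indicator A \<omega> * (norm (?V \<omega> i))\<^sup>2) \<and> (\<integral>\<omega>. indicator A \<omega> * (norm (?V \<omega> i))\<^sup>2 \<partial>M) \<le> 1 + B"
    if i: "i \<in> {1..n}" for i
  proof -
    note [measurable] = V_meas[OF i] AM AW
    have "(\<integral>\<^sup>+\<omega>. ennreal (indicator A \<omega> * (norm (?V \<omega> i))\<^sup>2) \<partial>M)
        \<le> (\<integral>\<^sup>+\<omega>. 1 + indicator A \<omega> * ennreal (norm (?V \<omega> i) ^ 4) \<partial>M)"
    proof (rule nn_integral_mono)
      fix \<omega>
      have "(norm (?V \<omega> i))\<^sup>2 \<le> 1 + norm (?V \<omega> i) ^ 4"
      proof -
        have "0 \<le> ((norm (?V \<omega> i))\<^sup>2 - 1)\<^sup>2" by simp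
        then have "2 * (norm (?V \<omega> i))\<^sup>2 \<le> norm (?V \<omega> i) ^ 4 + 1" by (simp add: power2_diff power_mult[symmetric])
        then show ?thesis using zero_le_power2[of "norm (?V \<omega> i)"] by argo
      qed
      from ennreal_leI[OF this]
      show "ennreal (indicator A \<omega> * (norm (?V \<omega> i))\<^sup>2) \<le> 1 + indicator A \<omega> * ennreal (norm (?V \<omega> i) ^ 4)"
        by (cases "\<omega> \<in> A") simp_all
    qed
    also have "\<dots> = 1 + (\<integral>\<^sup>+\<omega>. indicator A \<omega> * ennreal (norm (?V \<omega> i) ^ 4) \<partial>M)"
      by (subst nn_integral_add) (auto simp: emeasure_space_1)
    also have "(\<integral>\<^sup>+\<omega>. indicator A \<omega> * ennreal (norm (?V \<omega> i) ^ 4) \<partial>M)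
        = (\<integral>\<^sup>+\<omega>. indicator A \<omega> * nn_cond_exp M W (\<lambda>\<omega>. ennreal (norm (?V \<omega> i) ^ 4)) \<omega> \<partial>M)"
      by (rule W.nn_cond_exp_intg[symmetric]) measurable
    also have "\<dots> \<le> (\<integral>\<^sup>+\<omega>. ennreal B \<partial>M)"
    proof (rule nn_integral_mono)
      fix \<omega>
      show "indicator A \<omega> * nn_cond_exp M W (\<lambda>\<omega>. ennreal (norm (?V \<omega> i) ^ 4)) \<omega> \<le> ennreal B"
        using i by (cases "\<omega> \<in> A") (auto simp: A_def)
    qed
    also have "\<dots> = ennreal B" by (simp add: emeasure_space_1)
    finally have le: "(\<integral>\<^sup>+\<omega>. ennreal (indicator A \<omega> * (norm (?V \<omega> i))\<^sup>2) \<partial>M) \<le> ennreal (1 + B)"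
      using B0 by simp
    show ?thesis by (intro conjI integrable_integral_leI[OF _ _ le]) (use B0 in auto)
  qed
  have Q_int: "integrable M (\<lambda>\<omega>. \<Sum>i=1..n. (norm (?Q i \<omega>))\<^sup>2)" "(\<integral>\<omega>. (\<Sum>i=1..n. (norm (?Q i \<omega>))\<^sup>2) \<partial>M) \<le> real n * X"
  proof -
    note [measurable] = Q_meas
    let ?Y = "\<Sum>i=1..n. \<integral>\<^sup>+\<omega>. ennreal ((norm (?Q i \<omega>))\<^sup>2) \<partial>M"
    have "(\<integral>\<^sup>+\<omega>. ennreal (\<Sum>i=1..n. (norm (?Q i \<omega>))\<^sup>2) \<partial>M) = (\<integral>\<^sup>+\<omega>. (\<Sum>i=1..n. ennreal ((norm (?Q i \<omega>))\<^sup>2)) \<partial>M)"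
      by (simp add: sum_ennreal)
    also have "\<dots> = ?Y" by (rule nn_integral_sum) measurable
    also have "?Y = ennreal (real n) * (ennreal (1 / real n) * ?Y)"
      using n0 by (simp add: mult.assoc[symmetric] ennreal_mult[symmetric])
    also have "\<dots> \<le> ennreal (real n) * ennreal X"
      using chi unfolding chi_pop_def by (rule mult_left_mono) simp
    finally have le: "(\<integral>\<^sup>+\<omega>. ennreal (\<Sum>i=1..n. (norm (?Q i \<omega>))\<^sup>2) \<partial>M) \<le> ennreal (real n * X)"
      by (simp add: ennreal_mult X0)
    show "integrable M (\<lambda>\<omega>. \<Sum>i=1..n. (norm (?Q i \<omega>))\<^sup>2)" "(\<integral>\<omega>. (\<Sum>i=1..n. (norm (?Q i \<omega>))\<^sup>2) \<partial>M) \<le> real n * X"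
      by (rule integrable_integral_leI[OF _ _ le]; use X0 in \<open>simp add: sum_nonneg\<close>)+
  qed
  let ?SV = "\<lambda>\<omega>. \<Sum>i=1..n. indicator A \<omega> * (norm (?V \<omega> i))\<^sup>2" and ?SQ = "\<lambda>\<omega>. \<Sum>i=1..n. (norm (?Q i \<omega>))\<^sup>2"
  have SV_int: "integrable M ?SV" using V_int by (intro Bochner_Integration.integrable_sum) auto
  have "integral\<^sup>L M ?SV = (\<Sum>i=1..n. \<integral>\<omega>. indicator A \<omega> * (norm (?V \<omega> i))\<^sup>2 \<partial>M)"
    by (rule Bochner_Integration.integral_sum) (use V_int in auto)
  also have "\<dots> \<le> (\<Sum>i=1..n. 1 + B)" by (rule sum_mono) (use V_int in auto)
  finally have SV_le: "integral\<^sup>L M ?SV \<le> real n * (1 + B)" by simp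
  \<comment> \<open>The threshold is chosen so that 2 ?c + 2 ?c = n R.\<close>
  let ?c = "real n * R / 4"
  have c0: "0 < ?c" using n0 R by simp
  let ?N1 = "{\<omega> \<in> space M. ?c \<le> ?SV \<omega>}" and ?N2 = "{\<omega> \<in> space M. ?c \<le> ?SQ \<omega>}"
  note [measurable] = borel_measurable_integrable[OF SV_int] borel_measurable_integrable[OF Q_int(1)]
  have N12: "?N1 \<in> sets M" "?N2 \<in> sets M" by measurable
  have "measure M ?N1 \<le> integral\<^sup>L M ?SV / ?c"
    by (rule integral_Markov_inequality_measure[OF SV_int sets.empty_sets]) (use c0 in \<open>auto intro!: sum_nonneg\<close>)
  also have "\<dots> \<le> real n * (1 + B) / ?c" by (rule divide_right_mono[OF SV_le]) (use c0 in simp)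
  finally have m1: "measure M ?N1 \<le> 4 * (1 + B) / R" using n0 R by (simp add: mult.commute)
  have "measure M ?N2 \<le> integral\<^sup>L M ?SQ / ?c"
    by (rule integral_Markov_inequality_measure[OF Q_int(1) sets.empty_sets]) (use c0 in \<open>auto intro!: sum_nonneg\<close>)
  also have "\<dots> \<le> real n * X / ?c" by (rule divide_right_mono[OF Q_int(2)]) (use c0 in simp)
  finally have m2: "measure M ?N2 \<le> 4 * X / R" using n0 R by (simp add: mult.commute)
  obtain d where dec: "AE \<omega> in M. \<forall>i\<in>{1..n}. x \<omega> i = (?V \<omega> i + ?Q i \<omega>) + (\<Sum>b<k. w \<omega> i b *\<^sub>R d b)"
    by (rule regressor_decomposition[OF x_int ww_int])
  show thesis
  proof (rule that[of "?N1 \<union> ?N2"])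
    show "?N1 \<union> ?N2 \<in> sets M" by (rule sets.Un[OF N12])
    have "measure M (?N1 \<union> ?N2) \<le> measure M ?N1 + measure M ?N2" by (rule measure_Un_le[OF N12])
    also have "\<dots> \<le> (4 * (1 + B) + 4 * X) / R" using add_mono[OF m1 m2] by (simp only: add_divide_distrib)
    finally show "measure M (?N1 \<union> ?N2) \<le> (4 * (1 + B) + 4 * X) / R" .
    show "AE \<omega> in M. \<omega> \<in> A \<longrightarrow> \<omega> \<notin> ?N1 \<union> ?N2 \<longrightarrow> Determinant.det (gram n k (w \<omega>)) \<noteq> 0 \<longrightarrow>
      (\<Sum>i=1..n. (norm (partial_out n k (w \<omega>) (x \<omega>) i))\<^sup>2) \<le> real n * R"
      using dec
    proof eventually_elim
      case (elim \<omega>)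
      show ?case
      proof (intro impI)
        assume A: "\<omega> \<in> A" and N: "\<omega> \<notin> ?N1 \<union> ?N2" and det: "Determinant.det (gram n k (w \<omega>)) \<noteq> 0"
        interpret full_rank_controls n k "w \<omega>" by unfold_locales (rule det)
        have sp: "\<omega> \<in> space M" using A by (simp add: A_def)
        let ?z = "\<lambda>i. ?V \<omega> i + ?Q i \<omega>"
        have "(\<Sum>i=1..n. (norm (partial_out n k (w \<omega>) (x \<omega>) i))\<^sup>2) = (\<Sum>i=1..n. (norm (partial_out n k (w \<omega>) ?z i))\<^sup>2)"
          by (intro sum.cong refl arg_cong[where f = "\<lambda>t. (norm t)\<^sup>2"] partial_out_shift[where d = d] bspec[OF elim])
        also have "\<dots> \<le> (\<Sum>i=1..n. (norm (?z i))\<^sup>2)" by (rule partial_out_norm_le)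
        also have "\<dots> \<le> (\<Sum>i=1..n. 2 * (norm (?V \<omega> i))\<^sup>2 + 2 * (norm (?Q i \<omega>))\<^sup>2)"
        proof (rule sum_mono)
          fix i
          have "(norm (?z i))\<^sup>2 \<le> (norm (?V \<omega> i) + norm (?Q i \<omega>))\<^sup>2"
            by (intro power_mono norm_triangle_ineq norm_ge_zero)
          also have "\<dots> \<le> 2 * (norm (?V \<omega> i))\<^sup>2 + 2 * (norm (?Q i \<omega>))\<^sup>2"
          proof -
            have "0 \<le> (norm (?V \<omega> i) - norm (?Q i \<omega>))\<^sup>2" by simp
            then show ?thesis by (simp add: power2_diff power2_sum)
          qed
          finally show "(norm (?z i))\<^sup>2 \<le> 2 * (norm (?V \<omega> i))\<^sup>2 + 2 * (norm (?Q i \<omega>))\<^sup>2" .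
        qed
        also have "\<dots> = 2 * ?SV \<omega> + 2 * ?SQ \<omega>"
          using A by (simp add: sum.distrib sum_distrib_left)
        also have "\<dots> \<le> 2 * ?c + 2 * ?c"
          by (intro add_mono mult_left_mono) (use N sp in auto)
        also have "\<dots> = real n * R" by simp
        finally show "(\<Sum>i=1..n. (norm (partial_out n k (w \<omega>) (x \<omega>) i))\<^sup>2) \<le> real n * R" .
      qed
    qed
  qed
qed

end

section \<open>Asymptotics\<close>

lemma norm_matrix_le_sum: "norm (A :: real ^ 'd ^ 'e) \<le> (\<Sum>a\<in>UNIV. \<Sum>b\<in>UNIV. \<bar>A $ a $ b\<bar>)"
proof -
  have "norm A \<le> (\<Sum>a\<in>UNIV. norm (A $ a))"
    unfolding norm_vec_def[of A] by (rule L2_set_le_sum) simp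
  also have "\<dots> \<le> (\<Sum>a\<in>UNIV. \<Sum>b\<in>UNIV. \<bar>A $ a $ b\<bar>)"
    by (intro sum_mono norm_le_l1_cart)
  finally show ?thesis .
qed

section \<open>A tail bound at fixed n\<close>

context cluster_row
begin

text \<open>\<open>null_in_prob\<close> speaks of the measure of the favourable event, which is 0 if
  that event is not measurable. It is to be bounded through its complement, so measurability has to
  come first.\<close>

lemma deviation_measurable:
  assumes \<kappa>_meas: "\<And>p q. p \<in> idx G T \<Longrightarrow> q \<in> idx G T \<Longrightarrow> (\<lambda>z. \<kappa> z p q) \<in> borel_measurable (control_space n k)"
    and y: "\<And>i. i \<in> {1..n} \<Longrightarrow> (\<lambda>\<omega>. y \<omega> i) \<in> borel_measurable M"
  shows "(\<lambda>\<omega>. Sigma_hat n k (w \<omega>) (x \<omega>) (y \<omega>) G T (\<kappa> (w \<omega>))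
    - (1 / real n) *\<^sub>R
        (\<Sum>g1=1..G. \<Sum>g2=1..G. \<Sum>g3=1..G.
         \<Sum>i1\<in>T g1. \<Sum>j1\<in>T g1. \<Sum>i2\<in>T g2. \<Sum>j2\<in>T g2. \<Sum>i3\<in>T g3. \<Sum>j3\<in>T g3.
          (\<kappa> (w \<omega>) (g1, i1, j1) (g2, i2, j2) * annih n k (w \<omega>) i2 j3 * annih n k (w \<omega>) j2 i3
           * real_cond_exp M F (\<lambda>\<omega>. u \<omega> i3 * u \<omega> j3) \<omega>)
          *\<^sub>R outer (partial_out n k (w \<omega>) (x \<omega>) i1) (partial_out n k (w \<omega>) (x \<omega>) j1))) \<in> borel_measurable M"
proof -
  have idxI: "(g, i, j) \<in> idx G T" if "g \<in> {1..G}" "i \<in> T g" "j \<in> T g" for g i j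
    using that by (simp add: idx_def)
  have T_n: "i \<in> {1..n}" if "g \<in> {1..G}" "i \<in> T g" for g i using T_subset[OF that(1)] that(2) by (rule subsetD)
  have \<kappa>M: "(\<lambda>\<omega>. \<kappa> (w \<omega>) (g1, i1, j1) (g2, i2, j2)) \<in> borel_measurable M"
    if "g1 \<in> {1..G}" "g2 \<in> {1..G}" "i1 \<in> T g1" "j1 \<in> T g1" "i2 \<in> T g2" "j2 \<in> T g2" for g1 g2 i1 j1 i2 j2
    by (rule measurable_compose[OF w_rv \<kappa>_meas]) (intro idxI that)+
  have xM: "(\<lambda>\<omega>. x \<omega> i) \<in> borel_measurable M" if "i \<in> {1..n}" for i
    by (rule measurable_from_subalg[OF subalgebra_F xi_F[OF that]])
  have outerM: "(\<lambda>\<omega>. outer (partial_out n k (w \<omega>) (x \<omega>) i) (partial_out n k (w \<omega>) (x \<omega>) j)) \<in> borel_measurable M"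
    if "i \<in> {1..n}" "j \<in> {1..n}" for i j
    unfolding outer_def
    by (intro borel_measurable_vecI, unfold vec_lambda_beta)
       (intro borel_measurable_times borel_measurable_vec_nth partial_out_measurable[OF w_rv] that xM)
  show ?thesis
    unfolding Sigma_hat_def
    by (intro borel_measurable_diff borel_measurable_scaleR borel_measurable_const borel_measurable_sum
        borel_measurable_times \<kappa>M outerM residual_measurable[OF w_rv] annih_measurable[OF w_rv] borel_measurable_cond_exp2 xM y)
       (erule (1) T_n | assumption)+
qed

text \<open>A positive lower bound rules out the value 0 that \<open>measure\<close> takes on
  non-measurable sets. Measurability of the assumed events is thus extracted from the assumptions
  and needs no argument about the minima and maxima in their definitions.\<close>

lemma (in prob_space) measure_not_ge:
  assumes "1 - \<eta> \<le> measure M S" "\<eta> < 1"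
  shows "S \<in> sets M" "measure M (space M - S) \<le> \<eta>"
proof -
  show S: "S \<in> sets M" using assms measure_notin_sets[of S M] by force
  show "measure M (space M - S) \<le> \<eta>" using prob_compl[OF S] assms(1) by simp
qed

text \<open>The failure probability collects one \<open>\<eta>\<close> for each of the five assumed
  events, the exceptional set of \<open>residual_norm_prob\<close>, and the bound of
  \<open>deviation_prob\<close> at level \<open>\<epsilon>\<close> / d^2 for each of the d^2
  entries, d being the number of regressors. The bound on the inverse of \<open>Sigma_pop\<close> is
  used for the existence of that inverse.\<close>

lemma deviation_tail:
  assumes n0: "0 < n"
    and model: "\<And>i \<omega>. i \<in> {1..n} \<Longrightarrow> \<omega> \<in> space M \<Longrightarrow>
      y \<omega> i = \<beta> \<bullet> x \<omega> i + (\<Sum>a<k. \<gamma> a * w \<omega> i a) + u \<omega> i"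
    and x_int: "\<And>i. i \<in> {1..n} \<Longrightarrow> integrable M (\<lambda>\<omega>. x \<omega> i)"
    and ww_int: "\<And>i a. i \<in> {1..n} \<Longrightarrow> a < k \<Longrightarrow> integrable M (\<lambda>\<omega>. w \<omega> i a * w \<omega> i a)"
    and \<kappa>_meas: "\<And>p q. p \<in> idx G T \<Longrightarrow> q \<in> idx G T \<Longrightarrow> (\<lambda>z. \<kappa> z p q) \<in> borel_measurable (control_space n k)"
    and \<kappa>_sym: "\<And>z p q. z \<in> space (control_space n k) \<Longrightarrow> p \<in> idx G T \<Longrightarrow> q \<in> idx G T \<Longrightarrow> \<kappa> z p q = \<kappa> z q p"
    and exog: "\<And>i. i \<in> {1..n} \<Longrightarrow> AE \<omega> in M. real_cond_exp M F (\<lambda>\<omega>. u \<omega> i) \<omega> = 0"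
    and card_T: "\<And>g. g \<in> {1..G} \<Longrightarrow> real (card (T g)) \<le> m"
    and chi: "chi_pop M n k x w \<le> ennreal X" "0 \<le> X"
    and B: "0 \<le> Bm" "0 \<le> Bk" "Bm \<le> B" "Bk \<le> B" "0 < B"
    and \<eta>: "0 \<le> \<eta>" "\<eta> < 1" and s: "0 < s" and \<epsilon>: "0 < \<epsilon>"
    and S1: "1 - \<eta> \<le> measure M {\<omega> \<in> space M. moment_bound M n k x w u \<omega> \<le> ennreal Bm}"
    and S2: "1 - \<eta> \<le> measure M {\<omega> \<in> space M. norm_inverse (Sigma_pop M n k x w u \<omega>) \<le> ennreal Bs}"
    and S3: "1 - \<eta> \<le> measure M {\<omega> \<in> space M. ennreal (weights_norm G T (\<kappa> (w \<omega>))) \<le> ennreal Bk}"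
    and S4: "1 - \<eta> \<le> measure M {\<omega> \<in> space M. lambda_min_mat (gram n k (w \<omega>)) > 0}"
    and S5: "1 - \<eta> \<le> measure M {\<omega> \<in> space M.
      norm (Max ((\<lambda>i. norm (partial_out n k (w \<omega>) (x \<omega>) i)) ` {1..n}) / sqrt (real n)) \<le> s}"
  shows "measure M {\<omega> \<in> space M. norm (Sigma_hat n k (w \<omega>) (x \<omega>) (y \<omega>) G T (\<kappa> (w \<omega>))
    - (1 / real n) *\<^sub>R
        (\<Sum>g1=1..G. \<Sum>g2=1..G. \<Sum>g3=1..G.
         \<Sum>i1\<in>T g1. \<Sum>j1\<in>T g1. \<Sum>i2\<in>T g2. \<Sum>j2\<in>T g2. \<Sum>i3\<in>T g3. \<Sum>j3\<in>T g3.
          (\<kappa> (w \<omega>) (g1, i1, j1) (g2, i2, j2) * annih n k (w \<omega>) i2 j3 * annih n k (w \<omega>) j2 i3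
           * real_cond_exp M F (\<lambda>\<omega>. u \<omega> i3 * u \<omega> j3) \<omega>)
          *\<^sub>R outer (partial_out n k (w \<omega>) (x \<omega>) i1) (partial_out n k (w \<omega>) (x \<omega>) j1))) \<le> \<epsilon>}
    \<ge> 1 - (5 * \<eta> + (4 * (1 + Bm) + 4 * X) / B
      + (real CARD('d))\<^sup>2 *
        ((s * (m * ((1 + B) * (m * B\<^sup>2))) + (s + s\<^sup>2) * (m * B * (m * ((1 + B) * real CARD('d))))) / (\<epsilon> / (real CARD('d))\<^sup>2 / 2)
        + s\<^sup>2 * (2 * m\<^sup>2 * ((2 * B + 2 * (1 + (B + B))\<^sup>2) * (B * (m * B\<^sup>2)))) / (\<epsilon> / (real CARD('d))\<^sup>2 / 2)\<^sup>2))"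
    (is "measure M {\<omega> \<in> space M. norm (?D \<omega>) \<le> \<epsilon>} \<ge> 1 - (5 * \<eta> + ?q + ?d2 * ?b)")
proof -
  let ?v = "\<lambda>\<omega> i. partial_out n k (w \<omega>) (x \<omega>) i"
  let ?S1 = "{\<omega> \<in> space M. moment_bound M n k x w u \<omega> \<le> ennreal Bm}"
  let ?S2 = "{\<omega> \<in> space M. norm_inverse (Sigma_pop M n k x w u \<omega>) \<le> ennreal Bs}"
  let ?S3 = "{\<omega> \<in> space M. ennreal (weights_norm G T (\<kappa> (w \<omega>))) \<le> ennreal Bk}"
  let ?S4 = "{\<omega> \<in> space M. lambda_min_mat (gram n k (w \<omega>)) > 0}"
  let ?S5 = "{\<omega> \<in> space M. norm (Max ((\<lambda>i. norm (?v \<omega> i)) ` {1..n}) / sqrt (real n)) \<le> s}"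
  let ?H = "\<lambda>\<omega>. \<Sum>i=1..n. outer (?v \<omega> i) (?v \<omega> i)"
  \<comment> \<open>E has to lie in F, while the assumed events are only known to be measurable in
    M. It is therefore assembled from six conditions whose F-measurability can be checked and which
    follow from those events outside N, up to null sets.\<close>
  define E1 where "E1 = {\<omega> \<in> space F. \<forall>i\<in>{1..n}. nn_cond_exp M F (\<lambda>\<omega>. ennreal (u \<omega> i ^ 4)) \<omega> \<le> ennreal B}"
  define E2 where "E2 = {\<omega> \<in> space F. \<forall>p\<in>idx G T. (\<Sum>q\<in>idx G T. \<bar>\<kappa> (w \<omega>) p q\<bar>) \<le> B}"
  define E3 where "E3 = {\<omega> \<in> space F. Determinant.det (gram n k (w \<omega>)) \<noteq> 0}"
  define E4 where "E4 = {\<omega> \<in> space F. invertible (?H \<omega>)}"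
  define E5 where "E5 = {\<omega> \<in> space F. \<forall>i\<in>{1..n}. (norm (?v \<omega> i))\<^sup>2 \<le> real n * s\<^sup>2}"
  define E6 where "E6 = {\<omega> \<in> space F. (\<Sum>i=1..n. (norm (?v \<omega> i))\<^sup>2) \<le> real n * B}"
  have v_F: "(\<lambda>\<omega>. ?v \<omega> i) \<in> borel_measurable F" if "i \<in> {1..n}" for i
    by (rule partial_out_measurable[OF w_F that xi_F])
  have fin_idx: "finite (idx G T)" unfolding idx_def using finite_T by auto
  have E1_F: "E1 \<in> sets F" unfolding E1_def by measurable
  have E2_F: "E2 \<in> sets F" unfolding E2_def
  proof (rule sets.sets_Collect_finite_All[OF _ fin_idx])
    fix p assume p: "p \<in> idx G T"
    have "(\<lambda>\<omega>. \<Sum>q\<in>idx G T. \<bar>\<kappa> (w \<omega>) p q\<bar>) \<in> borel_measurable F"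
      by (intro borel_measurable_sum borel_measurable_abs measurable_compose[OF w_F \<kappa>_meas] p)
    then show "{\<omega> \<in> space F. (\<Sum>q\<in>idx G T. \<bar>\<kappa> (w \<omega>) p q\<bar>) \<le> B} \<in> sets F" by measurable
  qed
  have E3_F: "E3 \<in> sets F" unfolding E3_def using det_gram_measurable[OF w_F] by measurable
  have E4_F: "E4 \<in> sets F"
    unfolding E4_def using pred_invertible[OF H_component_measurable[OF w_F xi_F]] by (simp add: pred_def)
  have E5_F: "E5 \<in> sets F" unfolding E5_def
  proof (rule sets.sets_Collect_finite_All)
    fix i assume "i \<in> {1..n}"
    then show "{\<omega> \<in> space F. (norm (?v \<omega> i))\<^sup>2 \<le> real n * s\<^sup>2} \<in> sets F" using v_F[of i] by measurable
  qed simp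
  have E6_F: "E6 \<in> sets F"
  proof -
    have "(\<lambda>\<omega>. (norm (?v \<omega> i))\<^sup>2) \<in> borel_measurable F" if "i \<in> {1..n}" for i
      using v_F[OF that] by measurable
    then have "(\<lambda>\<omega>. \<Sum>i=1..n. (norm (?v \<omega> i))\<^sup>2) \<in> borel_measurable F"
      by (rule borel_measurable_sum)
    then show ?thesis unfolding E6_def by measurable
  qed
  define E where "E = E1 \<inter> E2 \<inter> E3 \<inter> E4 \<inter> E5 \<inter> E6"
  have E_F: "E \<in> sets F" unfolding E_def using E1_F E2_F E3_F E4_F E5_F E6_F by (intro sets.Int)
  have E_M: "E \<in> sets M" using E_F subalgebra_F by (auto simp: subalgebra_def)
  have EE: "\<omega> \<in> E1" "\<omega> \<in> E2" "\<omega> \<in> E3" "\<omega> \<in> E4" "\<omega> \<in> E5" "\<omega> \<in> E6" if "\<omega> \<in> E" for \<omega>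
    using that unfolding E_def by blast+
  interpret wr: weighted_row M n k G T x w u E B m y \<kappa> \<beta> \<gamma> "s\<^sup>2"
  proof unfold_locales
    fix \<omega> i assume "\<omega> \<in> E" "i \<in> {1..n}"
    then show "nn_cond_exp M F (\<lambda>\<omega>. ennreal (u \<omega> i ^ 4)) \<omega> \<le> ennreal B"
      "(norm (?v \<omega> i))\<^sup>2 \<le> real n * s\<^sup>2"
      using EE(1,5)[of \<omega>] unfolding E1_def E5_def by blast+
  next
    fix \<omega> assume "\<omega> \<in> E"
    from EE(3,4,6)[OF this] show "Determinant.det (gram n k (w \<omega>)) \<noteq> 0" "invertible (?H \<omega>)"
      "(\<Sum>i=1..n. (norm (?v \<omega> i))\<^sup>2) \<le> real n * B"
      unfolding E3_def E4_def E6_def by blast+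
  next
    fix \<omega> p assume "\<omega> \<in> E" "p \<in> idx G T"
    with EE(2)[of \<omega>] show "(\<Sum>q\<in>idx G T. \<bar>\<kappa> (w \<omega>) p q\<bar>) \<le> B" unfolding E2_def by blast
  qed (use B s n0 in \<open>simp_all add: E_F exog card_T model \<kappa>_meas \<kappa>_sym del: One_nat_def\<close>)
  have E15: "E1 \<inter> E5 \<in> sets F" using E1_F E5_F by (rule sets.Int)
  \<comment> \<open>Membership in E4 is what \<open>invertible_H\<close> has to produce, so it is
    applied on E1 \<inter> E5, where the fourth moments and the v i are bounded, and not on
    E.\<close>
  interpret inv: clustered_errors M n k G T x w u "E1 \<inter> E5" B m
  proof unfold_locales
    fix \<omega> i assume "\<omega> \<in> E1 \<inter> E5" "i \<in> {1..n}"
    then show "nn_cond_exp M F (\<lambda>\<omega>. ennreal (u \<omega> i ^ 4)) \<omega> \<le> ennreal B" unfolding E1_def by blast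
  qed (use B in \<open>simp_all add: E15 exog card_T del: One_nat_def\<close>)
  have aeH: "AE \<omega> in M. \<omega> \<in> E1 \<inter> E5 \<longrightarrow> invertible (Sigma_pop M n k x w u \<omega>) \<longrightarrow> invertible (?H \<omega>)"
  proof (rule inv.invertible_H)
    fix \<omega> i assume "\<omega> \<in> E1 \<inter> E5" "i \<in> {1..n}"
    then have "(norm (?v \<omega> i))\<^sup>2 \<le> real n * s\<^sup>2" unfolding E5_def by blast
    from real_le_rsqrt[OF this] show "norm (?v \<omega> i) \<le> sqrt (real n * s\<^sup>2)" .
  qed
  obtain N where N: "N \<in> sets M" "measure M N \<le> ?q"
    and aeN: "AE \<omega> in M. \<omega> \<in> {\<omega> \<in> space M. \<forall>i\<in>{1..n}. nn_cond_exp M W (\<lambda>\<omega>. ennreal (norm (V_dev M n k x w \<omega> i) ^ 4)) \<omega> \<le> ennreal Bm}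
      \<longrightarrow> \<omega> \<notin> N \<longrightarrow> Determinant.det (gram n k (w \<omega>)) \<noteq> 0 \<longrightarrow> (\<Sum>i=1..n. (norm (?v \<omega> i))\<^sup>2) \<le> real n * B"
    by (rule residual_norm_prob[OF x_int ww_int n0 B(5) B(1) chi(2) chi(1)])
  have good: "AE \<omega> in M. \<omega> \<in> space M - E \<longrightarrow> \<omega> \<in> ((((space M - ?S1) \<union> (space M - ?S2)) \<union> (space M - ?S3)) \<union> (space M - ?S4)) \<union> (space M - ?S5) \<union> N"
    using aeH aeN
  proof eventually_elim
    case (elim \<omega>)
    show ?case
    proof (rule impI, rule ccontr)
      assume sp: "\<omega> \<in> space M - E" and "\<omega> \<notin> ((((space M - ?S1) \<union> (space M - ?S2)) \<union> (space M - ?S3)) \<union> (space M - ?S4)) \<union> (space M - ?S5) \<union> N"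
      then have mem: "moment_bound M n k x w u \<omega> \<le> ennreal Bm" "norm_inverse (Sigma_pop M n k x w u \<omega>) \<le> ennreal Bs"
        "ennreal (weights_norm G T (\<kappa> (w \<omega>))) \<le> ennreal Bk" "lambda_min_mat (gram n k (w \<omega>)) > 0"
        "norm (Max ((\<lambda>i. norm (?v \<omega> i)) ` {1..n}) / sqrt (real n)) \<le> s" "\<omega> \<notin> N"
        and spM: "\<omega> \<in> space M" by blast+
      then have spF: "\<omega> \<in> space F" by (simp only: spaces)
      \<comment> \<open>All terms of \<open>moment_bound\<close> are nonnegative extended reals, so
        a bound on the whole bounds each of them.\<close>
      have mom: "nn_cond_exp M F (\<lambda>\<omega>. ennreal (u \<omega> i ^ 4)) \<omega> \<le> ennreal Bm \<and>
          nn_cond_exp M W (\<lambda>\<omega>. ennreal (norm (V_dev M n k x w \<omega> i) ^ 4)) \<omega> \<le> ennreal Bm" if i: "i \<in> {1..n}" for i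
      proof -
        let ?f = "\<lambda>i. nn_cond_exp M F (\<lambda>\<omega>. ennreal (u \<omega> i ^ 4)) \<omega>
          + nn_cond_exp M W (\<lambda>\<omega>. ennreal (norm (V_dev M n k x w \<omega> i) ^ 4)) \<omega>
          + 1 / nn_cond_exp M F (\<lambda>\<omega>. ennreal ((u \<omega> i)\<^sup>2)) \<omega>"
        have "?f i \<le> Max (?f ` {1..n})" by (rule Max_ge) (use i in auto)
        also have "\<dots> \<le> ennreal Bm"
          by (rule order.trans[OF _ mem(1)]) (unfold moment_bound_def, rule add_increasing2, simp, rule order.refl)
        finally have "?f i \<le> ennreal Bm" .
        moreover have "nn_cond_exp M F (\<lambda>\<omega>. ennreal (u \<omega> i ^ 4)) \<omega> \<le> ?f i"
          "nn_cond_exp M W (\<lambda>\<omega>. ennreal (norm (V_dev M n k x w \<omega> i) ^ 4)) \<omega> \<le> ?f i"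
          by (auto intro: add_increasing add_increasing2)
        ultimately show ?thesis by (meson order.trans)
      qed
      have 1: "\<omega> \<in> E1"
        unfolding E1_def using mom ennreal_leI[OF B(3)] spF by (blast intro: order.trans)
      have 2: "\<omega> \<in> E2" unfolding E2_def
      proof (intro CollectI conjI ballI spF)
        fix p assume p: "p \<in> idx G T"
        have "(\<Sum>q\<in>idx G T. \<bar>\<kappa> (w \<omega>) p q\<bar>) = (\<Sum>g2=1..G. \<Sum>i2\<in>T g2. \<Sum>j2\<in>T g2. \<bar>\<kappa> (w \<omega>) p (g2, i2, j2)\<bar>)"
          by (rule wr.sum_idx[symmetric])
        also have "\<dots> \<le> weights_norm G T (\<kappa> (w \<omega>))"
          unfolding weights_norm_def by (rule Max_ge) (use p fin_idx in auto)
        also have "\<dots> \<le> Bk" using mem(3) B(2) by (simp add: ennreal_le_iff)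
        finally show "(\<Sum>q\<in>idx G T. \<bar>\<kappa> (w \<omega>) p q\<bar>) \<le> B" using B(4) by simp
      qed
      have det: "Determinant.det (gram n k (w \<omega>)) \<noteq> 0" by (rule lambda_min_mat_pos_det[OF gram_carrier mem(4)])
      have 3: "\<omega> \<in> E3" unfolding E3_def using det spF by simp
      have 5: "\<omega> \<in> E5" unfolding E5_def
      proof (intro CollectI conjI ballI spF)
        fix i assume i: "i \<in> {1..n}"
        let ?m = "Max ((\<lambda>i. norm (?v \<omega> i)) ` {1..n})"
        have le: "norm (?v \<omega> i) \<le> ?m" by (rule Max_ge) (use i in auto)
        have "?m / sqrt (real n) \<le> s" using mem(5) unfolding real_norm_def by (rule abs_le_D1)
        then have "?m \<le> s * sqrt (real n)" using n0 by (simp add: pos_divide_le_eq)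
        with le have "norm (?v \<omega> i) \<le> s * sqrt (real n)" by (rule order.trans)
        from power_mono[OF this norm_ge_zero, of 2]
        show "(norm (?v \<omega> i))\<^sup>2 \<le> real n * s\<^sup>2" by (simp add: power_mult_distrib mult.commute)
      qed
      \<comment> \<open>A finite value of \<open>norm_inverse\<close> means invertibility, the
        singular case having been given the value infinity.\<close>
      have "invertible (Sigma_pop M n k x w u \<omega>)"
        using mem(2) by (auto simp: norm_inverse_def top_unique split: if_splits)
      then have 4: "\<omega> \<in> E4" unfolding E4_def using elim(1) 1 5 spF by blast
      have 6: "\<omega> \<in> E6" unfolding E6_def using elim(2) mom mem(6) det spM spF by blast
      show False using sp 1 2 3 4 5 6 unfolding E_def by blast
    qed
  qed
  note n1 = measure_not_ge[OF S1 \<eta>(2)] and n2 = measure_not_ge[OF S2 \<eta>(2)] and n3 = measure_not_ge[OF S3 \<eta>(2)]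
    and n4 = measure_not_ge[OF S4 \<eta>(2)] and n5 = measure_not_ge[OF S5 \<eta>(2)]
  note c = sets.compl_sets[OF n1(1)] sets.compl_sets[OF n2(1)] sets.compl_sets[OF n3(1)]
    sets.compl_sets[OF n4(1)] sets.compl_sets[OF n5(1)]
  have "measure M (space M - E) \<le> measure M (((((space M - ?S1) \<union> (space M - ?S2)) \<union> (space M - ?S3)) \<union> (space M - ?S4)) \<union> (space M - ?S5) \<union> N)"
    by (rule finite_measure_mono_AE[OF good]) (intro sets.Un c N(1))
  also have "\<dots> \<le> ((((\<eta> + \<eta>) + \<eta>) + \<eta>) + \<eta>) + ?q"
    by (intro order.trans[OF measure_Un_le] add_mono sets.Un c N n1(2) n2(2) n3(2) n4(2) n5(2))
  finally have notE: "measure M (space M - E) \<le> 5 * \<eta> + ?q" by simp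
  \<comment> \<open>Measurability of the outcomes is inherited from the model equation, which holds
    on \<open>space M\<close>.\<close>
  have y_M: "(\<lambda>\<omega>. y \<omega> i) \<in> borel_measurable M" if i: "i \<in> {1..n}" for i
  proof -
    have "(\<lambda>\<omega>. \<beta> \<bullet> x \<omega> i + (\<Sum>a<k. \<gamma> a * w \<omega> i a) + u \<omega> i) \<in> borel_measurable M"
      using i by (intro borel_measurable_add borel_measurable_inner borel_measurable_sum borel_measurable_times
          borel_measurable_const measurable_from_subalg[OF subalgebra_F xi_F] control_component[OF w_rv] ui_rv) auto
    then show ?thesis by (rule measurable_cong[THEN iffD1, rotated]) (simp add: model[OF i])
  qed
  have D_M [measurable]: "?D \<in> borel_measurable M" by (rule deviation_measurable[OF \<kappa>_meas y_M])
  have D_eq: "?D \<omega> = wr.deviation \<omega>" for \<omega>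
    unfolding wr.deviation_def wr.target_def ..
  let ?e = "\<epsilon> / (real CARD('d))\<^sup>2"
  have e0: "0 < ?e" using \<epsilon> by simp
  let ?I = "UNIV \<times> UNIV :: ('d \<times> 'd) set"
  let ?A = "\<lambda>p. {\<omega> \<in> E. ?e < \<bar>wr.deviation \<omega> $ fst p $ snd p\<bar>}"
  have A_M: "?A p \<in> sets M" for p
  proof -
    have m: "(\<lambda>\<omega>. ?D \<omega> $ fst p $ snd p) \<in> borel_measurable M"
      by (intro borel_measurable_vec_nth D_M)
    have "?A p = E \<inter> {\<omega> \<in> space M. ?e < \<bar>?D \<omega> $ fst p $ snd p\<bar>}"
      using sets.sets_into_space[OF E_M] unfolding D_eq by blast
    also have "\<dots> \<in> sets M" using m by (intro sets.Int E_M) measurable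
    finally show ?thesis .
  qed
  have sub: "space M - {\<omega> \<in> space M. norm (?D \<omega>) \<le> \<epsilon>} \<subseteq> (space M - E) \<union> (\<Union>p\<in>?I. ?A p)"
  proof
    fix \<omega> assume "\<omega> \<in> space M - {\<omega> \<in> space M. norm (?D \<omega>) \<le> \<epsilon>}"
    then have sp: "\<omega> \<in> space M" and big: "\<not> norm (wr.deviation \<omega>) \<le> \<epsilon>" unfolding D_eq by blast+
    show "\<omega> \<in> (space M - E) \<union> (\<Union>p\<in>?I. ?A p)"
    proof (rule ccontr)
      assume no: "\<omega> \<notin> (space M - E) \<union> (\<Union>p\<in>?I. ?A p)"
      have le: "\<bar>wr.deviation \<omega> $ a $ b\<bar> \<le> ?e" for a b
      proof (rule ccontr)
        assume "\<not> \<bar>wr.deviation \<omega> $ a $ b\<bar> \<le> ?e"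
        then have "\<omega> \<in> ?A (a, b)" using no sp by (simp add: not_le)
        then show False using no by blast
      qed
      have "norm (wr.deviation \<omega>) \<le> (\<Sum>a\<in>UNIV. \<Sum>b\<in>UNIV. \<bar>wr.deviation \<omega> $ a $ b\<bar>)" by (rule norm_matrix_le_sum)
      also have "\<dots> \<le> (\<Sum>a\<in>(UNIV::'d set). \<Sum>b\<in>(UNIV::'d set). ?e)" by (intro sum_mono le)
      also have "\<dots> = \<epsilon>" by (simp add: power2_eq_square)
      finally show False using big by blast
    qed
  qed
  have "measure M (space M - {\<omega> \<in> space M. norm (?D \<omega>) \<le> \<epsilon>}) \<le> measure M ((space M - E) \<union> (\<Union>p\<in>?I. ?A p))"
    by (rule finite_measure_mono[OF sub]) (intro sets.Un sets.compl_sets E_M sets.finite_UN A_M finite)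
  also have "\<dots> \<le> measure M (space M - E) + measure M (\<Union>p\<in>?I. ?A p)"
    by (intro measure_Un_le sets.compl_sets E_M sets.finite_UN A_M finite)
  also have "measure M (\<Union>p\<in>?I. ?A p) \<le> (\<Sum>p\<in>?I. measure M (?A p))"
    by (rule measure_UNION_le[OF finite A_M])
  also have "\<dots> \<le> (\<Sum>p\<in>?I. ?b)"
    by (rule sum_mono, rule wr.deviation_prob[OF s refl e0])
  also have "\<dots> = ?d2 * ?b" by (simp only: sum_constant card_cartesian_product of_nat_mult power2_eq_square)
  finally have le: "measure M (space M - {\<omega> \<in> space M. norm (?D \<omega>) \<le> \<epsilon>}) \<le> measure M (space M - E) + ?d2 * ?b"
    by (simp only: add_le_cancel_left)
  have "{\<omega> \<in> space M. norm (?D \<omega>) \<le> \<epsilon>} \<in> sets M" by measurable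
  from prob_compl[OF this] le notE show ?thesis by argo
qed

end

section \<open>Passage to the limit along the array\<close>

theorem theorem2:
  fixes M :: "nat \<Rightarrow> 'a measure"
    and K G :: "nat \<Rightarrow> nat"
    and T :: "nat \<Rightarrow> nat \<Rightarrow> nat set"
    and x :: "nat \<Rightarrow> 'a \<Rightarrow> nat \<Rightarrow> real ^ 'd"
    and w :: "nat \<Rightarrow> 'a \<Rightarrow> nat \<Rightarrow> nat \<Rightarrow> real"
    and y u :: "nat \<Rightarrow> 'a \<Rightarrow> nat \<Rightarrow> real"
    and \<beta> :: "real ^ 'd" and \<gamma> :: "nat \<Rightarrow> nat \<Rightarrow> real"
    and \<kappa> :: "nat \<Rightarrow> (nat \<Rightarrow> nat \<Rightarrow> real) \<Rightarrow> weights"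
  assumes prob: "\<And>n. prob_space (M n)"
    and K_pos: "\<And>n. 0 < K n"
    and x_rv: "\<And>n. x n \<in> measurable (M n) (Pi\<^sub>M {1..n} (\<lambda>_. borel))"
    and w_rv: "\<And>n. w n \<in> measurable (M n) (control_space n (K n))"
    and u_rv: "\<And>n. u n \<in> measurable (M n) (Pi\<^sub>M {1..n} (\<lambda>_. borel))"
    and model: "\<And>n i \<omega>. i \<in> {1..n} \<Longrightarrow> \<omega> \<in> space (M n) \<Longrightarrow>
      y n \<omega> i = \<beta> \<bullet> x n \<omega> i + (\<Sum>a<K n. \<gamma> n a * w n \<omega> i a) + u n \<omega> i"
    and u_integrable: "\<And>n i. i \<in> {1..n} \<Longrightarrow> integrable (M n) (\<lambda>\<omega>. u n \<omega> i)"
    and x_integrable: "\<And>n i. i \<in> {1..n} \<Longrightarrow> integrable (M n) (\<lambda>\<omega>. x n \<omega> i)"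
    and xw_integrable: "\<And>n i c a. i \<in> {1..n} \<Longrightarrow> a < K n \<Longrightarrow>
      integrable (M n) (\<lambda>\<omega>. x n \<omega> i $ c * w n \<omega> i a)"
    and ww_integrable: "\<And>n i a b. i \<in> {1..n} \<Longrightarrow> a < K n \<Longrightarrow> b < K n \<Longrightarrow>
      integrable (M n) (\<lambda>\<omega>. w n \<omega> i a * w n \<omega> i b)"
    and \<kappa>_measurable: "\<And>n p q. p \<in> idx (G n) (T n) \<Longrightarrow> q \<in> idx (G n) (T n) \<Longrightarrow>
      (\<lambda>z. \<kappa> n z p q) \<in> borel_measurable (control_space n (K n))"
    and \<kappa>_symmetric: "\<And>n z p q. z \<in> space (control_space n (K n)) \<Longrightarrow>
      p \<in> idx (G n) (T n) \<Longrightarrow> q \<in> idx (G n) (T n) \<Longrightarrow> \<kappa> n z p q = \<kappa> n z q p"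
    and partition: "\<And>n. partition_on {1..n} (T n ` {1..G n})" "\<And>n. inj_on (T n) {1..G n}"
    and cluster_indep: "\<And>n. cond_indep_vars (M n) (sigma_W (M n) n (K n) (w n))
      (\<lambda>g. Pi\<^sub>M (T n g) (\<lambda>_. borel)) (\<lambda>g \<omega>. \<lambda>i\<in>T n g. (u n \<omega> i, x n \<omega> i)) {1..G n}"
    and cluster_size: "(\<lambda>n. real (Max ((\<lambda>g. card (T n g)) ` {1..G n}))) \<in> O(\<lambda>_. 1)"
    and gram_pos: "(\<lambda>n. measure (M n)
      {\<omega>\<in>space (M n). lambda_min_mat (gram n (K n) (w n \<omega>)) > 0}) \<longlonglongrightarrow> 1"
    and dim_ratio: "limsup (\<lambda>n. ereal (real (K n) / real n)) < 1"
    and moments: "bounded_in_prob M (\<lambda>n. moment_bound (M n) n (K n) (x n) (w n) (u n))"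
    and Sigma_inv: "bounded_in_prob M
      (\<lambda>n \<omega>. norm_inverse (Sigma_pop (M n) n (K n) (x n) (w n) (u n) \<omega>))"
    and exogeneity: "\<And>n i. i \<in> {1..n} \<Longrightarrow>
      AE \<omega> in M n. real_cond_exp (M n) (sigma_XW (M n) n (K n) (x n) (w n)) (\<lambda>\<omega>. u n \<omega> i) \<omega> = 0"
    and chi_bounded: "\<exists>B::real. \<forall>\<^sub>F n in sequentially. chi_pop (M n) n (K n) (x n) (w n) \<le> ennreal B"
    and leverage: "null_in_prob M
      (\<lambda>n \<omega>. Max ((\<lambda>i. norm (partial_out n (K n) (w n \<omega>) (x n \<omega>) i)) ` {1..n}) / sqrt (real n))"
    and \<kappa>_bounded: "bounded_in_prob M
      (\<lambda>n \<omega>. ennreal (weights_norm (G n) (T n) (\<kappa> n (w n \<omega>))))"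
  shows "null_in_prob M (\<lambda>n \<omega>.
    Sigma_hat n (K n) (w n \<omega>) (x n \<omega>) (y n \<omega>) (G n) (T n) (\<kappa> n (w n \<omega>))
    - (1 / real n) *\<^sub>R
        (\<Sum>g1=1..G n. \<Sum>g2=1..G n. \<Sum>g3=1..G n.
         \<Sum>i1\<in>T n g1. \<Sum>j1\<in>T n g1. \<Sum>i2\<in>T n g2. \<Sum>j2\<in>T n g2. \<Sum>i3\<in>T n g3. \<Sum>j3\<in>T n g3.
          (\<kappa> n (w n \<omega>) (g1, i1, j1) (g2, i2, j2)
           * annih n (K n) (w n \<omega>) i2 j3 * annih n (K n) (w n \<omega>) j2 i3
           * real_cond_exp (M n) (sigma_XW (M n) n (K n) (x n) (w n))
               (\<lambda>\<omega>. u n \<omega> i3 * u n \<omega> j3) \<omega>)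
          *\<^sub>R outer (partial_out n (K n) (w n \<omega>) (x n \<omega>) i1)
                    (partial_out n (K n) (w n \<omega>) (x n \<omega>) j1)))"
proof -
  have eventually_good: "\<forall>\<^sub>F n in sequentially. measure (M n) {\<omega> \<in> space (M n). norm (
    Sigma_hat n (K n) (w n \<omega>) (x n \<omega>) (y n \<omega>) (G n) (T n) (\<kappa> n (w n \<omega>))
    - (1 / real n) *\<^sub>R
        (\<Sum>g1=1..G n. \<Sum>g2=1..G n. \<Sum>g3=1..G n.
         \<Sum>i1\<in>T n g1. \<Sum>j1\<in>T n g1. \<Sum>i2\<in>T n g2. \<Sum>j2\<in>T n g2. \<Sum>i3\<in>T n g3. \<Sum>j3\<in>T n g3.
          (\<kappa> n (w n \<omega>) (g1, i1, j1) (g2, i2, j2)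
           * annih n (K n) (w n \<omega>) i2 j3 * annih n (K n) (w n \<omega>) j2 i3
           * real_cond_exp (M n) (sigma_XW (M n) n (K n) (x n) (w n))
               (\<lambda>\<omega>. u n \<omega> i3 * u n \<omega> j3) \<omega>)
          *\<^sub>R outer (partial_out n (K n) (w n \<omega>) (x n \<omega>) i1)
                    (partial_out n (K n) (w n \<omega>) (x n \<omega>) j1))) \<le> \<epsilon>} \<ge> 1 - \<zeta>"
    (is "\<forall>\<^sub>F n in sequentially. ?P n \<ge> 1 - \<zeta>")
    if \<epsilon>: "0 < \<epsilon>" and \<zeta>: "0 < \<zeta>" "\<zeta> < 1" for \<epsilon> \<zeta>
  proof -
    \<comment> \<open>Seven contributions share \<open>\<zeta>\<close>: five assumed events, the
      exceptional set for the square sum of the v i, and the moment bounds over all entries.\<close>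
    define \<eta> where "\<eta> = \<zeta> / 7"
    have \<eta>: "0 < \<eta>" "0 \<le> \<eta>" "\<eta> < 1" using \<zeta> by (simp_all add: \<eta>_def)
    obtain b1 where b1: "\<forall>\<^sub>F n in sequentially. 1 - \<eta> \<le> measure (M n)
        {\<omega>\<in>space (M n). moment_bound (M n) n (K n) (x n) (w n) (u n) \<omega> \<le> ennreal b1}"
      using moments \<eta>(1) unfolding bounded_in_prob_def by blast
    obtain b2 where b2: "\<forall>\<^sub>F n in sequentially. 1 - \<eta> \<le> measure (M n)
        {\<omega>\<in>space (M n). norm_inverse (Sigma_pop (M n) n (K n) (x n) (w n) (u n) \<omega>) \<le> ennreal b2}"
      using Sigma_inv \<eta>(1) unfolding bounded_in_prob_def by blast
    obtain b3 where b3: "\<forall>\<^sub>F n in sequentially. 1 - \<eta> \<le> measure (M n)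
        {\<omega>\<in>space (M n). ennreal (weights_norm (G n) (T n) (\<kappa> n (w n \<omega>))) \<le> ennreal b3}"
      using \<kappa>_bounded \<eta>(1) unfolding bounded_in_prob_def by blast
    obtain b4 where b4: "\<forall>\<^sub>F n in sequentially. chi_pop (M n) n (K n) (x n) (w n) \<le> ennreal b4"
      using chi_bounded by blast
    obtain m where m: "\<forall>\<^sub>F n in sequentially. norm (real (Max ((\<lambda>g. card (T n g)) ` {1..G n}))) \<le> m * norm (1::real)"
      using cluster_size by (rule landau_o.bigE)
    \<comment> \<open>A negative bound acts like 0 after conversion to \<open>ennreal\<close>, so
      all bounds may be taken nonnegative.\<close>
    have clip: "ennreal (max b 0) = ennreal b" for b by (simp add: max_def ennreal_neg)
    define Bm where "Bm = max b1 0"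
    define Bk where "Bk = max b3 0"
    define X where "X = max b4 0"
    \<comment> \<open>The last summand makes the exceptional probability (4 (1 + Bm) + 4 X) / B at
      most \<open>\<eta>\<close>, and the summand 1 makes B positive.\<close>
    define B where "B = Bm + Bk + 1 + (4 * (1 + Bm) + 4 * X) / \<eta>"
    have nn: "0 \<le> Bm" "0 \<le> Bk" "0 \<le> X" by (simp_all add: Bm_def Bk_def X_def)
    have q0: "0 \<le> (4 * (1 + Bm) + 4 * X) / \<eta>" using nn \<eta> by simp
    have B: "Bm \<le> B" "Bk \<le> B" "0 < B" "(4 * (1 + Bm) + 4 * X) / \<eta> \<le> B"
      using nn q0 by (simp_all add: B_def)
    have Bq: "(4 * (1 + Bm) + 4 * X) / B \<le> \<eta>" using B(3,4) \<eta>(1) by (simp add: pos_divide_le_eq mult.commute)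
    let ?d2 = "(real CARD('d))\<^sup>2"
    let ?b = "\<lambda>s. ?d2 *
        ((s * (m * ((1 + B) * (m * B\<^sup>2))) + (s + s\<^sup>2) * (m * B * (m * ((1 + B) * real CARD('d))))) / (\<epsilon> / ?d2 / 2)
        + s\<^sup>2 * (2 * m\<^sup>2 * ((2 * B + 2 * (1 + (B + B))\<^sup>2) * (B * (m * B\<^sup>2)))) / (\<epsilon> / ?d2 / 2)\<^sup>2)"
    \<comment> \<open>B and m are fixed by now, and ?b is a polynomial in s without constant term. A
      small positive s therefore brings it below \<open>\<eta>\<close>, and the leverage assumption
      is then invoked for this s.\<close>
    have "isCont ?b 0" using \<epsilon> by (intro continuous_intros) auto
    then have "(?b \<longlongrightarrow> ?b 0) (at_right 0)" unfolding isCont_def by (rule tendsto_mono[rotated]) (rule at_le, simp)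
    then have "(?b \<longlongrightarrow> 0) (at_right 0)" by simp
    from order_tendstoD(2)[OF this \<eta>(1)] obtain r where r: "0 < r" "\<And>s. 0 < s \<Longrightarrow> s < r \<Longrightarrow> ?b s < \<eta>"
      unfolding eventually_at_right_field by blast
    define s where "s = r / 2"
    have s: "0 < s" "?b s \<le> \<eta>" using r(1) r(2)[of s] by (simp_all add: s_def)
    have lev: "\<forall>\<^sub>F n in sequentially. 1 - \<eta> < measure (M n) {\<omega> \<in> space (M n).
        norm (Max ((\<lambda>i. norm (partial_out n (K n) (w n \<omega>) (x n \<omega>) i)) ` {1..n}) / sqrt (real n)) \<le> s}"
      using leverage s(1) \<eta>(1) unfolding null_in_prob_def by (intro order_tendstoD(1)) auto
    have gp: "\<forall>\<^sub>F n in sequentially. 1 - \<eta> < measure (M n) {\<omega>\<in>space (M n). lambda_min_mat (gram n (K n) (w n \<omega>)) > 0}"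
      using \<eta>(1) by (intro order_tendstoD(1)[OF gram_pos]) simp
    show ?thesis
      using b1 b2 b3 b4 m lev gp eventually_gt_at_top[of 0]
    proof eventually_elim
      case (elim n)
      interpret prob_space "M n" by (rule prob)
      interpret cluster_row "M n" n "K n" "G n" "T n" "x n" "w n" "u n"
        by unfold_locales (rule x_rv w_rv u_rv partition cluster_indep)+
      have card: "real (card (T n g)) \<le> m" if g: "g \<in> {1..G n}" for g
      proof -
        have "card (T n g) \<le> Max ((\<lambda>g. card (T n g)) ` {1..G n})" by (rule Max_ge) (use g in auto)
        then have "real (card (T n g)) \<le> real (Max ((\<lambda>g. card (T n g)) ` {1..G n}))" by (rule of_nat_mono)
        then show ?thesis using elim(5) by simp
      qed
      have "1 - (5 * \<eta> + (4 * (1 + Bm) + 4 * X) / B + ?b s) \<le> ?P n"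
        by (rule deviation_tail[OF elim(8) model x_integrable ww_integrable \<kappa>_measurable \<kappa>_symmetric exogeneity card
              elim(4)[folded clip[of b4], folded X_def] nn(3) nn(1) nn(2) B(1,2,3) \<eta>(2,3) s(1) \<epsilon>
              elim(1)[folded clip[of b1], folded Bm_def] elim(2) elim(3)[folded clip[of b3], folded Bk_def]
              less_imp_le[OF elim(7)] less_imp_le[OF elim(6)]])
      moreover have "5 * \<eta> + (4 * (1 + Bm) + 4 * X) / B + ?b s \<le> 5 * \<eta> + \<eta> + \<eta>"
        by (intro add_mono order.refl Bq s(2))
      moreover have "5 * \<eta> + \<eta> + \<eta> = \<zeta>" by (simp add: \<eta>_def)
      ultimately show "1 - \<zeta> \<le> ?P n" by simp
    qed
  qed
  show ?thesis
    unfolding null_in_prob_def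
  proof (intro allI impI order_tendstoI)
    fix \<epsilon> a :: real assume "0 < \<epsilon>" "a < 1"
    \<comment> \<open>The value is capped at 1 / 2 because \<open>eventually_good\<close> is
      available only below 1.\<close>
    let ?\<zeta> = "min ((1 - a) / 2) (1 / 2)"
    have \<zeta>: "0 < ?\<zeta>" "?\<zeta> < 1" using \<open>a < 1\<close> by (simp_all add: min_less_iff_disj)
    have "a < 1 - ?\<zeta>" using \<open>a < 1\<close> min.cobounded1[of "(1 - a) / 2" "1 / 2"] by argo
    then show "\<forall>\<^sub>F n in sequentially. a < measure (M n) {\<omega> \<in> space (M n). norm (
      Sigma_hat n (K n) (w n \<omega>) (x n \<omega>) (y n \<omega>) (G n) (T n) (\<kappa> n (w n \<omega>))
      - (1 / real n) *\<^sub>R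
          (\<Sum>g1=1..G n. \<Sum>g2=1..G n. \<Sum>g3=1..G n.
           \<Sum>i1\<in>T n g1. \<Sum>j1\<in>T n g1. \<Sum>i2\<in>T n g2. \<Sum>j2\<in>T n g2. \<Sum>i3\<in>T n g3. \<Sum>j3\<in>T n g3.
            (\<kappa> n (w n \<omega>) (g1, i1, j1) (g2, i2, j2)
             * annih n (K n) (w n \<omega>) i2 j3 * annih n (K n) (w n \<omega>) j2 i3
             * real_cond_exp (M n) (sigma_XW (M n) n (K n) (x n) (w n))
                 (\<lambda>\<omega>. u n \<omega> i3 * u n \<omega> j3) \<omega>)
            *\<^sub>R outer (partial_out n (K n) (w n \<omega>) (x n \<omega>) i1)
                      (partial_out n (K n) (w n \<omega>) (x n \<omega>) j1))) \<le> \<epsilon>}"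
      by (intro eventually_mono[OF eventually_good[OF \<open>0 < \<epsilon>\<close> \<zeta>]]) (rule less_le_trans)
  next
    \<comment> \<open>Probabilities never exceed 1, which settles the upper half of the
      limit.\<close>
    fix \<epsilon> a :: real assume "1 < a"
    then show "\<forall>\<^sub>F n in sequentially. measure (M n) (S n) < a" for S
      using prob_space.prob_le_1[OF prob] by (intro always_eventually allI) (rule le_less_trans)
  qed
qed

end
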